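(* Let $p>1$, $s\in(0,1)$, let $\Omega\subset\mathbb{R}^N$ be a bounded domain with $C^{1,1}$ boundary, and let $f:\mathbb{R}\to\mathbb{R}$ be of class $C^1$, nondecreasing, with $f(0)>0$ and $\lim_{t\to\infty}\frac{f(t)}{t^{p-1}}=\infty$. For $\lambda>0$ let $(P_\lambda)$ denote the problem $$(-\Delta)_p^s u=\lambda f(u)\ \text{in }\Omega,\qquad u>0\ \text{in }\Omega,\qquad u=0\ \text{in }\mathbb{R}^N\setminus\Omega.$$ Then there exists $\lambda^*\in(0,\infty)$ such that for every $\lambda\in(0,\lambda^* )$ the problem $(P_\lambda)$ has a bounded minimal solution $u_\lambda\in W_0^{s,p}(\Omega)$, which is also a stable solution. Moreover, $u_\lambda$ is nondecreasing in $\lambda$, and $(P_\lambda)$ has no bounded solution for $\lambda>\lambda^*$.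
   Context: Function space: $[u]_{s,p}=\left(\int_{\mathbb{R}^{2N}}\frac{|u(x)-u(y)|^p}{|x-y|^{N+sp}}\,dx\,dy\right)^{1/p}$, $W^{s,p}(\mathbb{R}^N)=\{u\in L^p(\mathbb{R}^N):[u]_{s,p}<\infty\}$, and $W_0^{s,p}(\Omega)=\{u\in W^{s,p}(\mathbb{R}^N): u=0 \text{ a.e. in }\mathbb{R}^N\setminus\Omega\}$ with norm $\|u\|_{W_0^{s,p}(\Omega)}=[u]_{s,p}$; $W_0^{s,p}(\Omega)^*$ is its dual. Operator: for $u,v\in W_0^{s,p}(\Omega)$, $\langle(-\Delta)_p^s u,v\rangle=\int_{\mathbb{R}^{2N}}\frac{J_u(x,y)(v(x)-v(y))}{|x-y|^{N+sp}}\,dx\,dy$ with $J_u(x,y)=|u(x)-u(y)|^{p-2}(u(x)-u(y))$ (read as $0$ when $u(x)=u(y)$). Weak solution: $u\in W_0^{s,p}(\Omega)$ is a (weak) solution of $(-\Delta)_p^su=g(x,u)$ in $\Omega$, $u=0$ in $\mathbb{R}^N\setminus\Omega$, if $g(x,u)\in W_0^{s,p}(\Omega)^*$ (i.e. for every $v\in W_0^{s,p}(\Omega)$, $g(x,u)v\in L^1(\Omega)$ and $|\int_\Omega g(x,u)v\,dx|\le C\|v\|_{W_0^{s,p}(\Omega)}$ with $C$ independent of $v$) and $\langle(-\Delta)_p^su,v\rangle=\int_\Omega g(x,u)v\,dx$ for all $v\in W_0^{s,p}(\Omega)$ with $v\ge0$. A solution of $(P_\lambda)$ is such a weak solution with $g(x,u)=\lambda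 f(u)$ and $u>0$ in $\Omega$; it is bounded if $u\in L^\infty(\Omega)$. A solution of $(P_\lambda)$ is minimal if it is $\le$ every solution of $(P_\lambda)$ a.e. in $\Omega$. Stability: for $u\in W_0^{s,p}(\Omega)$ let $\mathcal{T}_u(\Omega)=W_0^{s,p}(\Omega)$ if $p\ge2$, and, if $1<p<2$, $\mathcal{T}_u(\Omega)=\{\varphi\in W_0^{s,p}(\Omega): |\varphi(x)-\varphi(y)|\le C_\varphi|u(x)-u(y)|\text{ a.e. for some }C_\varphi>0\}$. A solution $u$ of $(P_\lambda)$ is stable if for all $\varphi\in\mathcal{T}_u(\Omega)$ $$(p-1)\int_{\mathbb{R}^{2N}}\frac{|u(x)-u(y)|^{p-2}(\varphi(x)-\varphi(y))^2}{|x-y|^{N+ps}}\,dx\,dy-\lambda\int_\Omega f'(u)\varphi^2\,dx\ge0,$$ where for $1<p<2$ the first integrand is read as $0$ where $u(x)=u(y)$, and the second integral is well defined in $[0,\infty]$ since $f'\ge0$. *)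

theory Defs
  imports "HOL-Analysis.Analysis"
begin

text \<open>
  Euclidean space \<open>\<real>\<^sup>N\<close> is an arbitrary type of class \<^class>\<open>euclidean_space\<close>, with
  \<open>N = DIM('a)\<close>.  Elements of \<open>L\<^sup>p\<close> and Sobolev spaces are represented by Lebesgue measurable
  functions on the whole space, so pointwise relations between them are stated almost everywhere.
\<close>

text \<open>
  Near each boundary point, \<open>\<Omega>\<close> is the strict epigraph, in the direction of a unit vector \<open>e\<close>, of a
  \<open>C\<^sup>1\<^sup>,\<^sup>1\<close> function of the coordinates orthogonal to \<open>e\<close>.  The function \<open>\<gamma>\<close> is defined on the
  whole space but evaluated only at orthogonal projections onto the hyperplane \<open>e\<^sup>\<bottom>\<close>; this is no
  restriction, since a \<open>C\<^sup>1\<^sup>,\<^sup>1\<close> function on the hyperplane extends by composition with the projection.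
\<close>

definition C11_function :: "('a::euclidean_space \<Rightarrow> real) \<Rightarrow> bool" where
  "C11_function \<gamma> \<longleftrightarrow>
     (\<exists>G L. (\<forall>x. (\<gamma> has_derivative (\<lambda>h. G x \<bullet> h)) (at x)) \<and> L-lipschitz_on UNIV G)"

definition C11_boundary :: "'a::euclidean_space set \<Rightarrow> bool" where
  "C11_boundary \<Omega> \<longleftrightarrow>
     (\<forall>x0\<in>frontier \<Omega>. \<exists>r>0. \<exists>e \<gamma>. norm e = 1 \<and> C11_function \<gamma> \<and>
        \<Omega> \<inter> ball x0 r = {x \<in> ball x0 r. \<gamma> (x - (x \<bullet> e) *\<^sub>R e) < x \<bullet> e})"

definition bounded_C11_domain :: "'a::euclidean_space set \<Rightarrow> bool" where
  "bounded_C11_domain \<Omega> \<longleftrightarrow>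
     open \<Omega> \<and> connected \<Omega> \<and> \<Omega> \<noteq> {} \<and> bounded \<Omega> \<and> C11_boundary \<Omega>"

text \<open>
  On the diagonal the quotients below are \<open>0\<close> by the convention \<open>x / 0 = 0\<close>; the diagonal is a null set.
\<close>

definition gagliardo_integrand ::
    "real \<Rightarrow> real \<Rightarrow> ('a::euclidean_space \<Rightarrow> real) \<Rightarrow> 'a \<times> 'a \<Rightarrow> real" where
  "gagliardo_integrand s p u =
     (\<lambda>(x, y). \<bar>u x - u y\<bar> powr p / norm (x - y) powr (real DIM('a) + s * p))"

definition gagliardo :: "real \<Rightarrow> real \<Rightarrow> ('a::euclidean_space \<Rightarrow> real) \<Rightarrow> real" where
  "gagliardo s p u = (LINT z|lebesgue. gagliardo_integrand s p u z) powr (1 / p)"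

text \<open>Finiteness of \<open>\<parallel>u\<parallel>\<^sub>p\<close> and \<open>[u]\<^sub>s\<^sub>,\<^sub>p\<close> is integrability of the (nonnegative) integrands.\<close>

definition Wsp :: "real \<Rightarrow> real \<Rightarrow> ('a::euclidean_space \<Rightarrow> real) set" where
  "Wsp s p = {u \<in> borel_measurable lebesgue.
     integrable lebesgue (\<lambda>x. \<bar>u x\<bar> powr p) \<and> integrable lebesgue (gagliardo_integrand s p u)}"

definition Wsp0 :: "real \<Rightarrow> real \<Rightarrow> 'a::euclidean_space set \<Rightarrow> ('a \<Rightarrow> real) set" where
  "Wsp0 s p \<Omega> = {u \<in> Wsp s p. AE x in lebesgue. x \<notin> \<Omega> \<longrightarrow> u x = 0}"

text \<open>Here \<open>0 powr a = 0\<close> for every \<open>a\<close>, so \<open>J\<^sub>u\<close> vanishes where \<open>u x = u y\<close>.\<close>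

definition J :: "real \<Rightarrow> ('a \<Rightarrow> real) \<Rightarrow> 'a \<Rightarrow> 'a \<Rightarrow> real" where
  "J p u x y = \<bar>u x - u y\<bar> powr (p - 2) * (u x - u y)"

definition frac_p_laplacian ::
    "real \<Rightarrow> real \<Rightarrow> ('a::euclidean_space \<Rightarrow> real) \<Rightarrow> ('a \<Rightarrow> real) \<Rightarrow> real" where
  "frac_p_laplacian s p u v =
     (LINT (x, y)|lebesgue. J p u x y * (v x - v y) / norm (x - y) powr (real DIM('a) + s * p))"

definition in_dual_Wsp0 ::
    "real \<Rightarrow> real \<Rightarrow> 'a::euclidean_space set \<Rightarrow> ('a \<Rightarrow> real) \<Rightarrow> bool" where
  "in_dual_Wsp0 s p \<Omega> h \<longleftrightarrow>
     (\<forall>v\<in>Wsp0 s p \<Omega>. set_integrable lebesgue \<Omega> (\<lambda>x. h x * v x)) \<and>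
     (\<exists>C. \<forall>v\<in>Wsp0 s p \<Omega>. \<bar>LINT x:\<Omega>|lebesgue. h x * v x\<bar> \<le> C * gagliardo s p v)"

definition weak_solution ::
    "real \<Rightarrow> real \<Rightarrow> 'a::euclidean_space set \<Rightarrow> ('a \<Rightarrow> real \<Rightarrow> real) \<Rightarrow> ('a \<Rightarrow> real) \<Rightarrow> bool" where
  "weak_solution s p \<Omega> g u \<longleftrightarrow>
     u \<in> Wsp0 s p \<Omega> \<and> in_dual_Wsp0 s p \<Omega> (\<lambda>x. g x (u x)) \<and>
     (\<forall>v\<in>Wsp0 s p \<Omega>. (AE x in lebesgue. 0 \<le> v x) \<longrightarrow>
        frac_p_laplacian s p u v = (LINT x:\<Omega>|lebesgue. g x (u x) * v x))"

definition solution_P ::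
    "real \<Rightarrow> real \<Rightarrow> 'a::euclidean_space set \<Rightarrow> (real \<Rightarrow> real) \<Rightarrow> real \<Rightarrow> ('a \<Rightarrow> real) \<Rightarrow> bool" where
  "solution_P s p \<Omega> f lam u \<longleftrightarrow>
     weak_solution s p \<Omega> (\<lambda>x t. lam * f t) u \<and> (AE x in lebesgue. x \<in> \<Omega> \<longrightarrow> 0 < u x)"

definition essentially_bounded_on :: "'a::euclidean_space set \<Rightarrow> ('a \<Rightarrow> real) \<Rightarrow> bool" where
  "essentially_bounded_on \<Omega> u \<longleftrightarrow> (\<exists>M. AE x in lebesgue. x \<in> \<Omega> \<longrightarrow> \<bar>u x\<bar> \<le> M)"

definition minimal_solution_P ::
    "real \<Rightarrow> real \<Rightarrow> 'a::euclidean_space set \<Rightarrow> (real \<Rightarrow> real) \<Rightarrow> real \<Rightarrow> ('a \<Rightarrow> real) \<Rightarrow> bool" where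
  "minimal_solution_P s p \<Omega> f lam u \<longleftrightarrow>
     solution_P s p \<Omega> f lam u \<and>
     (\<forall>v. solution_P s p \<Omega> f lam v \<longrightarrow> (AE x in lebesgue. x \<in> \<Omega> \<longrightarrow> u x \<le> v x))"

definition stability_test_space ::
    "real \<Rightarrow> real \<Rightarrow> 'a::euclidean_space set \<Rightarrow> ('a \<Rightarrow> real) \<Rightarrow> ('a \<Rightarrow> real) set" where
  "stability_test_space s p \<Omega> u =
     (if 2 \<le> p then Wsp0 s p \<Omega>
      else {\<phi> \<in> Wsp0 s p \<Omega>.
              \<exists>C>0. AE (x, y) in lebesgue. \<bar>\<phi> x - \<phi> y\<bar> \<le> C * \<bar>u x - u y\<bar>})"

text \<open>
  The weight \<open>\<bar>u x - u y\<bar>\<^sup>p\<^sup>-\<^sup>2\<close>.  Because \<open>0 powr 0 = 0\<close>, the case \<open>p = 2\<close>, where the weight is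
  identically \<open>1\<close>, is separate.  For \<open>p < 2\<close> it is \<open>0\<close> where \<open>u x = u y\<close>.
\<close>

definition stability_weight :: "real \<Rightarrow> ('a \<Rightarrow> real) \<Rightarrow> 'a \<Rightarrow> 'a \<Rightarrow> real" where
  "stability_weight p u x y = (if p = 2 then 1 else \<bar>u x - u y\<bar> powr (p - 2))"

text \<open>
  Both integrands below are nonnegative and both integrals are taken in \<open>[0,\<infinity>]\<close>; the first one is
  always finite for \<open>\<phi>\<close> in the test space, so the difference is a meaningful extended real.
\<close>

definition stable_solution_P ::
    "real \<Rightarrow> real \<Rightarrow> 'a::euclidean_space set \<Rightarrow> (real \<Rightarrow> real) \<Rightarrow> real \<Rightarrow> ('a \<Rightarrow> real) \<Rightarrow> bool" where
  "stable_solution_P s p \<Omega> f lam u \<longleftrightarrow>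
     solution_P s p \<Omega> f lam u \<and>
     (\<forall>\<phi>\<in>stability_test_space s p \<Omega> u.
        ereal (p - 1) * enn2ereal (\<integral>\<^sup>+ (x, y). ennreal (stability_weight p u x y * (\<phi> x - \<phi> y)\<^sup>2
              / norm (x - y) powr (real DIM('a) + p * s)) \<partial>lebesgue)
        - ereal lam * enn2ereal (\<integral>\<^sup>+ x\<in>\<Omega>. ennreal (deriv f (u x) * (\<phi> x)\<^sup>2) \<partial>lebesgue) \<ge> 0)"

end

theory Submission
  imports Defs
begin

text \<open>
  Write \<open>E\<^sub>h(v) = [v]\<^sup>p / p - \<integral> h v\<close>.  Since \<open>\<bar>t\<bar>\<^sup>p\<close> is convex, \<open>E\<^sub>h\<close> is submodular for the pointwise maximum
  and minimum, and truncating \<open>v\<close> to \<open>[0, M]\<close> lowers \<open>E\<^sub>h\<close> as soon as \<open>0 \<le> h \<le> c\<^sub>0 M\<^sup>p\<^sup>-\<^sup>1\<close>, because the points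
  of \<open>\<Omega>\<close> interact with a far away ball on which \<open>v\<close> vanishes.  Submodularity turns a minimising
  sequence into monotone ones, so minimisers exist without any weak compactness, are bounded, and are
  compared with supersolutions by the same interaction.

  The iteration \<open>u\<^sub>0 = 0\<close>, \<open>(-\<Delta>)\<^sub>p\<^sup>s u\<^sub>n\<^sub>+\<^sub>1 = \<lambda> f(u\<^sub>n)\<close> increases and stays below every solution for a parameter
  \<open>\<mu> \<ge> \<lambda>\<close>, and below \<open>1\<close> for small \<open>\<lambda>\<close>; a bounded limit is the minimal solution.  Picone's inequality bounds
  the set of \<open>\<lambda>\<close> admitting a bounded solution, and \<open>\<lambda>\<^sup>*\<close> is its supremum.  For stability, replacing a
  competitor \<open>v \<le> u\<close> by \<open>max(v, u\<^sub>n)\<close> successively never increases the full energy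
  \<open>[v]\<^sup>p / p - \<lambda> \<integral> F(v)\<close>; hence \<open>u\<close> minimises it among all \<open>v \<le> u\<close>, and the second-order expansion at \<open>u - t\<bar>\<phi>\<bar>\<close>
  gives the inequality.
\<close>

section \<open>The function \<open>\<bar>t\<bar>\<^sup>p\<close>\<close>

text \<open>Two obstacles shape the stability part. The limit u is known to minimise only among
  functions below it, so \<phi> is replaced by |\<phi>|: this keeps \<phi>^2 and shrinks all
  differences. And for p < 2 the weight |u(x) - u(y)|^{p-2} is singular, so the energy is not
  differentiated twice; the inequality between u and u - t|\<phi>| is divided by t^2 after its
  first-order terms have cancelled. As t tends to 0, the double integral converges by dominated
  convergence, for p < 2 exactly because |\<phi>(x) - \<phi>(y)| \<le> C |u(x) - u(y)|, and the
  integral over the domain is handled by Fatou's lemma, which asks for no integrability of f'(u)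
  \<phi>^2 in advance. Strict positivity is an energy comparison as well: lifting u to max(u, e
  \<phi>) gains a term linear in e, because f(0) > 0, and costs at most a multiple of e^p with p >
  1.\<close>

definition jp :: "real \<Rightarrow> real \<Rightarrow> real" where
  "jp p t = \<bar>t\<bar> powr (p - 2) * t"

lemma jp_0 [simp]: "jp p 0 = 0"
  by (simp add: jp_def)

lemma jp_minus: "jp p (- t) = - jp p t"
  by (simp add: jp_def)

lemma jp_nonneg_eq: "0 \<le> t \<Longrightarrow> jp p t = t powr (p - 1)"
  using powr_mult_base[of t "p - 2"] by (simp add: jp_def mult.commute)

lemma abs_jp: "\<bar>jp p t\<bar> = \<bar>t\<bar> powr (p - 1)"
  using jp_nonneg_eq[of "\<bar>t\<bar>" p] by (simp add: jp_def abs_mult)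

lemma jp_mult_self: "jp p t * t = \<bar>t\<bar> powr p"
proof (cases "t = 0")
  case False
  have "jp p t * t = \<bar>t\<bar> powr (p - 2) * (\<bar>t\<bar> powr 2)"
    using False by (simp add: jp_def power2_eq_square)
  also have "\<dots> = \<bar>t\<bar> powr p"
    by (simp only: powr_add[symmetric]) simp
  finally show ?thesis .
qed simp

lemma jp_strict_mono:
  assumes "1 < p" "a < b"
  shows "jp p a < jp p b"
proof -
  consider "0 \<le> a" | "a < 0" "0 \<le> b" | "b < 0" using assms by linarith
  then show ?thesis
  proof cases
    case 1
    then show ?thesis using assms by (simp add: jp_nonneg_eq powr_less_mono2)
  next
    case 2
    then have "jp p a < 0" "0 \<le> jp p b"
      using assms by (auto simp: jp_def mult_pos_neg)
    then show ?thesis by linarith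
  next
    case 3
    have "jp p (- b) < jp p (- a)"
      using 3 assms by (simp add: jp_nonneg_eq powr_less_mono2 del: jp_minus)
    then show ?thesis by (simp add: jp_minus)
  qed
qed

lemma jp_mono: "1 < p \<Longrightarrow> a \<le> b \<Longrightarrow> jp p a \<le> jp p b"
  using jp_strict_mono[of p a b] by (cases "a = b") auto

lemma isCont_jp:
  assumes "1 < p"
  shows "isCont (jp p) t"
proof -
  \<comment> \<open>For p < 2 the factor |t|^{p-2} is unbounded at 0, so continuity cannot be read
    off the product; the positive and negative parts carry the positive exponent p - 1.\<close>
  have eq: "jp p = (\<lambda>t. (max t 0) powr (p - 1) - (max (- t) 0) powr (p - 1))"
  proof
    fix t :: real
    show "jp p t = (max t 0) powr (p - 1) - (max (- t) 0) powr (p - 1)"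
      using jp_nonneg_eq[of t p] jp_nonneg_eq[of "- t" p]
      by (cases "0 \<le> t") (auto simp: jp_minus max_def)
  qed
  have "continuous_on UNIV (jp p)"
    unfolding eq using assms by (intro continuous_intros continuous_on_powr') auto
  then show ?thesis by (simp add: continuous_on_eq_continuous_at)
qed

lemma borel_measurable_jp [measurable]: "jp p \<in> borel_measurable borel"
  unfolding jp_def by measurable

lemma max_powr_le: "0 \<le> (p::real) \<Longrightarrow> (max \<bar>a\<bar> \<bar>b\<bar>) powr p \<le> \<bar>a\<bar> powr p + \<bar>b\<bar> powr p"
  by (auto simp: max_def)

lemma abs_jp_mult_le:
  assumes "1 < p"
  shows "\<bar>jp p a * b\<bar> \<le> \<bar>a\<bar> powr p + \<bar>b\<bar> powr p"
proof -
  let ?m = "max \<bar>a\<bar> \<bar>b\<bar>"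
  have "\<bar>jp p a * b\<bar> \<le> ?m powr (p - 1) * ?m"
    unfolding abs_mult abs_jp using assms by (intro mult_mono powr_mono2) auto
  also have "\<dots> = ?m powr p"
    using jp_mult_self[of p ?m] jp_nonneg_eq[of ?m p] by (simp add: max_def)
  also have "\<dots> \<le> \<bar>a\<bar> powr p + \<bar>b\<bar> powr p" using assms by (intro max_powr_le) auto
  finally show ?thesis .
qed

text \<open>Young's inequality for \<open>jp p c * a\<close> with conjugate exponents p and p / (p -
  1). This tangent inequality is the convexity behind submodularity, truncation, Picone's inequality
  and the subgradient property of \<open>A\<close>.\<close>

lemma powr_tangent:
  assumes "1 < p"
  shows "\<bar>c\<bar> powr p + p * jp p c * (a - c) \<le> \<bar>a\<bar> powr p"
proof -
  define q where "q = p / (p - 1)"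
  have q: "q > 1" "1 / p + 1 / q = 1" "(p - 1) * q = p"
    using assms by (auto simp: q_def field_simps)
  have "jp p c * a \<le> \<bar>a\<bar> * \<bar>c\<bar> powr (p - 1)"
    by (metis abs_jp abs_ge_self abs_mult mult.commute)
  also have "\<dots> \<le> \<bar>a\<bar> powr p / p + (\<bar>c\<bar> powr (p - 1)) powr q / q"
    using assms q by (intro Youngs_inequality) auto
  also have "(\<bar>c\<bar> powr (p - 1)) powr q = \<bar>c\<bar> powr p"
    by (simp add: powr_powr q)
  also have "\<bar>a\<bar> powr p / p + \<bar>c\<bar> powr p / q = (\<bar>a\<bar> powr p + (p - 1) * \<bar>c\<bar> powr p) / p"
    using assms by (simp add: q_def field_simps)
  finally have "p * (jp p c * a) \<le> \<bar>a\<bar> powr p + (p - 1) * \<bar>c\<bar> powr p"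
    using assms by (simp add: field_simps)
  moreover have "p * jp p c * (a - c) = p * (jp p c * a) - p * (jp p c * c)"
    by (simp add: algebra_simps)
  then have "p * jp p c * (a - c) = p * (jp p c * a) - p * \<bar>c\<bar> powr p"
    by (simp only: jp_mult_self)
  ultimately show ?thesis by (simp only: left_diff_distrib)
qed

text \<open>Convexity: pulling two points together at fixed sum lowers the sum of the values. The
  tangents at x and y, evaluated at a and b, leave p (jp x - jp y)(a - x), which is nonnegative when
  y \<le> x; the other order is symmetric.\<close>

lemma powr_swap:
  fixes a b x y p :: real
  assumes "1 < p" "b \<le> x" "x \<le> a" "x + y = a + b"
  shows "\<bar>x\<bar> powr p + \<bar>y\<bar> powr p \<le> \<bar>a\<bar> powr p + \<bar>b\<bar> powr p"
proof -
  have *: "\<bar>x\<bar> powr p + \<bar>y\<bar> powr p \<le> \<bar>a\<bar> powr p + \<bar>b\<bar> powr p"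
    if "y \<le> x" "x \<le> a" "x + y = a + b" for x y
  proof -
    have "0 \<le> p * ((jp p x - jp p y) * (a - x))"
      using that jp_mono[OF assms(1) that(1)] assms(1) by auto
    then have "0 \<le> p * jp p x * (a - x) - p * jp p y * (a - x)" by (simp add: algebra_simps)
    moreover have "b - y = - (a - x)" using that by simp
    then have "p * jp p y * (b - y) = - (p * jp p y * (a - x))" by (simp only: mult_minus_right)
    ultimately show ?thesis
      using powr_tangent[OF assms(1), of x a] powr_tangent[OF assms(1), of y b] by linarith
  qed
  show ?thesis using *[of y x] *[of x y] assms by linarith
qed

text \<open>If a - c and b - d have the same sign, maximum and minimum merely permute the two
  differences. If the signs are opposite, the new differences have the same sum and lie between the
  old ones, so \<open>powr_swap\<close> applies.\<close>

lemma powr_submodular: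
  fixes a b c d :: real
  assumes "1 < p"
  shows "\<bar>max a c - max b d\<bar> powr p + \<bar>min a c - min b d\<bar> powr p
    \<le> \<bar>a - b\<bar> powr p + \<bar>c - d\<bar> powr p"
proof -
  consider "c \<le> a" "d \<le> b" | "a \<le> c" "b \<le> d" | "c \<le> a" "b \<le> d" | "a \<le> c" "d \<le> b"
    by linarith
  then show ?thesis
  proof cases
    case 3
    then show ?thesis using powr_swap[OF assms, of "c - d" "a - d" "a - b" "c - b"] by simp
  next
    case 4
    then show ?thesis using powr_swap[OF assms, of "a - b" "c - b" "c - d" "a - d"] by simp
  qed (simp_all add: max_absorb1 max_absorb2 min_absorb1 min_absorb2)
qed

lemma powr_sum_le:
  fixes a b p :: real
  assumes "0 \<le> p" "0 \<le> a" "0 \<le> b"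
  shows "(a + b) powr p \<le> 2 powr p * (a powr p + b powr p)"
proof -
  have "(a + b) powr p \<le> (2 * max a b) powr p" using assms by (intro powr_mono2) auto
  also have "\<dots> = 2 powr p * (max a b) powr p" using assms by (simp add: powr_mult)
  also have "\<dots> \<le> 2 powr p * (a powr p + b powr p)" by (auto simp: max_def)
  finally show ?thesis .
qed



section \<open>Derivatives of |t|^p and its second-order remainder\<close>

lemma DERIV_abs_powr:
  assumes "1 < p"
  shows "((\<lambda>t. \<bar>t\<bar> powr p) has_real_derivative p * jp p c) (at c)"
  unfolding has_field_derivative_iff
proof (rule Lim_transform)
  \<comment> \<open>The tangents at c and at a squeeze the difference quotient between
    \<open>p * jp p c\<close> and \<open>p * jp p a\<close>; continuity of \<open>jp\<close> then
    finishes, with no separate treatment of c = 0.\<close>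
  have *: "\<bar>(\<bar>a\<bar> powr p - \<bar>c\<bar> powr p) / (a - c) - p * jp p c\<bar> \<le> p * \<bar>jp p a - jp p c\<bar>"
    if "a \<noteq> c" for a
  proof -
    let ?q = "(\<bar>a\<bar> powr p - \<bar>c\<bar> powr p) / (a - c)"
    have q: "?q * (a - c) = \<bar>a\<bar> powr p - \<bar>c\<bar> powr p" using that by simp
    have 1: "p * jp p c * (a - c) \<le> ?q * (a - c)"
      unfolding q using powr_tangent[OF assms, of c a] by (simp add: algebra_simps)
    have 2: "?q * (a - c) \<le> p * jp p a * (a - c)"
      unfolding q using powr_tangent[OF assms, of a c] by (simp add: algebra_simps)
    show ?thesis
    proof (cases "c < a")
      case True
      then have "p * jp p c \<le> ?q" "?q \<le> p * jp p a"
        using 1 2 by (auto simp only: mult_le_cancel_right)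
      then have "\<bar>?q - p * jp p c\<bar> \<le> p * (jp p a - jp p c)" by (simp add: algebra_simps)
      also have "\<dots> \<le> p * \<bar>jp p a - jp p c\<bar>" using assms by (intro mult_left_mono) auto
      finally show ?thesis .
    next
      case False
      then have "a < c" using that by simp
      then have "?q \<le> p * jp p c" "p * jp p a \<le> ?q"
        using 1 2 by (auto simp only: mult_le_cancel_right)
      then have "\<bar>?q - p * jp p c\<bar> \<le> p * - (jp p a - jp p c)" by (simp add: algebra_simps)
      also have "\<dots> \<le> p * \<bar>jp p a - jp p c\<bar>" using assms by (intro mult_left_mono) auto
      finally show ?thesis .
    qed
  qed
  have "((\<lambda>a. p * \<bar>jp p a - jp p c\<bar>) \<longlongrightarrow> p * \<bar>jp p c - jp p c\<bar>) (at c)"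
    using isCont_jp[OF assms, of c] unfolding isCont_def by (intro tendsto_intros)
  then show "((\<lambda>a. (\<bar>a\<bar> powr p - \<bar>c\<bar> powr p) / (a - c) - p * jp p c) \<longlongrightarrow> 0) (at c)"
    unfolding diff_self abs_zero mult_zero_right
    by (rule Lim_null_comparison[rotated]) (use * in \<open>auto simp: eventually_at_filter\<close>)
qed simp

lemma DERIV_jp:
  assumes "1 < p" "2 \<le> p \<or> t \<noteq> 0"
  shows "(jp p has_real_derivative (p - 1) * (if p = 2 then 1 else \<bar>t\<bar> powr (p - 2))) (at t)"
proof -
  consider "p = 2" | "p \<noteq> 2" "0 < t" | "p \<noteq> 2" "t < 0" | "2 < p" "t = 0" using assms by fastforce
  then show ?thesis
  proof cases
    case 1
    then have "jp p = (\<lambda>t. t)" by (auto simp: jp_def)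
    then show ?thesis using 1 by simp
  next
    case 2
    have "((\<lambda>t. t powr (p - 1)) has_real_derivative (p - 1) * t powr (p - 1 - 1)) (at t)"
      using 2 by (auto intro!: derivative_eq_intros)
    then have "(jp p has_real_derivative (p - 1) * t powr (p - 1 - 1)) (at t)"
      by (rule has_field_derivative_transform_within_open[of _ _ _ "{0<..}"])
         (use 2 in \<open>auto simp: jp_nonneg_eq\<close>)
    then show ?thesis using 2 by simp
  next
    case 3
    have "((\<lambda>t. - ((- t) powr (p - 1))) has_real_derivative (p - 1) * (- t) powr (p - 1 - 1)) (at t)"
      using 3 by (auto intro!: derivative_eq_intros)
    then have "(jp p has_real_derivative (p - 1) * (- t) powr (p - 1 - 1)) (at t)"
      by (rule has_field_derivative_transform_within_open[of _ _ _ "{..<0}"])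
         (use 3 jp_minus[of p] in \<open>auto simp: jp_nonneg_eq[symmetric]\<close>)
    then show ?thesis using 3 by simp
  next
    case 4
    have "((\<lambda>h. \<bar>h\<bar> powr (p - 2)) \<longlongrightarrow> \<bar>0\<bar> powr (p - 2)) (at (0::real))"
      using 4 by (intro tendsto_powr') (auto intro!: tendsto_eq_intros)
    then have "((\<lambda>h. \<bar>h\<bar> powr (p - 2)) \<longlongrightarrow> 0) (at (0::real))" by simp
    then have "((\<lambda>h. (jp p h - jp p 0) / (h - 0)) \<longlongrightarrow> 0) (at 0)"
      by (rule Lim_transform_eventually) (auto simp: jp_def eventually_at_filter)
    then show ?thesis using 4 by (simp add: has_field_derivative_iff)
  qed
qed

text \<open>Remainder of the first-order expansion of |.|^p at a in the direction -b, divided by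
  t^2. The sign of the direction is that of the competitors u - t \<phi>.\<close>

definition taylor_rem :: "real \<Rightarrow> real \<Rightarrow> real \<Rightarrow> real \<Rightarrow> real" where
  "taylor_rem p a b t = (\<bar>a - t * b\<bar> powr p - \<bar>a\<bar> powr p + p * t * jp p a * b) / t\<^sup>2"

lemma taylor_rem_nonneg:
  assumes "1 < p"
  shows "0 \<le> taylor_rem p a b t"
  using powr_tangent[OF assms, of a "a - t * b"]
  by (simp add: taylor_rem_def algebra_simps)

text \<open>Cauchy's mean value theorem against t^2. It turns the second-order remainder of F into a
  difference quotient of g = F' without asking g to be differentiable, which \<open>jp\<close> is
  not at 0 when p < 2.\<close>

lemma second_order_mvt:
  fixes F g :: "real \<Rightarrow> real"
  assumes F: "\<And>x. (F has_real_derivative g x) (at x)" and t: "0 < t"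
  obtains r where "0 < r" "r < t"
    "(F (a - t * b) - F a + t * g a * b) / t\<^sup>2 = b * ((g a - g (a - r * b)) / r) / 2"
proof -
  define Q where "Q = (\<lambda>t. F (a - t * b) - F a + t * g a * b)"
  have dQ: "(Q has_real_derivative b * (g a - g (a - t * b))) (at t)" for t
    unfolding Q_def
    by (rule derivative_eq_intros DERIV_chain2[OF F] refl)+ (simp add: algebra_simps)
  have "\<exists>r. 0 < r \<and> r < t \<and> (Q t - Q 0) * (2 * r) = (t\<^sup>2 - 0\<^sup>2) * (b * (g a - g (a - r * b)))"
    by (rule GMVT'[OF t]) (auto intro!: DERIV_isCont[OF dQ] dQ derivative_eq_intros)
  then obtain r where r: "0 < r" "r < t" "(Q t - Q 0) * (2 * r) = (t\<^sup>2 - 0\<^sup>2) * (b * (g a - g (a - r * b)))"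
    by blast
  have "Q t / t\<^sup>2 = b * ((g a - g (a - r * b)) / r) / 2"
    using r t by (simp add: Q_def field_simps)
  then show ?thesis using that r unfolding Q_def by blast
qed

text \<open>A derivative of g is required at the single point a, and just for nonzero b. For p < 2
  this accommodates the pairs with u(x) = u(y), where \<open>jp\<close> is not differentiable but
  the test function has equal values almost everywhere.\<close>

lemma second_order_tendsto:
  fixes F g :: "real \<Rightarrow> real"
  assumes F: "\<And>x. (F has_real_derivative g x) (at x)" and g: "b \<noteq> 0 \<Longrightarrow> (g has_real_derivative D) (at a)"
    and t: "\<And>n. 0 < t n" "t \<longlonglongrightarrow> 0"
  shows "(\<lambda>n. (F (a - t n * b) - F a + t n * g a * b) / (t n)\<^sup>2) \<longlonglongrightarrow> D * b\<^sup>2 / 2"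
proof (cases "b = 0")
  case False
  have "\<exists>r. 0 < r \<and> r < t n \<and> (F (a - t n * b) - F a + t n * g a * b) / (t n)\<^sup>2 = b * ((g a - g (a - r * b)) / r) / 2" for n
    using second_order_mvt[OF F t(1)[of n], of a b] by metis
  then obtain r where r: "\<And>n. 0 < r n" "\<And>n. r n < t n"
    "\<And>n. (F (a - t n * b) - F a + t n * g a * b) / (t n)\<^sup>2 = b * ((g a - g (a - r n * b)) / r n) / 2" by metis
  have r0: "r \<longlonglongrightarrow> 0"
    by (rule tendsto_sandwich[OF _ _ tendsto_const t(2)])
       (use r(1,2) in \<open>auto intro: less_imp_le always_eventually\<close>)
  have lim: "((\<lambda>y. (g y - g a) / (y - a)) \<longlongrightarrow> D) (at a)"
    using g[OF False] by (simp add: has_field_derivative_iff)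
  have "filterlim (\<lambda>n. a - r n * b) (at a) sequentially"
    unfolding filterlim_at using r(1) False
    by (auto intro!: tendsto_eq_intros r0 simp: less_le)
  from filterlim_compose[OF lim this]
  have "(\<lambda>n. (g (a - r n * b) - g a) / (a - r n * b - a)) \<longlonglongrightarrow> D" .
  then have "(\<lambda>n. b\<^sup>2 / 2 * ((g (a - r n * b) - g a) / (a - r n * b - a))) \<longlonglongrightarrow> b\<^sup>2 / 2 * D"
    by (intro tendsto_intros)
  moreover have "b\<^sup>2 / 2 * ((g (a - r n * b) - g a) / (a - r n * b - a))
      = (F (a - t n * b) - F a + t n * g a * b) / (t n)\<^sup>2" for n
    unfolding r(3) using r(1)[of n] False by (simp add: field_simps power2_eq_square)
  ultimately show ?thesis by (simp add: mult.commute)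
qed simp

lemma taylor_rem_mvt:
  assumes "1 < p" "0 < t"
  obtains r where "0 < r" "r < t" "taylor_rem p a b t = p * b * ((jp p a - jp p (a - r * b)) / r) / 2"
proof -
  obtain r where "0 < r" "r < t" "(\<bar>a - t * b\<bar> powr p - \<bar>a\<bar> powr p + t * (p * jp p a) * b) / t\<^sup>2
      = b * ((p * jp p a - p * jp p (a - r * b)) / r) / 2"
    using second_order_mvt[OF DERIV_abs_powr[OF assms(1)] assms(2)] .
  then show ?thesis
    using that[of r] by (simp add: taylor_rem_def right_diff_distrib[symmetric] mult_ac)
qed

lemma taylor_rem_tendsto:
  assumes p: "1 < p" "2 \<le> p \<or> a \<noteq> 0 \<or> b = 0" and t: "\<And>n. 0 < t n" "t \<longlonglongrightarrow> 0"
  shows "(\<lambda>n. taylor_rem p a b (t n)) \<longlonglongrightarrow> p * (p - 1) / 2 * ((if p = 2 then 1 else \<bar>a\<bar> powr (p - 2)) * b\<^sup>2)"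
proof -
  define D where "D = (p - 1) * (if p = 2 then 1 else \<bar>a\<bar> powr (p - 2))"
  have "((\<lambda>x. p * jp p x) has_real_derivative p * D) (at a)" if "b \<noteq> 0"
    unfolding D_def using p that by (intro DERIV_cmult DERIV_jp) auto
  from second_order_tendsto[OF DERIV_abs_powr[OF p(1)] this t]
  have "(\<lambda>n. taylor_rem p a b (t n)) \<longlonglongrightarrow> p * D * b\<^sup>2 / 2"
    by (simp add: taylor_rem_def mult.assoc mult.left_commute[of p])
  moreover have "p * D * b\<^sup>2 / 2 = p * (p - 1) / 2 * ((if p = 2 then 1 else \<bar>a\<bar> powr (p - 2)) * b\<^sup>2)"
    by (simp add: D_def)
  ultimately show ?thesis by (simp only:)
qed

text \<open>Majorant for dominated convergence: a - r b stays in the ball of radius m = |a| + |b|,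
  where the derivative of \<open>jp\<close> is at most (p - 1) m^{p-2} since the exponent is
  nonnegative, and m^{p-2} b^2 \<le> m^p.\<close>

lemma taylor_rem_le_ge2:
  assumes p: "2 \<le> p" and t: "0 < t" "t \<le> 1"
  shows "taylor_rem p a b t \<le> p * (p - 1) / 2 * 2 powr p * (\<bar>a\<bar> powr p + \<bar>b\<bar> powr p)"
proof -
  obtain r where r: "0 < r" "r < t" "taylor_rem p a b t = p * b * ((jp p a - jp p (a - r * b)) / r) / 2"
    using taylor_rem_mvt[of p t a b] p t by auto
  let ?m = "\<bar>a\<bar> + \<bar>b\<bar>"
  have rb: "\<bar>r * b\<bar> \<le> \<bar>b\<bar>" using r t by (simp add: abs_mult mult_left_le_one_le)
  have in_ball: "a \<in> cball 0 ?m" "a - r * b \<in> cball 0 ?m" using rb by auto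
  have "norm (jp p a - jp p (a - r * b)) \<le> (p - 1) * (if p = 2 then 1 else ?m powr (p - 2)) * norm (a - (a - r * b))"
  proof (rule field_differentiable_bound[of "cball 0 ?m" _ _])
    show "(jp p has_field_derivative (p - 1) * (if p = 2 then 1 else \<bar>t\<bar> powr (p - 2))) (at t within cball 0 ?m)" for t
      using DERIV_jp[of p t] p by (auto intro: has_field_derivative_at_within)
    show "norm ((p - 1) * (if p = 2 then 1 else \<bar>t\<bar> powr (p - 2))) \<le> (p - 1) * (if p = 2 then 1 else ?m powr (p - 2))"
      if "t \<in> cball 0 ?m" for t
      using that p by (auto simp: abs_mult intro!: mult_left_mono powr_mono2)
  qed (use in_ball in auto)
  also have "norm (a - (a - r * b)) = r * \<bar>b\<bar>" using r by (simp add: abs_mult)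
  finally have "norm (jp p a - jp p (a - r * b)) / r \<le> (p - 1) * (if p = 2 then 1 else ?m powr (p - 2)) * \<bar>b\<bar>"
    using r by (simp add: field_simps)
  then have "\<bar>b * ((jp p a - jp p (a - r * b)) / r)\<bar> \<le> \<bar>b\<bar> * ((p - 1) * (if p = 2 then 1 else ?m powr (p - 2)) * \<bar>b\<bar>)"
    unfolding abs_mult using r(1) by (intro mult_left_mono) auto
  also have "\<dots> = (p - 1) * ((if p = 2 then 1 else ?m powr (p - 2)) * (\<bar>b\<bar> * \<bar>b\<bar>))" by simp
  also have "\<dots> \<le> (p - 1) * ?m powr p"
  proof (rule mult_left_mono)
    have "\<bar>b\<bar> * \<bar>b\<bar> \<le> ?m * ?m" by (intro mult_mono) auto
    then have "(if p = 2 then 1 else ?m powr (p - 2)) * (\<bar>b\<bar> * \<bar>b\<bar>) \<le> (if p = 2 then 1 else ?m powr (p - 2)) * (?m * ?m)"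
      by (intro mult_left_mono) auto
    also have "\<dots> = ?m powr p"
      using jp_mult_self[of p ?m] by (auto simp: jp_def mult.assoc power2_eq_square)
    finally show "(if p = 2 then 1 else ?m powr (p - 2)) * (\<bar>b\<bar> * \<bar>b\<bar>) \<le> ?m powr p" .
  qed (use p in auto)
  finally have "b * ((jp p a - jp p (a - r * b)) / r) \<le> (p - 1) * ?m powr p" by linarith
  from mult_left_mono[OF this, of "p / 2"]
  have "taylor_rem p a b t \<le> p / 2 * ((p - 1) * ?m powr p)"
    unfolding r(3) using p by (simp add: mult.assoc)
  also have "\<dots> \<le> p / 2 * ((p - 1) * (2 powr p * (\<bar>a\<bar> powr p + \<bar>b\<bar> powr p)))"
    using p by (intro mult_left_mono powr_sum_le) auto
  finally show ?thesis by (simp add: mult.assoc)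
qed

text \<open>The singularity of the derivative of \<open>jp\<close> at 0 is kept at a distance: |b|
  \<le> C |a| and t \<le> 1 / (2 C) confine a - r b to distance |a| / 2 from a, where |.|^{p-2} is
  at most (|a| / 2)^{p-2}.\<close>

lemma taylor_rem_le_less2:
  assumes p: "1 < p" "p < 2" and t: "0 < t" "t \<le> 1 / (2 * C)" and C: "0 < C" "\<bar>b\<bar> \<le> C * \<bar>a\<bar>"
  shows "taylor_rem p a b t \<le> p * (p - 1) / 2 * (1 / 2) powr (p - 2) * C\<^sup>2 * \<bar>a\<bar> powr p"
proof (cases "b = 0")
  case True
  then show ?thesis using p by (simp add: taylor_rem_def)
next
  case False
  then have a: "a \<noteq> 0" using C by auto
  obtain r where r: "0 < r" "r < t" "taylor_rem p a b t = p * b * ((jp p a - jp p (a - r * b)) / r) / 2"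
    using taylor_rem_mvt[of p t a b] p t by auto
  have "r * \<bar>b\<bar> \<le> 1 / (2 * C) * (C * \<bar>a\<bar>)" using r t C by (intro mult_mono) auto
  then have rb: "\<bar>r * b\<bar> \<le> \<bar>a\<bar> / 2" using C r by (simp add: abs_mult)
  let ?S = "cball a (\<bar>a\<bar> / 2)"
  have S: "\<bar>a\<bar> / 2 \<le> \<bar>x\<bar>" if "x \<in> ?S" for x using that abs_triangle_ineq[of "a - x" x] by (simp add: dist_real_def)
  have "norm (jp p a - jp p (a - r * b)) \<le> (p - 1) * (\<bar>a\<bar> / 2) powr (p - 2) * norm (a - (a - r * b))"
  proof (rule field_differentiable_bound[of ?S])
    show "(jp p has_field_derivative (p - 1) * \<bar>t\<bar> powr (p - 2)) (at t within ?S)" if "t \<in> ?S" for t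
      using DERIV_jp[of p t] p S[OF that] a by (auto intro: has_field_derivative_at_within)
    show "norm ((p - 1) * \<bar>t\<bar> powr (p - 2)) \<le> (p - 1) * (\<bar>a\<bar> / 2) powr (p - 2)"
      if "t \<in> ?S" for t
      using S[OF that] p a by (auto simp: abs_mult intro!: mult_left_mono powr_mono2')
  qed (use rb in \<open>auto simp: dist_real_def\<close>)
  also have "norm (a - (a - r * b)) = r * \<bar>b\<bar>" using r by (simp add: abs_mult)
  finally have "norm (jp p a - jp p (a - r * b)) / r \<le> (p - 1) * (\<bar>a\<bar> / 2) powr (p - 2) * \<bar>b\<bar>"
    using r by (simp add: field_simps)
  then have "\<bar>b * ((jp p a - jp p (a - r * b)) / r)\<bar> \<le> \<bar>b\<bar> * ((p - 1) * (\<bar>a\<bar> / 2) powr (p - 2) * \<bar>b\<bar>)"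
    unfolding abs_mult using r(1) by (intro mult_left_mono) auto
  also have "\<dots> = (p - 1) * (\<bar>a\<bar> / 2) powr (p - 2) * (\<bar>b\<bar> * \<bar>b\<bar>)" by simp
  also have "\<dots> \<le> (p - 1) * (\<bar>a\<bar> / 2) powr (p - 2) * ((C * \<bar>a\<bar>) * (C * \<bar>a\<bar>))"
    using p C by (intro mult_left_mono mult_mono) auto
  also have "\<dots> = (p - 1) * (1 / 2) powr (p - 2) * C\<^sup>2 * (\<bar>a\<bar> powr (p - 2) * (\<bar>a\<bar> * \<bar>a\<bar>))"
    using powr_mult[of "1/2" "\<bar>a\<bar>" "p - 2"] by (simp add: power2_eq_square)
  also have "\<bar>a\<bar> powr (p - 2) * (\<bar>a\<bar> * \<bar>a\<bar>) = \<bar>a\<bar> powr p"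
    using jp_mult_self[of p "\<bar>a\<bar>"] by (simp add: jp_def mult.assoc)
  finally have "b * ((jp p a - jp p (a - r * b)) / r) \<le> (p - 1) * (1 / 2) powr (p - 2) * C\<^sup>2 * \<bar>a\<bar> powr p"
    by linarith
  from mult_left_mono[OF this, of "p / 2"] show ?thesis unfolding r(3) using p by (simp add: mult.assoc)
qed

section \<open>Picone's inequality and regularity of its test function\<close>

lemma discrete_picone:
  assumes p: "1 < p" and ab: "0 < a" "0 < b" and cd: "0 \<le> c" "0 \<le> d"
  shows "jp p (a - b) * (c powr p / a powr (p - 1) - d powr p / b powr (p - 1)) \<le> \<bar>c - d\<bar> powr p"
proof -
  have *: "jp p (a - b) * (c powr p / a powr (p - 1) - d powr p / b powr (p - 1)) \<le> \<bar>c - d\<bar> powr p"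
    if ba: "b < a" "0 < b" and cd: "0 \<le> c" "0 \<le> d" for a b c d
  proof -
    define t where "t = b / a"
    have t: "0 < t" "t < 1" using ba by (auto simp: t_def)
    have b: "b = t * a" using ba by (simp add: t_def)
    have a: "0 < a" using ba by simp
    have ab': "jp p (a - b) = (1 - t) powr (p - 1) * a powr (p - 1)"
      using t a by (simp add: b jp_nonneg_eq left_diff_distrib[of 1 t a, simplified, symmetric] powr_mult)
    \<comment> \<open>The value c is the convex combination of these two points with weights 1 - t
      and t. In the weighted sum of the tangents at c the linear terms cancel, which leaves
      \<open>le\<close>; multiplied by (1 - t)^{p-1} this is Picone's inequality.\<close>
    let ?x = "(c - d) / (1 - t)" and ?y = "d / t"
    have "(1 - t) * (c powr p + p * jp p c * (?x - c)) + t * (c powr p + p * jp p c * (?y - c))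
       \<le> (1 - t) * \<bar>?x\<bar> powr p + t * \<bar>?y\<bar> powr p"
      using powr_tangent[OF p, of c ?x] powr_tangent[OF p, of c ?y] t cd
      by (intro add_mono mult_left_mono) auto
    moreover have "(1 - t) * (c powr p + p * jp p c * (?x - c)) + t * (c powr p + p * jp p c * (?y - c)) = c powr p"
    proof -
      have "(1 - t) * ?x = c - d" "t * ?y = d" using t by auto
      then have "(1 - t) * (?x - c) + t * (?y - c) = 0" by (simp add: algebra_simps)
      moreover have "(1 - t) * (c powr p + p * jp p c * (?x - c)) + t * (c powr p + p * jp p c * (?y - c))
         = c powr p + p * jp p c * ((1 - t) * (?x - c) + t * (?y - c))"
        by (simp only: distrib_left left_diff_distrib) (simp add: algebra_simps)
      ultimately show ?thesis by simp
    qed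
    ultimately have le: "c powr p - t * \<bar>?y\<bar> powr p \<le> (1 - t) * \<bar>?x\<bar> powr p" by simp
    have "(1 - t) powr (p - 1) * ((1 - t) * \<bar>?x\<bar> powr p) = (1 - t) powr p * (\<bar>c - d\<bar> powr p / (1 - t) powr p)"
      using t powr_mult_base[of "1 - t" "p - 1"]
      by (simp only: mult.assoc[symmetric] mult.commute[of "(1 - t) powr (p - 1)"]) (simp add: abs_divide powr_divide)
    also have "\<dots> = \<bar>c - d\<bar> powr p" using t by simp
    finally have x: "(1 - t) powr (p - 1) * ((1 - t) * \<bar>?x\<bar> powr p) = \<bar>c - d\<bar> powr p" .
    have y: "t * \<bar>?y\<bar> powr p = d powr p / t powr (p - 1)"
      using t cd powr_mult_base[of t "p - 1"] by (simp add: abs_divide powr_divide field_simps)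
    have "jp p (a - b) * (c powr p / a powr (p - 1) - d powr p / b powr (p - 1))
        = (1 - t) powr (p - 1) * (c powr p - d powr p / t powr (p - 1))"
      unfolding ab' using t a by (simp add: b powr_mult field_simps)
    also have "\<dots> \<le> (1 - t) powr (p - 1) * ((1 - t) * \<bar>?x\<bar> powr p)"
      using le unfolding y by (intro mult_left_mono) auto
    finally show ?thesis unfolding x .
  qed
  consider "b < a" | "a < b" | "a = b" by linarith
  then show ?thesis
  proof cases
    case 1
    then show ?thesis using * ab cd by blast
  next
    case 2
    have "jp p (b - a) * (d powr p / b powr (p - 1) - c powr p / a powr (p - 1)) \<le> \<bar>d - c\<bar> powr p"
      using * 2 ab cd by blast
    moreover have "jp p (b - a) = - jp p (a - b)" using jp_minus[of p "a - b"] by simp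
    ultimately show ?thesis by (simp add: algebra_simps abs_minus_commute)
  qed simp
qed

lemma powr_diff_le:
  fixes c d p R :: real
  assumes p: "1 < p" and cd: "0 \<le> c" "c \<le> R" "0 \<le> d" "d \<le> R"
  shows "\<bar>c powr p - d powr p\<bar> \<le> p * R powr (p - 1) * \<bar>c - d\<bar>"
proof -
  have *: "c powr p - d powr p \<le> p * R powr (p - 1) * \<bar>c - d\<bar>" if "0 \<le> c" "c \<le> R" "0 \<le> d" for c d
  proof -
    have "c powr p - d powr p \<le> p * (jp p c * (c - d))"
      using powr_tangent[OF p, of c d] that by (simp add: algebra_simps)
    also have "\<dots> \<le> p * (R powr (p - 1) * \<bar>c - d\<bar>)"
    proof (rule mult_left_mono)
      have "jp p c * (c - d) \<le> jp p c * \<bar>c - d\<bar>"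
        using that by (intro mult_left_mono) (auto simp: jp_nonneg_eq)
      also have "\<dots> \<le> R powr (p - 1) * \<bar>c - d\<bar>"
        using that p by (intro mult_right_mono) (auto simp: jp_nonneg_eq intro!: powr_mono2)
      finally show "jp p c * (c - d) \<le> R powr (p - 1) * \<bar>c - d\<bar>" .
    qed (use p in auto)
    finally show ?thesis by simp
  qed
  show ?thesis using *[of c d] *[of d c] cd by (simp add: abs_minus_commute abs_le_iff)
qed

text \<open>Picone's test function belongs to \<open>W\<close> once it is Lipschitz in both
  arguments. It is, because t^p is Lipschitz on [0, R] and t^{1-p} on [1, \<infinity>).\<close>

lemma picone_quotient_lipschitz:
  fixes a b c d p R :: real
  assumes p: "1 < p" and cd: "0 \<le> c" "c \<le> R" "0 \<le> d" "d \<le> R" and ab: "1 \<le> a" "1 \<le> b"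
  shows "\<bar>c powr p / a powr (p - 1) - d powr p / b powr (p - 1)\<bar>
    \<le> (p * R powr (p - 1) + (p - 1) * R powr p) * (\<bar>c - d\<bar> + \<bar>a - b\<bar>)"
proof -
  have "norm (a powr (1 - p) - b powr (1 - p)) \<le> (p - 1) * norm (a - b)"
  proof (rule field_differentiable_bound[of "{1..}" _ "\<lambda>t. (1 - p) * t powr (1 - p - 1)"])
    show "((\<lambda>t. t powr (1 - p)) has_field_derivative (1 - p) * t powr (1 - p - 1)) (at t within {1..})"
      if "t \<in> {1..}" for t
      using that by (intro has_field_derivative_at_within[OF has_real_derivative_powr]) auto
    show "norm ((1 - p) * t powr (1 - p - 1)) \<le> p - 1" if "t \<in> {1..}" for t
    proof -
      have "t powr - p \<le> t powr 0" using that p by (intro powr_mono) auto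
      then have "(p - 1) * t powr - p \<le> (p - 1) * 1"
        using that p by (intro mult_left_mono) auto
      then show ?thesis using p by (simp add: abs_mult)
    qed
  qed (use ab in auto)
  then have "\<bar>a powr (1 - p) - b powr (1 - p)\<bar> \<le> (p - 1) * \<bar>a - b\<bar>" by simp
  then have q: "d powr p * \<bar>a powr (1 - p) - b powr (1 - p)\<bar> \<le> R powr p * ((p - 1) * \<bar>a - b\<bar>)"
    using cd p by (intro mult_mono powr_mono2) auto
  have "a powr (1 - p) \<le> a powr 0" using ab p by (intro powr_mono) auto
  then have a1: "\<bar>a powr (1 - p)\<bar> \<le> 1" using ab by simp
  have "\<bar>c powr p / a powr (p - 1) - d powr p / b powr (p - 1)\<bar>
     = \<bar>(c powr p - d powr p) * a powr (1 - p) + d powr p * (a powr (1 - p) - b powr (1 - p))\<bar>"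
  proof -
    have neg: "1 - p = - (p - 1)" by simp
    have "x / y powr (p - 1) = x * y powr (1 - p)" for x y :: real
      unfolding neg powr_minus divide_inverse ..
    then show ?thesis by (simp only: left_diff_distrib right_diff_distrib)
  qed
  also have "\<dots> \<le> \<bar>c powr p - d powr p\<bar> * \<bar>a powr (1 - p)\<bar> + d powr p * \<bar>a powr (1 - p) - b powr (1 - p)\<bar>"
    by (rule order_trans[OF abs_triangle_ineq]) (simp add: abs_mult)
  also have "\<dots> \<le> p * R powr (p - 1) * \<bar>c - d\<bar> + R powr p * ((p - 1) * \<bar>a - b\<bar>)"
  proof -
    have "\<bar>c powr p - d powr p\<bar> * \<bar>a powr (1 - p)\<bar> \<le> p * R powr (p - 1) * \<bar>c - d\<bar> * 1"
      using powr_diff_le[OF p cd] a1 by (rule mult_mono) (use p in auto)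
    then show ?thesis using q by linarith
  qed
  also have "\<dots> \<le> (p * R powr (p - 1) + (p - 1) * R powr p) * (\<bar>c - d\<bar> + \<bar>a - b\<bar>)"
  proof -
    have *: "A * u + B * v \<le> (A + B) * (u + v)"
      if "0 \<le> A" "0 \<le> B" "0 \<le> u" "0 \<le> v" for A B u v :: real
      using that mult_nonneg_nonneg[of A v] mult_nonneg_nonneg[of B u]
      unfolding distrib_left distrib_right by linarith
    show ?thesis using *[of "p * R powr (p - 1)" "(p - 1) * R powr p" "\<bar>c - d\<bar>" "\<bar>a - b\<bar>"] p
      by (simp add: mult_ac)
  qed
  finally show ?thesis .
qed

section \<open>The Gagliardo measure\<close>

text \<open>On pairs, \<open>lebesgue\<close> is the completion of the Borel product measure and not
  itself a product measure; the exceptional set is therefore first enlarged to a Borel null set and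
  only then multiplied by the whole space.\<close>

lemma AE_lebesgue_fst:
  assumes "AE x in (lebesgue :: 'a::euclidean_space measure). P x"
  shows "AE z in (lebesgue :: ('a \<times> 'b::euclidean_space) measure). P (fst z)"
proof -
  obtain N where N: "N \<in> null_sets lborel" "{x. \<not> P x} \<subseteq> N"
    using AE_completion_iff[THEN iffD1, OF assms] unfolding eventually_ae_filter by auto
  have "emeasure (lborel \<Otimes>\<^sub>M (lborel :: 'b measure)) (N \<times> UNIV) = 0"
    using N by (subst lborel.emeasure_pair_measure_Times) auto
  then have "N \<times> UNIV \<in> null_sets (lborel :: ('a \<times> 'b) measure)"
    using N by (auto simp: null_sets_def lborel_prod[symmetric])
  then show ?thesis
    unfolding AE_completion_iff by (rule AE_I') (use N in \<open>auto simp: mem_Times_iff\<close>)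
qed

lemma AE_lebesgue_snd:
  assumes "AE x in (lebesgue :: 'b::euclidean_space measure). P x"
  shows "AE z in (lebesgue :: ('a::euclidean_space \<times> 'b) measure). P (snd z)"
proof -
  obtain N where N: "N \<in> null_sets lborel" "{x. \<not> P x} \<subseteq> N"
    using AE_completion_iff[THEN iffD1, OF assms] unfolding eventually_ae_filter by auto
  have "emeasure ((lborel :: 'a measure) \<Otimes>\<^sub>M lborel) (UNIV \<times> N) = 0"
    using N by (subst lborel.emeasure_pair_measure_Times) auto
  then have "UNIV \<times> N \<in> null_sets (lborel :: ('a \<times> 'b) measure)"
    using N by (auto simp: null_sets_def lborel_prod[symmetric])
  then show ?thesis
    unfolding AE_completion_iff by (rule AE_I') (use N in \<open>auto simp: mem_Times_iff\<close>)
qed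

lemma borel_measurable_lebesgue_fst:
  fixes u :: "'a::euclidean_space \<Rightarrow> real"
  assumes "u \<in> borel_measurable lebesgue"
  shows "(\<lambda>z. u (fst z)) \<in> borel_measurable (lebesgue :: ('a \<times> 'b::euclidean_space) measure)"
proof -
  obtain u' where u': "u' \<in> borel_measurable lborel" "AE x in lborel. u x = u' x"
    using completion_ex_borel_measurable_real[OF assms] by blast
  then have "(\<lambda>z. u' (fst z)) \<in> borel_measurable (borel :: ('a \<times> 'b) measure)"
    by (simp add: borel_prod[symmetric])
  then have "(\<lambda>z. u' (fst z)) \<in> borel_measurable (lebesgue :: ('a \<times> 'b) measure)"
    by (intro measurable_completion) auto
  moreover have "AE z in (lebesgue :: ('a \<times> 'b) measure). u' (fst z) = u (fst z)"
    using u' by (intro AE_lebesgue_fst AE_completion) (auto simp: eq_commute)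
  ultimately show ?thesis by (rule borel_measurable_AE)
qed

lemma borel_measurable_lebesgue_snd:
  fixes u :: "'b::euclidean_space \<Rightarrow> real"
  assumes "u \<in> borel_measurable lebesgue"
  shows "(\<lambda>z. u (snd z)) \<in> borel_measurable (lebesgue :: ('a::euclidean_space \<times> 'b) measure)"
proof -
  obtain u' where u': "u' \<in> borel_measurable lborel" "AE x in lborel. u x = u' x"
    using completion_ex_borel_measurable_real[OF assms] by blast
  then have "(\<lambda>z. u' (snd z)) \<in> borel_measurable (borel :: ('a \<times> 'b) measure)"
    by (simp add: borel_prod[symmetric])
  then have "(\<lambda>z. u' (snd z)) \<in> borel_measurable (lebesgue :: ('a \<times> 'b) measure)"
    by (intro measurable_completion) auto
  moreover have "AE z in (lebesgue :: ('a \<times> 'b) measure). u' (snd z) = u (snd z)"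
    using u' by (intro AE_lebesgue_snd AE_completion) (auto simp: eq_commute)
  ultimately show ?thesis by (rule borel_measurable_AE)
qed

definition dif :: "('a \<Rightarrow> real) \<Rightarrow> 'a \<times> 'a \<Rightarrow> real" where
  "dif u z = u (fst z) - u (snd z)"

lemma borel_measurable_dif:
  "u \<in> borel_measurable lebesgue \<Longrightarrow> dif u \<in> borel_measurable (lebesgue :: ('a \<times> 'a::euclidean_space) measure)"
  unfolding dif_def
  by (intro borel_measurable_diff borel_measurable_lebesgue_fst borel_measurable_lebesgue_snd)

section \<open>Standing assumptions and the kernel as a measure\<close>

locale fractional_setting =
  fixes p s :: real and Om :: "'a::euclidean_space set"
  assumes p: "1 < p" and s: "0 < s" "s < 1" and Om: "open Om" "bounded Om"
begin

abbreviation W where "W \<equiv> Wsp0 s p Om"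
abbreviation L where "L \<equiv> lebesgue_on Om"

definition gker :: "'a \<times> 'a \<Rightarrow> real" where
  "gker z = 1 / norm (fst z - snd z) powr (real DIM('a) + s * p)"

text \<open>The measure |x - y|^{-N-sp} dx dy. With the kernel absorbed, [v]^p is the p-th power of
  an L^p norm of \<open>dif v\<close>, and pointwise inequalities for |t|^p integrate
  directly.\<close>

definition gmeas :: "('a \<times> 'a) measure" where
  "gmeas = density lebesgue (\<lambda>z. ennreal (gker z))"

lemma gker_nonneg: "0 \<le> gker z"
  by (simp add: gker_def)

lemma borel_measurable_gker_borel: "gker \<in> borel_measurable borel"
  unfolding gker_def by (simp add: borel_prod[symmetric])

lemma borel_measurable_gker: "gker \<in> borel_measurable lebesgue"
  by (rule measurable_completion) (use borel_measurable_gker_borel in simp)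

lemma measurable_gmeas_eq: "borel_measurable gmeas = borel_measurable lebesgue"
  by (auto intro!: measurable_cong_sets simp: gmeas_def)

lemma AE_gmeas: "AE z in lebesgue. P z \<Longrightarrow> AE z in gmeas. P z"
  unfolding gmeas_def using borel_measurable_gker by (subst AE_density) auto

lemma AE_gmeas_fst: "AE x in lebesgue. P x \<Longrightarrow> AE z in gmeas. P (fst z)"
  by (intro AE_gmeas AE_lebesgue_fst)

lemma AE_gmeas_snd: "AE x in lebesgue. P x \<Longrightarrow> AE z in gmeas. P (snd z)"
  by (intro AE_gmeas AE_lebesgue_snd)

lemma integrable_gmeas:
  fixes q :: "'a \<times> 'a \<Rightarrow> real"
  shows "q \<in> borel_measurable lebesgue \<Longrightarrow> integrable gmeas q \<longleftrightarrow> integrable lebesgue (\<lambda>z. q z * gker z)"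
  unfolding gmeas_def using borel_measurable_gker
  by (subst integrable_density) (auto simp: gker_nonneg mult.commute)

lemma integral_gmeas:
  fixes q :: "'a \<times> 'a \<Rightarrow> real"
  shows "q \<in> borel_measurable lebesgue \<Longrightarrow> integral\<^sup>L gmeas q = (LINT z|lebesgue. q z * gker z)"
  unfolding gmeas_def using borel_measurable_gker
  by (subst integral_density) (auto simp: gker_nonneg mult.commute)

lemma sets_Om [measurable]: "Om \<in> sets lebesgue" "Om \<in> sets borel"
  using Om by auto

lemma AE_L: "(AE x in L. P x) \<longleftrightarrow> (AE x in lebesgue. x \<in> Om \<longrightarrow> P x)"
  by (subst AE_restrict_space_iff) auto

lemma integrable_L: "integrable L (u :: 'a \<Rightarrow> real) \<longleftrightarrow> set_integrable lebesgue Om u"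
  unfolding set_integrable_def by (subst integrable_restrict_space) auto

lemma integral_L: "integral\<^sup>L L (u :: 'a \<Rightarrow> real) = (LINT x:Om|lebesgue. u x)"
  unfolding set_lebesgue_integral_def by (subst integral_restrict_space) auto

lemma measurable_L: "u \<in> borel_measurable lebesgue \<Longrightarrow> u \<in> borel_measurable L"
  by (rule measurable_restrict_space1)

sublocale L: finite_measure L
proof
  have "emeasure lebesgue Om < \<infinity>" using Om emeasure_bounded_finite[of Om] by simp
  then show "emeasure L (space L) \<noteq> \<infinity>" by (subst emeasure_restrict_space) auto
qed

section \<open>A ball outside the domain and the constant of its interaction\<close>

definition rad :: real where "rad = (SOME R. 0 < R \<and> Om \<subseteq> ball 0 R)"

text \<open>The centre has norm \<open>rad + 1\<close>, so every point of this unit ball has norm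
  strictly between \<open>rad\<close> and \<open>rad + 2\<close>; the first bound puts it outside
  \<open>Om\<close>, the second bounds its distance to \<open>Om\<close> from above.\<close>

definition far :: "'a set" where "far = ball ((rad + 1) *\<^sub>R (SOME b. b \<in> Basis)) 1"

text \<open>Points of \<open>Om\<close> and of \<open>far\<close> are less than
  \<open>2 * rad + 2\<close> apart. The constant is the volume of \<open>far\<close> times the
  kernel at that distance: a lower bound for the interaction of any point of \<open>Om\<close> with
  the whole ball.\<close>

definition c0 :: real where
  "c0 = measure lborel far / (2 * rad + 2) powr (real DIM('a) + s * p)"

lemma rad: "0 < rad" "Om \<subseteq> ball 0 rad"
proof -
  obtain R where "0 < R" "Om \<subseteq> ball 0 R"
    using bounded_subset_ballD[OF Om(2), of 0] by auto
  then have "\<exists>R. 0 < R \<and> Om \<subseteq> ball 0 R" by blast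
  from someI_ex[OF this] show "0 < rad" "Om \<subseteq> ball 0 rad" by (auto simp: rad_def)
qed

lemma far_norm:
  assumes "y \<in> far"
  shows "rad < norm y" "norm y < rad + 2"
proof -
  let ?c = "(rad + 1) *\<^sub>R (SOME b. b \<in> Basis) :: 'a"
  have c: "norm ?c = rad + 1" using rad(1) someI_ex[OF ex_in_conv[THEN iffD2, OF nonempty_Basis]] by simp
  have "norm (?c - y) < 1" using assms by (simp add: far_def dist_norm)
  then show "rad < norm y" "norm y < rad + 2"
    using c norm_triangle_ineq2[of ?c y] norm_triangle_ineq2[of y ?c] by (auto simp: norm_minus_commute)
qed

lemma far_disjoint: "y \<in> far \<Longrightarrow> y \<notin> Om"
  using far_norm[of y] rad(2) by force

lemma far_measure: "emeasure lborel far = ennreal (measure lborel far)" "0 < measure lborel far"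
proof -
  show "emeasure lborel far = ennreal (measure lborel far)"
    unfolding far_def by (intro emeasure_eq_ennreal_measure) (use emeasure_lborel_ball_finite in \<open>auto simp: less_top\<close>)
  show "0 < measure lborel far"
    unfolding far_def using content_ball_pos[of 1] by simp
qed

lemma sets_far [measurable]: "far \<in> sets borel"
  by (simp add: far_def)

lemma c0_pos: "0 < c0"
  unfolding c0_def using far_measure rad(1) by (intro divide_pos_pos) auto

lemma gker_far:
  assumes "x \<in> Om" "y \<in> far"
  shows "1 / (2 * rad + 2) powr (real DIM('a) + s * p) \<le> gker (x, y)"
proof -
  have "norm x < rad" using assms(1) rad(2) by auto
  then have "norm (x - y) \<le> 2 * rad + 2"
    using far_norm[OF assms(2)] norm_triangle_ineq4[of x y] by simp
  moreover have "x \<noteq> y" using far_disjoint assms by auto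
  ultimately show ?thesis
    unfolding gker_def using s p by (auto intro!: divide_left_mono powr_mono2 mult_pos_pos)
qed

text \<open>
  Functions in \<open>W\<close> vanish on the ball \<open>far\<close>, at positive distance from \<open>Om\<close>; the interaction of \<open>Om\<close>
  with that ball alone yields the Poincare inequality, the sup bound and strict comparison.
\<close>

lemma cross_nn_integral:
  assumes g: "g \<in> borel_measurable lebesgue"
  shows "ennreal c0 * (\<integral>\<^sup>+x. ennreal (g x) * indicator Om x \<partial>lebesgue)
    \<le> (\<integral>\<^sup>+z. ennreal (g (fst z)) * indicator (Om \<times> far) z \<partial>gmeas)"
proof -
  \<comment> \<open>Tonelli is applied on the uncompleted product, so g is first replaced by a Borel
    representative.\<close>
  obtain h where h [measurable]: "h \<in> borel_measurable borel" and gh: "AE x in lborel. g x = h x"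
    using completion_ex_borel_measurable_real[OF g] by auto
  define k where "k = 1 / (2 * rad + 2) powr (real DIM('a) + s * p)"
  have k: "0 \<le> k" by (simp add: k_def)
  have "ennreal c0 * (\<integral>\<^sup>+x. ennreal (g x) * indicator Om x \<partial>lebesgue)
      = ennreal c0 * (\<integral>\<^sup>+x. ennreal (h x) * indicator Om x \<partial>lborel)"
    unfolding nn_integral_completion by (intro arg_cong2[of _ _ _ _ "(*)"] refl nn_integral_cong_AE) (use gh in auto)
  also have "\<dots> = (\<integral>\<^sup>+x. \<integral>\<^sup>+y. ennreal k * (ennreal (h x) * indicator Om x) * indicator far y \<partial>lborel \<partial>lborel)"
  proof -
    have "ennreal c0 = ennreal k * emeasure lborel far"
      by (simp add: c0_def k_def far_measure(1) flip: ennreal_mult')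
    moreover have "(\<integral>\<^sup>+x. ennreal k * (ennreal (h x) * indicator Om x) * emeasure lborel far \<partial>lborel)
        = ennreal k * (\<integral>\<^sup>+x. ennreal (h x) * indicator Om x \<partial>lborel) * emeasure lborel far"
      by (subst nn_integral_multc) (auto simp: nn_integral_cmult)
    ultimately show ?thesis
      by (subst nn_integral_cmult_indicator) (auto simp: mult.assoc mult.left_commute mult.commute)
  qed
  also have "\<dots> = (\<integral>\<^sup>+z. ennreal k * (ennreal (h (fst z)) * indicator Om (fst z)) * indicator far (snd z) \<partial>(lborel \<Otimes>\<^sub>M lborel))"
    by (subst lborel.nn_integral_fst[symmetric]) auto
  also have "\<dots> = (\<integral>\<^sup>+z. ennreal k * (ennreal (h (fst z)) * indicator Om (fst z)) * indicator far (snd z) \<partial>lebesgue)"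
    by (simp add: lborel_prod nn_integral_completion)
  also have "\<dots> \<le> (\<integral>\<^sup>+z. ennreal (gker z) * (ennreal (g (fst z)) * indicator (Om \<times> far) z) \<partial>lebesgue)"
  proof (rule nn_integral_mono_AE)
    show "AE z in lebesgue. ennreal k * (ennreal (h (fst z)) * indicator Om (fst z)) * indicator far (snd z)
       \<le> ennreal (gker z) * (ennreal (g (fst z)) * indicator (Om \<times> far) z)"
      using AE_lebesgue_fst[OF AE_completion[OF gh]]
      by eventually_elim
         (auto simp: indicator_def mem_Times_iff k_def intro!: mult_right_mono ennreal_leI gker_far
            gker_far[of "fst _" "snd _", simplified])
  qed
  also have "\<dots> = (\<integral>\<^sup>+z. ennreal (g (fst z)) * indicator (Om \<times> far) z \<partial>gmeas)"
  proof -
    have "Om \<times> far \<in> sets (borel :: ('a \<times> 'a) measure)"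
      unfolding borel_prod[symmetric] by measurable
    then have "Om \<times> far \<in> sets lebesgue" by auto
    then show ?thesis
      unfolding gmeas_def
      using borel_measurable_gker measurable_compose[OF borel_measurable_lebesgue_fst[OF g] measurable_ennreal]
      by (subst nn_integral_density) (auto intro!: borel_measurable_times_ennreal borel_measurable_indicator)
  qed
  finally show ?thesis .
qed

text \<open>All pairs outside Om \<times> far are discarded, which is harmless because q \<ge> 0.
  The Poincare inequality, the truncation estimate and the comparison principle are obtained by
  choosing q and g.\<close>

lemma cross_integral:
  fixes q :: "'a \<times> 'a \<Rightarrow> real" and g :: "'a \<Rightarrow> real"
  assumes q: "integrable gmeas q" "AE z in gmeas. 0 \<le> q z"
    and g: "g \<in> borel_measurable lebesgue" "AE x in L. 0 \<le> g x"
    and le: "AE z in gmeas. fst z \<in> Om \<longrightarrow> snd z \<in> far \<longrightarrow> g (fst z) \<le> q z"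
  shows "integrable L g" "c0 * integral\<^sup>L L g \<le> integral\<^sup>L gmeas q"
proof -
  let ?I = "\<integral>\<^sup>+x. ennreal (g x) \<partial>L"
  have "ennreal c0 * ?I \<le> (\<integral>\<^sup>+z. ennreal (g (fst z)) * indicator (Om \<times> far) z \<partial>gmeas)"
    using cross_nn_integral[OF g(1)] by (subst nn_integral_restrict_space) auto
  also have "\<dots> \<le> (\<integral>\<^sup>+z. ennreal (q z) \<partial>gmeas)"
    by (rule nn_integral_mono_AE) (use le q(2) in \<open>eventually_elim, auto simp: indicator_def ennreal_leI\<close>)
  also have "\<dots> = ennreal (integral\<^sup>L gmeas q)" using q by (rule nn_integral_eq_integral)
  finally have *: "ennreal c0 * ?I \<le> ennreal (integral\<^sup>L gmeas q)" .
  then have "ennreal c0 * ?I < top" using le_less_trans[OF _ ennreal_less_top] by blast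
  then have "?I < \<infinity>" using c0_pos by (auto simp: ennreal_mult_less_top)
  then show int: "integrable L g"
    using g measurable_L[OF g(1)] by (intro integrableI_nonneg) auto
  have "ennreal (c0 * integral\<^sup>L L g) \<le> ennreal (integral\<^sup>L gmeas q)"
    using * nn_integral_eq_integral[OF int g(2)] c0_pos by (simp add: ennreal_mult')
  moreover have "0 \<le> integral\<^sup>L gmeas q" using q(2) by (rule integral_nonneg_AE)
  ultimately show "c0 * integral\<^sup>L L g \<le> integral\<^sup>L gmeas q" by (simp add: ennreal_le_iff)
qed

end

section \<open>The space \<open>W\<^sub>0\<^sup>s\<^sup>,\<^sup>p\<close>\<close>

context fractional_setting
begin

definition G :: "('a \<Rightarrow> real) \<Rightarrow> real" where
  "G v = (\<integral>z. \<bar>dif v z\<bar> powr p \<partial>gmeas)"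

definition A :: "('a \<Rightarrow> real) \<Rightarrow> ('a \<Rightarrow> real) \<Rightarrow> real" where
  "A u v = (\<integral>z. jp p (dif u z) * dif v z \<partial>gmeas)"

lemma gagliardo_integrand_eq: "gagliardo_integrand s p v = (\<lambda>z. \<bar>dif v z\<bar> powr p * gker z)"
  by (auto simp: gagliardo_integrand_def dif_def gker_def)

lemma borel_measurable_dif_gmeas:
  "v \<in> borel_measurable lebesgue \<Longrightarrow> dif v \<in> borel_measurable gmeas"
  by (simp add: measurable_gmeas_eq borel_measurable_dif)

lemma borel_measurable_dif_powr:
  "v \<in> borel_measurable lebesgue \<Longrightarrow> (\<lambda>z. \<bar>dif v z\<bar> powr p) \<in> borel_measurable lebesgue"
  using borel_measurable_dif[of v] by measurable

lemma powr_integrable_L_of_dif: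
  assumes v: "v \<in> borel_measurable lebesgue" "AE x in lebesgue. x \<notin> Om \<longrightarrow> v x = 0"
    and int: "integrable gmeas (\<lambda>z. \<bar>dif v z\<bar> powr p)"
  shows "integrable L (\<lambda>x. \<bar>v x\<bar> powr p)" "c0 * (\<integral>x. \<bar>v x\<bar> powr p \<partial>L) \<le> G v"
proof -
  have le: "AE z in gmeas. fst z \<in> Om \<longrightarrow> snd z \<in> far \<longrightarrow> \<bar>v (fst z)\<bar> powr p \<le> \<bar>dif v z\<bar> powr p"
    using AE_gmeas_snd[OF v(2)] by eventually_elim (auto simp: dif_def dest: far_disjoint)
  have m: "(\<lambda>x. \<bar>v x\<bar> powr p) \<in> borel_measurable lebesgue" using v(1) by measurable
  show "integrable L (\<lambda>x. \<bar>v x\<bar> powr p)" "c0 * (\<integral>x. \<bar>v x\<bar> powr p \<partial>L) \<le> G v"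
    using cross_integral[OF int _ m _ le] by (auto simp: G_def)
qed

text \<open>Since v vanishes on \<open>far\<close>, the interaction with that ball already gives
  integrability of |v|^p. Apart from measurability and vanishing outside, membership is thus a
  statement about \<open>gmeas\<close> alone.\<close>

lemma W_iff:
  "v \<in> W \<longleftrightarrow> v \<in> borel_measurable lebesgue \<and> (AE x in lebesgue. x \<notin> Om \<longrightarrow> v x = 0)
    \<and> integrable gmeas (\<lambda>z. \<bar>dif v z\<bar> powr p)"
proof -
  have "integrable lebesgue (\<lambda>x. \<bar>v x\<bar> powr p)"
    if v: "v \<in> borel_measurable lebesgue" "AE x in lebesgue. x \<notin> Om \<longrightarrow> v x = 0"
      and int: "integrable gmeas (\<lambda>z. \<bar>dif v z\<bar> powr p)"
  proof -
    have "integrable lebesgue (\<lambda>x. indicator Om x *\<^sub>R \<bar>v x\<bar> powr p)"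
      using powr_integrable_L_of_dif(1)[OF that] by (simp add: integrable_L set_integrable_def)
    moreover have "(\<lambda>x. \<bar>v x\<bar> powr p) \<in> borel_measurable lebesgue" using v(1) by measurable
    moreover have "AE x in lebesgue. norm (\<bar>v x\<bar> powr p) \<le> norm (indicator Om x *\<^sub>R \<bar>v x\<bar> powr p)"
      using v(2) by eventually_elim (auto simp: indicator_def)
    ultimately show ?thesis by (rule Bochner_Integration.integrable_bound)
  qed
  moreover have "integrable lebesgue (gagliardo_integrand s p v) \<longleftrightarrow> integrable gmeas (\<lambda>z. \<bar>dif v z\<bar> powr p)"
    if "v \<in> borel_measurable lebesgue"
    unfolding gagliardo_integrand_eq integrable_gmeas[OF borel_measurable_dif_powr[OF that]] ..
  ultimately show ?thesis
    unfolding Wsp0_def Wsp_def by blast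
qed

lemma W_meas: "v \<in> W \<Longrightarrow> v \<in> borel_measurable lebesgue"
  and W_zero_outside: "v \<in> W \<Longrightarrow> AE x in lebesgue. x \<notin> Om \<longrightarrow> v x = 0"
  and W_integrable_dif: "v \<in> W \<Longrightarrow> integrable gmeas (\<lambda>z. \<bar>dif v z\<bar> powr p)"
  by (simp_all add: W_iff)

lemma W_meas_L: "v \<in> W \<Longrightarrow> v \<in> borel_measurable L"
  by (intro measurable_L W_meas)

lemma W_meas_dif: "v \<in> W \<Longrightarrow> dif v \<in> borel_measurable gmeas"
  by (intro borel_measurable_dif_gmeas W_meas)

lemma W_powr_integrable: "v \<in> W \<Longrightarrow> integrable L (\<lambda>x. \<bar>v x\<bar> powr p)"
  and poincare: "v \<in> W \<Longrightarrow> c0 * (\<integral>x. \<bar>v x\<bar> powr p \<partial>L) \<le> G v"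
  using powr_integrable_L_of_dif by (auto simp: W_iff)

lemma G_nonneg: "0 \<le> G v"
  unfolding G_def by (rule Bochner_Integration.integral_nonneg) simp

lemma gagliardo_eq: "v \<in> W \<Longrightarrow> gagliardo s p v = G v powr (1 / p)"
  unfolding gagliardo_def gagliardo_integrand_eq G_def
  by (subst integral_gmeas) (auto intro!: borel_measurable_dif_powr W_meas)

lemma frac_p_laplacian_eq:
  assumes "u \<in> W" "v \<in> W"
  shows "frac_p_laplacian s p u v = A u v"
proof -
  have "(\<lambda>z. jp p (dif u z) * dif v z) \<in> borel_measurable lebesgue"
    using borel_measurable_dif[OF W_meas[OF assms(1)]] borel_measurable_dif[OF W_meas[OF assms(2)]]
    by measurable
  then show ?thesis
    unfolding frac_p_laplacian_def A_def
    by (subst integral_gmeas) (auto simp: J_def jp_def dif_def gker_def case_prod_unfold)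
qed

lemma A_integrable:
  assumes "u \<in> W" "v \<in> W"
  shows "integrable gmeas (\<lambda>z. jp p (dif u z) * dif v z)"
proof (rule Bochner_Integration.integrable_bound)
  show "integrable gmeas (\<lambda>z. \<bar>dif u z\<bar> powr p + \<bar>dif v z\<bar> powr p)"
    using assms by (auto simp: W_iff)
  show "(\<lambda>z. jp p (dif u z) * dif v z) \<in> borel_measurable gmeas"
    using W_meas_dif[OF assms(1)] W_meas_dif[OF assms(2)] by measurable
  show "AE z in gmeas. norm (jp p (dif u z) * dif v z) \<le> norm (\<bar>dif u z\<bar> powr p + \<bar>dif v z\<bar> powr p)"
    using abs_jp_mult_le[OF p] by auto
qed

lemma W_dominated:
  assumes v: "v \<in> borel_measurable lebesgue" "AE x in lebesgue. x \<notin> Om \<longrightarrow> v x = 0"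
    and uw: "u \<in> W" "w \<in> W"
    and C: "0 \<le> C" "AE z in gmeas. \<bar>dif v z\<bar> \<le> C * (\<bar>dif u z\<bar> + \<bar>dif w z\<bar>)"
  shows "v \<in> W"
proof -
  have "integrable gmeas (\<lambda>z. \<bar>dif v z\<bar> powr p)"
  proof (rule Bochner_Integration.integrable_bound)
    show "integrable gmeas (\<lambda>z. C powr p * (2 powr p * (\<bar>dif u z\<bar> powr p + \<bar>dif w z\<bar> powr p)))"
      using uw by (auto simp: W_iff)
    show "(\<lambda>z. \<bar>dif v z\<bar> powr p) \<in> borel_measurable gmeas"
      using v(1) by (simp add: measurable_gmeas_eq borel_measurable_dif_powr)
    show "AE z in gmeas. norm (\<bar>dif v z\<bar> powr p)
        \<le> norm (C powr p * (2 powr p * (\<bar>dif u z\<bar> powr p + \<bar>dif w z\<bar> powr p)))"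
      using C(2)
    proof eventually_elim
      case (elim z)
      have "\<bar>dif v z\<bar> powr p \<le> (C * (\<bar>dif u z\<bar> + \<bar>dif w z\<bar>)) powr p"
        using elim p by (intro powr_mono2) auto
      also have "\<dots> = C powr p * (\<bar>dif u z\<bar> + \<bar>dif w z\<bar>) powr p" using C by (simp add: powr_mult)
      also have "\<dots> \<le> C powr p * (2 powr p * (\<bar>dif u z\<bar> powr p + \<bar>dif w z\<bar> powr p))"
        using p by (intro mult_left_mono powr_sum_le) auto
      finally show ?case by simp
    qed
  qed
  then show ?thesis using v by (simp add: W_iff)
qed

text \<open>The closure principle behind maxima, minima, linear combinations, truncation and
  Picone's test function: differences of a Lipschitz expression are dominated by those of its two
  arguments.\<close>

lemma W_combine:
  assumes uw: "u \<in> W" "w \<in> W" and m: "case_prod f \<in> borel_measurable (borel \<Otimes>\<^sub>M borel)"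
    and f: "f 0 0 = 0" "0 \<le> C" "\<And>a b c d. \<bar>f a b - f c d\<bar> \<le> C * (\<bar>a - c\<bar> + \<bar>b - d\<bar>)"
  shows "(\<lambda>x. f (u x) (w x)) \<in> W"
proof (rule W_dominated[OF _ _ uw f(2)])
  show "(\<lambda>x. f (u x) (w x)) \<in> borel_measurable lebesgue"
    using measurable_compose[OF measurable_Pair[OF W_meas[OF uw(1)] W_meas[OF uw(2)]] m] by simp
  show "AE x in lebesgue. x \<notin> Om \<longrightarrow> f (u x) (w x) = 0"
    using W_zero_outside[OF uw(1)] W_zero_outside[OF uw(2)] by eventually_elim (simp add: f)
  show "AE z in gmeas. \<bar>dif (\<lambda>x. f (u x) (w x)) z\<bar> \<le> C * (\<bar>dif u z\<bar> + \<bar>dif w z\<bar>)"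
    using f(3) by (auto simp: dif_def)
qed

lemma W_max: "u \<in> W \<Longrightarrow> w \<in> W \<Longrightarrow> (\<lambda>x. max (u x) (w x)) \<in> W"
  by (rule W_combine[where f = max and C = 1]) (auto simp: max_def)

lemma W_min: "u \<in> W \<Longrightarrow> w \<in> W \<Longrightarrow> (\<lambda>x. min (u x) (w x)) \<in> W"
  by (rule W_combine[where f = min and C = 1]) (auto simp: min_def)

lemma W_lin:
  assumes "u \<in> W" "w \<in> W"
  shows "(\<lambda>x. a * u x + b * w x) \<in> W"
proof (rule W_combine[where f = "\<lambda>x y. a * x + b * y" and C = "\<bar>a\<bar> + \<bar>b\<bar>", OF assms])
  fix x y x' y' :: real
  have "\<bar>a * x + b * y - (a * x' + b * y')\<bar> = \<bar>a * (x - x') + b * (y - y')\<bar>" by (simp add: algebra_simps)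
  also have "\<dots> \<le> \<bar>a\<bar> * \<bar>x - x'\<bar> + \<bar>b\<bar> * \<bar>y - y'\<bar>"
    by (rule order_trans[OF abs_triangle_ineq]) (simp add: abs_mult)
  also have "\<dots> \<le> (\<bar>a\<bar> + \<bar>b\<bar>) * (\<bar>x - x'\<bar> + \<bar>y - y'\<bar>)" by (simp add: algebra_simps)
  finally show "\<bar>a * x + b * y - (a * x' + b * y')\<bar> \<le> (\<bar>a\<bar> + \<bar>b\<bar>) * (\<bar>x - x'\<bar> + \<bar>y - y'\<bar>)" .
qed auto

lemma W_diff: "u \<in> W \<Longrightarrow> w \<in> W \<Longrightarrow> (\<lambda>x. u x - w x) \<in> W"
  using W_lin[of u w 1 "- 1"] by simp

lemma W_scale: "u \<in> W \<Longrightarrow> (\<lambda>x. a * u x) \<in> W"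
  using W_lin[of u u a 0] by simp

lemma W_uminus: "u \<in> W \<Longrightarrow> (\<lambda>x. - u x) \<in> W"
  using W_scale[of u "- 1"] by simp

lemma W_zero: "(\<lambda>x. 0) \<in> W"
  by (simp add: W_iff dif_def)

lemma W_pos: "u \<in> W \<Longrightarrow> (\<lambda>x. max (u x) 0) \<in> W"
  using W_max[OF _ W_zero] .

lemma W_abs: "u \<in> W \<Longrightarrow> (\<lambda>x. \<bar>u x\<bar>) \<in> W"
proof -
  have "\<bar>t\<bar> = max t (- t)" for t :: real by simp
  then show "u \<in> W \<Longrightarrow> (\<lambda>x. \<bar>u x\<bar>) \<in> W" using W_max[OF _ W_uminus] by presburger
qed

lemma W_truncate: "u \<in> W \<Longrightarrow> 0 \<le> M \<Longrightarrow> (\<lambda>x. min (max (u x) 0) M) \<in> W"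
  by (rule W_combine[where f = "\<lambda>x y. min (max x 0) M" and C = 1 and w = "\<lambda>x. 0", OF _ W_zero])
     (auto simp: min_def max_def)

lemma W_integrable:
  assumes "v \<in> W"
  shows "integrable L v"
proof (rule Bochner_Integration.integrable_bound)
  show "integrable L (\<lambda>x. 1 + \<bar>v x\<bar> powr p)"
    using W_powr_integrable[OF assms] by simp
  have "\<bar>t\<bar> \<le> 1 + \<bar>t\<bar> powr p" for t :: real
    using powr_mono[of 1 p "\<bar>t\<bar>"] p by (cases "1 \<le> \<bar>t\<bar>") (auto intro: add_increasing2)
  then show "AE x in L. norm (v x) \<le> norm (1 + \<bar>v x\<bar> powr p)" by auto
qed (rule W_meas_L[OF assms])

lemma W_mult_integrable:
  assumes "v \<in> W" "h \<in> borel_measurable lebesgue" "AE x in L. \<bar>h x\<bar> \<le> H"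
  shows "integrable L (\<lambda>x. h x * v x)"
proof (rule Bochner_Integration.integrable_bound)
  show "integrable L (\<lambda>x. H * v x)" using W_integrable[OF assms(1)] by simp
  show "(\<lambda>x. h x * v x) \<in> borel_measurable L"
    using measurable_L[OF assms(2)] W_meas_L[OF assms(1)] by measurable
  show "AE x in L. norm (h x * v x) \<le> norm (H * v x)"
    using assms(3) by eventually_elim (auto simp: abs_mult intro!: mult_right_mono)
qed

lemma W_L1_bound:
  assumes v: "v \<in> W"
  shows "(\<integral>x. \<bar>v x\<bar> \<partial>L) \<le> (measure L Om + 1 / c0) * gagliardo s p v"
proof -
  have iv: "integrable L (\<lambda>x. \<bar>v x\<bar>)" using W_integrable[OF v] by simp
  have ip: "integrable L (\<lambda>x. \<bar>v x\<bar> powr p)" using W_powr_integrable[OF v] .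
  have P: "(\<integral>x. \<bar>v x\<bar> powr p \<partial>L) \<le> G v / c0"
    using poincare[OF v] c0_pos by (simp add: field_simps)
  show ?thesis
  proof (cases "G v = 0")
    case True
    then have "(\<integral>x. \<bar>v x\<bar> powr p \<partial>L) = 0"
      using P Bochner_Integration.integral_nonneg[of L "\<lambda>x. \<bar>v x\<bar> powr p"]
      by (intro antisym) auto
    then have "AE x in L. \<bar>v x\<bar> powr p = 0" using integral_nonneg_eq_0_iff_AE[OF ip] by simp
    then have "(\<integral>x. \<bar>v x\<bar> \<partial>L) = (\<integral>x. 0 \<partial>L)"
      by (intro integral_cong_AE) (use W_meas_L[OF v] in \<open>auto elim!: eventually_mono\<close>)
    then show ?thesis using True p by (simp add: gagliardo_eq[OF v])
  next
    case False
    \<comment> \<open>In place of Hoelder's inequality, split at the level t = [v]: where |y| > t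
      one has |y| \<le> t^{1-p} |y|^p, and Poincare bounds the integral of the last term by t / c0,
      which is again linear in the seminorm.\<close>
    define t where "t = gagliardo s p v"
    have t: "0 < t" "t powr p = G v"
      using False G_nonneg[of v] p by (auto simp: t_def gagliardo_eq[OF v] powr_powr)
    have "\<bar>y\<bar> \<le> t + t powr (1 - p) * \<bar>y\<bar> powr p" for y :: real
    proof (cases "\<bar>y\<bar> \<le> t")
      case False
      then have y: "0 < \<bar>y\<bar>" "t < \<bar>y\<bar>" using t by auto
      have "\<bar>y\<bar> = \<bar>y\<bar> powr (1 - p) * \<bar>y\<bar> powr p" using y by (simp flip: powr_add)
      also have "\<dots> \<le> t powr (1 - p) * \<bar>y\<bar> powr p"
        using y t p by (intro mult_right_mono powr_mono2') auto
      finally show ?thesis using t by simp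
    qed (auto intro: add_increasing2)
    then have "(\<integral>x. \<bar>v x\<bar> \<partial>L) \<le> (\<integral>x. t + t powr (1 - p) * \<bar>v x\<bar> powr p \<partial>L)"
      using iv ip by (intro integral_mono) auto
    also have "\<dots> = measure L Om * t + t powr (1 - p) * (\<integral>x. \<bar>v x\<bar> powr p \<partial>L)"
      using ip by (simp add: space_restrict_space)
    also have "\<dots> \<le> measure L Om * t + t powr (1 - p) * (G v / c0)"
      using P by (intro add_left_mono mult_left_mono) auto
    also have "t powr (1 - p) * (G v / c0) = t / c0"
      using t(1) by (simp add: t(2)[symmetric] flip: powr_add)
    finally show ?thesis by (simp add: t_def algebra_simps)
  qed
qed

lemma in_dual_bounded:
  assumes h: "h \<in> borel_measurable lebesgue" "AE x in L. \<bar>h x\<bar> \<le> H"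
  shows "in_dual_Wsp0 s p Om h"
proof -
  have "\<bar>\<integral>x. h x * v x \<partial>L\<bar> \<le> \<bar>H\<bar> * (measure L Om + 1 / c0) * gagliardo s p v" if v: "v \<in> W" for v
  proof -
    have "\<bar>\<integral>x. h x * v x \<partial>L\<bar> \<le> (\<integral>x. \<bar>h x * v x\<bar> \<partial>L)" by (rule integral_abs_bound)
    also have "\<dots> \<le> (\<integral>x. \<bar>H\<bar> * \<bar>v x\<bar> \<partial>L)"
    proof (rule integral_mono_AE)
      show "AE x in L. \<bar>h x * v x\<bar> \<le> \<bar>H\<bar> * \<bar>v x\<bar>"
        using h(2) by eventually_elim (auto simp: abs_mult intro!: mult_right_mono)
    qed (use W_mult_integrable[OF v h] W_integrable[OF v] in auto)
    also have "\<dots> \<le> \<bar>H\<bar> * ((measure L Om + 1 / c0) * gagliardo s p v)"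
      using W_L1_bound[OF v] by (simp add: mult_left_mono)
    finally show ?thesis by (simp add: mult.assoc)
  qed
  then show ?thesis
    unfolding in_dual_Wsp0_def using W_mult_integrable[OF _ h]
    by (auto simp flip: integral_L integrable_L intro!: exI[of _ "\<bar>H\<bar> * (measure L Om + 1 / c0)"])
qed

section \<open>Submodularity, convexity and semicontinuity of the seminorm; comparison\<close>

lemma G_submodular:
  assumes "u \<in> W" "w \<in> W"
  shows "G (\<lambda>x. max (u x) (w x)) + G (\<lambda>x. min (u x) (w x)) \<le> G u + G w"
proof -
  have "G (\<lambda>x. max (u x) (w x)) + G (\<lambda>x. min (u x) (w x))
      = (\<integral>z. \<bar>dif (\<lambda>x. max (u x) (w x)) z\<bar> powr p + \<bar>dif (\<lambda>x. min (u x) (w x)) z\<bar> powr p \<partial>gmeas)"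
    unfolding G_def using W_max[OF assms] W_min[OF assms]
    by (intro Bochner_Integration.integral_add[symmetric]) (auto simp: W_iff)
  also have "\<dots> \<le> (\<integral>z. \<bar>dif u z\<bar> powr p + \<bar>dif w z\<bar> powr p \<partial>gmeas)"
  proof (rule integral_mono)
    show "\<bar>dif (\<lambda>x. max (u x) (w x)) z\<bar> powr p + \<bar>dif (\<lambda>x. min (u x) (w x)) z\<bar> powr p
        \<le> \<bar>dif u z\<bar> powr p + \<bar>dif w z\<bar> powr p" for z
      unfolding dif_def using powr_submodular[OF p] by simp
  qed (use assms W_max[OF assms] W_min[OF assms] in \<open>auto simp: W_iff\<close>)
  also have "\<dots> = G u + G w"
    unfolding G_def using assms by (intro Bochner_Integration.integral_add) (auto simp: W_iff)
  finally show ?thesis .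
qed

lemma G_mono:
  assumes "u \<in> W" "w \<in> W" "\<And>x y. \<bar>u x - u y\<bar> \<le> \<bar>w x - w y\<bar>"
  shows "G u \<le> G w"
  unfolding G_def using assms p
  by (intro integral_mono) (auto simp: W_iff dif_def intro!: powr_mono2)

text \<open>\<open>powr_tangent\<close> integrated: \<open>p * A u\<close> is a subgradient of
  \<open>G\<close> at u.\<close>

lemma G_tangent:
  assumes "u \<in> W" "v \<in> W"
  shows "G u + p * A u (\<lambda>x. v x - u x) \<le> G v"
proof -
  have i: "integrable gmeas (\<lambda>z. jp p (dif u z) * dif (\<lambda>x. v x - u x) z)"
    using A_integrable[OF assms(1) W_diff[OF assms(2,1)]] .
  have "G u + p * A u (\<lambda>x. v x - u x)
      = (\<integral>z. \<bar>dif u z\<bar> powr p + p * (jp p (dif u z) * dif (\<lambda>x. v x - u x) z) \<partial>gmeas)"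
    unfolding G_def A_def using assms i by (subst Bochner_Integration.integral_add) (auto simp: W_iff)
  also have "\<dots> \<le> G v"
    unfolding G_def
  proof (rule integral_mono)
    show "\<bar>dif u z\<bar> powr p + p * (jp p (dif u z) * dif (\<lambda>x. v x - u x) z) \<le> \<bar>dif v z\<bar> powr p" for z
      using powr_tangent[OF p, of "dif u z" "dif v z"] by (simp add: dif_def algebra_simps)
  qed (use assms i in \<open>auto simp: W_iff\<close>)
  finally show ?thesis .
qed

text \<open>Fatou's lemma along an almost everywhere convergent sequence, which is what monotone
  limits provide. The bounds \<open>g k\<close> also put the limit into \<open>W\<close>.\<close>

lemma G_lsc:
  assumes wk: "\<And>k. w k \<in> W" and w: "w' \<in> borel_measurable lebesgue"
    and lim: "AE x in lebesgue. (\<lambda>k. w k x) \<longlonglongrightarrow> w' x"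
    and G: "\<And>k. G (w k) \<le> g k" "g \<longlonglongrightarrow> c"
  shows "w' \<in> W" "G w' \<le> c"
proof -
  have c: "0 \<le> c" using G(2) by (rule LIMSEQ_le_const) (use G(1) G_nonneg order_trans in blast)
  have "AE x in lebesgue. \<forall>k. x \<notin> Om \<longrightarrow> w k x = 0"
    unfolding AE_all_countable using W_zero_outside[OF wk] by blast
  with lim have zero: "AE x in lebesgue. x \<notin> Om \<longrightarrow> w' x = 0"
    by eventually_elim (auto simp: LIMSEQ_const_iff)
  have lim2: "AE z in gmeas. (\<lambda>k. ennreal (\<bar>dif (w k) z\<bar> powr p)) \<longlonglongrightarrow> ennreal (\<bar>dif w' z\<bar> powr p)"
    using AE_gmeas_fst[OF lim] AE_gmeas_snd[OF lim]
  proof eventually_elim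
    case (elim z)
    then show ?case unfolding dif_def using p by (intro tendsto_ennrealI tendsto_powr' tendsto_intros) auto
  qed
  have "(\<integral>\<^sup>+z. ennreal (\<bar>dif w' z\<bar> powr p) \<partial>gmeas)
      = (\<integral>\<^sup>+z. liminf (\<lambda>k. ennreal (\<bar>dif (w k) z\<bar> powr p)) \<partial>gmeas)"
  proof (rule nn_integral_cong_AE)
    show "AE z in gmeas. ennreal (\<bar>dif w' z\<bar> powr p) = liminf (\<lambda>k. ennreal (\<bar>dif (w k) z\<bar> powr p))"
      using lim2 by eventually_elim (rule lim_imp_Liminf[symmetric, OF sequentially_bot])
  qed
  also have "\<dots> \<le> liminf (\<lambda>k. \<integral>\<^sup>+z. ennreal (\<bar>dif (w k) z\<bar> powr p) \<partial>gmeas)"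
  proof (rule nn_integral_liminf)
    show "(\<lambda>z. ennreal (\<bar>dif (w k) z\<bar> powr p)) \<in> borel_measurable gmeas" for k
      using W_meas_dif[OF wk[of k]] by measurable
  qed
  also have "\<dots> \<le> liminf (\<lambda>k. ennreal (g k))"
  proof (intro Liminf_mono always_eventually allI)
    fix k
    have "(\<integral>\<^sup>+z. ennreal (\<bar>dif (w k) z\<bar> powr p) \<partial>gmeas) = ennreal (G (w k))"
      unfolding G_def by (intro nn_integral_eq_integral W_integrable_dif wk) auto
    then show "(\<integral>\<^sup>+z. ennreal (\<bar>dif (w k) z\<bar> powr p) \<partial>gmeas) \<le> ennreal (g k)"
      using G(1)[of k] by (simp add: ennreal_leI)
  qed
  also have "liminf (\<lambda>k. ennreal (g k)) = ennreal c"
    by (intro lim_imp_Liminf tendsto_ennrealI G) simp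
  finally have le: "(\<integral>\<^sup>+z. ennreal (\<bar>dif w' z\<bar> powr p) \<partial>gmeas) \<le> ennreal c" .
  have int: "integrable gmeas (\<lambda>z. \<bar>dif w' z\<bar> powr p)"
  proof (rule integrableI_nonneg)
    show "(\<lambda>z. \<bar>dif w' z\<bar> powr p) \<in> borel_measurable gmeas"
      using w by (simp add: measurable_gmeas_eq borel_measurable_dif_powr)
  qed (use le in \<open>auto intro: le_less_trans\<close>)
  then show "w' \<in> W" using w zero by (simp add: W_iff)
  have "ennreal (G w') \<le> ennreal c"
    using le unfolding G_def by (subst nn_integral_eq_integral[symmetric]) (auto intro: int)
  then show "G w' \<le> c" using c by (simp add: ennreal_le_iff)
qed

text \<open>Test with (u - w)^+. The integrand q is pointwise nonnegative because \<open>jp\<close>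
  is increasing, while its integral is at most 0. On Om \<times> far the second values vanish, so q
  there equals (jp u - jp w)(u - w)^+ at the first point; its integral over \<open>Om\<close> must
  be 0, and strict monotonicity of \<open>jp\<close> concludes.\<close>

lemma weak_comparison:
  assumes uw: "u \<in> W" "w \<in> W"
    and le: "\<And>v. v \<in> W \<Longrightarrow> AE x in lebesgue. 0 \<le> v x \<Longrightarrow> A u v \<le> A w v"
  shows "AE x in lebesgue. u x \<le> w x"
proof -
  define v where "v = (\<lambda>x. max (u x - w x) 0)"
  have v: "v \<in> W" unfolding v_def using uw by (intro W_pos W_diff)
  define q where "q = (\<lambda>z. (jp p (dif u z) - jp p (dif w z)) * dif v z)"
  have qeq: "q = (\<lambda>z. jp p (dif u z) * dif v z - jp p (dif w z) * dif v z)"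
    by (simp add: q_def left_diff_distrib)
  have iq: "integrable gmeas q"
    unfolding qeq using A_integrable uw v by auto
  have "integral\<^sup>L gmeas q = A u v - A w v"
    unfolding qeq A_def using A_integrable uw v by (intro Bochner_Integration.integral_diff) auto
  also have "\<dots> \<le> 0" using le[OF v] by (simp add: v_def)
  finally have q0: "integral\<^sup>L gmeas q \<le> 0" .
  have qnn: "0 \<le> q z" for z
  proof (cases "dif u z \<le> dif w z")
    case True
    then have "dif v z \<le> 0" by (auto simp: v_def dif_def)
    then show ?thesis using jp_mono[OF p True] by (auto simp: q_def intro: mult_nonpos_nonpos)
  next
    case False
    then have "0 \<le> dif v z" "jp p (dif w z) \<le> jp p (dif u z)"
      using jp_mono[OF p, of "dif w z" "dif u z"] by (auto simp: v_def dif_def)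
    then show ?thesis by (auto simp: q_def)
  qed
  define g where "g = (\<lambda>x. (jp p (u x) - jp p (w x)) * v x)"
  have g: "g \<in> borel_measurable lebesgue"
    unfolding g_def using W_meas[OF uw(1)] W_meas[OF uw(2)] W_meas[OF v] by measurable
  have gnn: "0 \<le> g x" for x
    using jp_mono[OF p, of "w x" "u x"] by (auto simp: g_def v_def max_def)
  have "AE z in gmeas. fst z \<in> Om \<longrightarrow> snd z \<in> far \<longrightarrow> g (fst z) \<le> q z"
    using AE_gmeas_snd[OF W_zero_outside[OF uw(1)]] AE_gmeas_snd[OF W_zero_outside[OF uw(2)]]
    by eventually_elim (auto simp: g_def q_def dif_def v_def dest: far_disjoint)
  from cross_integral[OF iq _ g _ this] gnn qnn
  have ig: "integrable L g" and "c0 * integral\<^sup>L L g \<le> integral\<^sup>L gmeas q" by auto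
  then have "c0 * integral\<^sup>L L g \<le> 0" using q0 by linarith
  then have "integral\<^sup>L L g \<le> 0" using c0_pos by (simp add: mult_le_0_iff)
  moreover have "0 \<le> integral\<^sup>L L g" using gnn by (rule Bochner_Integration.integral_nonneg)
  ultimately have "AE x in L. g x = 0" using integral_nonneg_eq_0_iff_AE[OF ig] gnn by auto
  then have "AE x in lebesgue. x \<in> Om \<longrightarrow> g x = 0" by (simp add: AE_L)
  with W_zero_outside[OF uw(1)] W_zero_outside[OF uw(2)]
  show ?thesis
  proof eventually_elim
    case (elim x)
    show ?case
    proof (cases "x \<in> Om")
      case True
      then have "g x = 0" using elim by simp
      then show ?thesis using jp_strict_mono[OF p, of "w x" "u x"] by (cases "u x \<le> w x") (auto simp: g_def v_def max_def)
    qed (use elim in simp)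
  qed
qed

end

section \<open>Energy minimisers\<close>

context fractional_setting
begin

definition bounded_rhs :: "('a \<Rightarrow> real) \<Rightarrow> real \<Rightarrow> bool" where
  "bounded_rhs h H \<longleftrightarrow> h \<in> borel_measurable lebesgue \<and> (AE x in L. 0 \<le> h x \<and> h x \<le> H)"

definition E :: "('a \<Rightarrow> real) \<Rightarrow> ('a \<Rightarrow> real) \<Rightarrow> real" where
  "E h v = G v / p - (\<integral>x. h x * v x \<partial>L)"

definition is_minimizer :: "('a \<Rightarrow> real) \<Rightarrow> ('a \<Rightarrow> real) \<Rightarrow> bool" where
  "is_minimizer h u \<longleftrightarrow> u \<in> W \<and> (\<forall>v\<in>W. E h u \<le> E h v)"

lemma bounded_rhs_meas: "bounded_rhs h H \<Longrightarrow> h \<in> borel_measurable lebesgue"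
  and bounded_rhs_AE: "bounded_rhs h H \<Longrightarrow> AE x in L. 0 \<le> h x \<and> h x \<le> H"
  by (auto simp: bounded_rhs_def)

lemma bounded_rhs_abs: "bounded_rhs h H \<Longrightarrow> AE x in L. \<bar>h x\<bar> \<le> H"
  by (drule bounded_rhs_AE, erule eventually_mono) auto

lemma rhs_mult_integrable: "bounded_rhs h H \<Longrightarrow> v \<in> W \<Longrightarrow> integrable L (\<lambda>x. h x * v x)"
  using W_mult_integrable[OF _ bounded_rhs_meas bounded_rhs_abs] .

text \<open>Truncation is a contraction, so no interaction grows. Between x in \<open>Om\<close> and
  \<open>far\<close> the difference is v(x) itself, and the tangent at M shows a drop of at least p
  M^{p-1} (v - M)^+. Through \<open>c0\<close> this pays for the linear term, which loses at most H
  times the integral of (v - M)^+; where v < 0 that term only improves, as h \<ge> 0.\<close>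

lemma E_truncate:
  assumes h: "bounded_rhs h H" and M: "0 < M" "H \<le> c0 * M powr (p - 1)" and v: "v \<in> W"
  shows "E h (\<lambda>x. min (max (v x) 0) M) \<le> E h v"
proof -
  define w where "w = (\<lambda>x. min (max (v x) 0) M)"
  have w: "w \<in> W" unfolding w_def using v M by (intro W_truncate) auto
  define e where "e = (\<lambda>x. max (v x - M) 0)"
  have e_int: "integrable L e"
    unfolding e_def using W_integrable[OF v] by (intro integrable_max) auto
  have i1: "integrable gmeas (\<lambda>z. \<bar>dif v z\<bar> powr p - \<bar>dif w z\<bar> powr p)"
    using v w by (auto simp: W_iff)
  have i2: "\<bar>dif w z\<bar> powr p \<le> \<bar>dif v z\<bar> powr p" for z
    using p by (intro powr_mono2) (auto simp: w_def dif_def)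
  have i3: "(\<lambda>x. p * (M powr (p - 1) * e x)) \<in> borel_measurable lebesgue"
    unfolding e_def using W_meas[OF v] by measurable
  have i4: "AE z in gmeas. fst z \<in> Om \<longrightarrow> snd z \<in> far \<longrightarrow>
      p * (M powr (p - 1) * e (fst z)) \<le> \<bar>dif v z\<bar> powr p - \<bar>dif w z\<bar> powr p"
    using AE_gmeas_snd[OF W_zero_outside[OF v]]
  proof (eventually_elim, intro impI)
    fix z assume z: "snd z \<notin> Om \<longrightarrow> v (snd z) = 0" "fst z \<in> Om" "snd z \<in> far"
    then have *: "dif v z = v (fst z)" "dif w z = w (fst z)"
      using far_disjoint M by (auto simp: dif_def w_def)
    show "p * (M powr (p - 1) * e (fst z)) \<le> \<bar>dif v z\<bar> powr p - \<bar>dif w z\<bar> powr p"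
    proof (cases "v (fst z) \<le> M")
      case True
      then show ?thesis unfolding * using p by (auto simp: e_def w_def intro!: powr_mono2)
    next
      case False
      then have "w (fst z) = M" "e (fst z) = v (fst z) - M" using M by (auto simp: w_def e_def)
      then show ?thesis
        unfolding * using powr_tangent[OF p, of M "v (fst z)"] M by (simp add: jp_nonneg_eq mult.assoc)
    qed
  qed
  have e0: "0 \<le> e x" for x by (simp add: e_def)
  have "c0 * (\<integral>x. p * (M powr (p - 1) * e x) \<partial>L)
      \<le> (\<integral>z. \<bar>dif v z\<bar> powr p - \<bar>dif w z\<bar> powr p \<partial>gmeas)"
    by (rule cross_integral(2)[OF i1 _ i3 _ i4]) (use i2 e0 p in auto)
  also have "\<dots> = G v - G w"
    unfolding G_def using v w by (intro Bochner_Integration.integral_diff) (auto simp: W_iff)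
  finally have 1: "p * (c0 * M powr (p - 1) * integral\<^sup>L L e) \<le> G v - G w"
    by (simp add: mult_ac)
  have "(\<integral>x. h x * v x \<partial>L) - (\<integral>x. h x * w x \<partial>L) = (\<integral>x. h x * v x - h x * w x \<partial>L)"
    using rhs_mult_integrable[OF h] v w by (intro Bochner_Integration.integral_diff[symmetric]) auto
  also have "\<dots> \<le> (\<integral>x. H * e x \<partial>L)"
  proof (rule integral_mono_AE)
    show "AE x in L. h x * v x - h x * w x \<le> H * e x"
      using bounded_rhs_AE[OF h]
    proof eventually_elim
      case (elim x)
      have "h x * (v x - w x) \<le> h x * e x"
        using elim M by (intro mult_left_mono) (auto simp: w_def e_def)
      also have "\<dots> \<le> H * e x" using elim by (intro mult_right_mono) (auto simp: e_def)
      finally show ?case by (simp add: algebra_simps)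
    qed
  qed (use rhs_mult_integrable[OF h] v w e_int in auto)
  also have "\<dots> \<le> c0 * M powr (p - 1) * integral\<^sup>L L e"
    using mult_right_mono[OF M(2) Bochner_Integration.integral_nonneg[of L e]] e0 by simp
  also have "\<dots> \<le> (G v - G w) / p" using 1 p by (simp add: field_simps)
  finally show ?thesis unfolding E_def w_def[symmetric] by (simp add: diff_divide_distrib)
qed

lemma E_submodular:
  assumes h: "bounded_rhs h H" and uw: "u \<in> W" "w \<in> W"
  shows "E h (\<lambda>x. max (u x) (w x)) + E h (\<lambda>x. min (u x) (w x)) \<le> E h u + E h w"
proof -
  have i: "integrable L (\<lambda>x. h x * max (u x) (w x))" "integrable L (\<lambda>x. h x * min (u x) (w x))"
    "integrable L (\<lambda>x. h x * u x)" "integrable L (\<lambda>x. h x * w x)"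
    using rhs_mult_integrable[OF h] uw W_max W_min by auto
  have "(\<integral>x. h x * max (u x) (w x) \<partial>L) + (\<integral>x. h x * min (u x) (w x) \<partial>L)
      = (\<integral>x. h x * max (u x) (w x) + h x * min (u x) (w x) \<partial>L)"
    using i by (intro Bochner_Integration.integral_add[symmetric])
  also have "\<dots> = (\<integral>x. h x * u x + h x * w x \<partial>L)"
    by (rule Bochner_Integration.integral_cong) (auto simp: max_def min_def)
  also have "\<dots> = (\<integral>x. h x * u x \<partial>L) + (\<integral>x. h x * w x \<partial>L)"
    using i by (intro Bochner_Integration.integral_add)
  finally have eq: "(\<integral>x. h x * max (u x) (w x) \<partial>L) + (\<integral>x. h x * min (u x) (w x) \<partial>L)
      = (\<integral>x. h x * u x \<partial>L) + (\<integral>x. h x * w x \<partial>L)" .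
  have "(G (\<lambda>x. max (u x) (w x)) + G (\<lambda>x. min (u x) (w x))) / p \<le> (G u + G w) / p"
    using G_submodular[OF uw] p by (intro divide_right_mono) auto
  then show ?thesis using eq unfolding E_def by (simp add: add_divide_distrib)
qed

text \<open>The uniform bounds H and M give convergence of the linear term by dominated convergence;
  the rest is \<open>G_lsc\<close>. Right-hand sides may vary with k so that the limit of the
  iteration is covered along with the construction of minimisers.\<close>

lemma E_lsc:
  assumes wk: "\<And>k. w k \<in> W" "\<And>k. AE x in L. \<bar>w k x\<bar> \<le> M" and w: "w' \<in> borel_measurable lebesgue"
    and lim: "AE x in lebesgue. (\<lambda>k. w k x) \<longlonglongrightarrow> w' x"
    and hk: "\<And>k. bounded_rhs (hk k) H" and h: "h \<in> borel_measurable lebesgue"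
      "AE x in L. (\<lambda>k. hk k x) \<longlonglongrightarrow> h x"
    and E: "\<And>k. E (hk k) (w k) \<le> e k" "e \<longlonglongrightarrow> c"
  shows "w' \<in> W" "E h w' \<le> c"
proof -
  have limL: "AE x in L. (\<lambda>k. w k x) \<longlonglongrightarrow> w' x"
    using lim by (auto simp: AE_L elim: eventually_mono)
  have "(\<lambda>k. \<integral>x. hk k x * w k x \<partial>L) \<longlonglongrightarrow> (\<integral>x. h x * w' x \<partial>L)"
  proof (rule integral_dominated_convergence[where w = "\<lambda>x. H * M"])
    show "(\<lambda>x. h x * w' x) \<in> borel_measurable L" "(\<lambda>x. hk k x * w k x) \<in> borel_measurable L" for k
      using measurable_L[OF h(1)] measurable_L[OF w] measurable_L[OF bounded_rhs_meas[OF hk[of k]]]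
        W_meas_L[OF wk(1)[of k]] by measurable
    show "AE x in L. (\<lambda>k. hk k x * w k x) \<longlonglongrightarrow> h x * w' x"
      using h(2) limL by eventually_elim (rule tendsto_mult)
    show "AE x in L. norm (hk k x * w k x) \<le> H * M" for k
      using bounded_rhs_abs[OF hk[of k]] wk(2)[of k]
    proof eventually_elim
      case (elim x)
      then show ?case unfolding real_norm_def abs_mult by (intro mult_mono) auto
    qed
  qed simp
  then have lim': "(\<lambda>k. p * (e k + (\<integral>x. hk k x * w k x \<partial>L))) \<longlonglongrightarrow> p * (c + (\<integral>x. h x * w' x \<partial>L))"
    using E(2) by (intro tendsto_intros)
  have "G (w k) \<le> p * (e k + (\<integral>x. hk k x * w k x \<partial>L))" for k
    using E(1)[of k] p by (simp add: E_def field_simps)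
  from G_lsc[OF wk(1) w lim this lim']
  show "w' \<in> W" "E h w' \<le> c" using p by (auto simp: E_def field_simps)
qed

text \<open>
  The energy is submodular, so the maxima over tails of a fast minimising sequence are again almost
  minimising; two monotone limits then replace weak compactness.
\<close>

lemma ex_minimizer:
  assumes h: "bounded_rhs h H" and M: "0 < M" "H \<le> c0 * M powr (p - 1)"
  shows "\<exists>u. is_minimizer h u \<and> (\<forall>x. 0 \<le> u x \<and> u x \<le> M)"
proof -
  \<comment> \<open>The energy is bounded below on functions with values in [0, M], and by
    \<open>E_truncate\<close> a minimiser among these is one in all of \<open>W\<close>.\<close>
  define K where "K = {v \<in> W. \<forall>x. 0 \<le> v x \<and> v x \<le> M}"
  have K0: "(\<lambda>x. 0) \<in> K" using W_zero M by (simp add: K_def)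
  have lower: "- (H * M * measure L Om) \<le> E h v" if "v \<in> K" for v
  proof -
    have "(\<integral>x. h x * v x \<partial>L) \<le> (\<integral>x. H * M \<partial>L)"
    proof (rule integral_mono_AE)
      show "AE x in L. h x * v x \<le> H * M"
        using bounded_rhs_AE[OF h] by eventually_elim (use that in \<open>auto simp: K_def intro!: mult_mono\<close>)
    qed (use that rhs_mult_integrable[OF h] in \<open>auto simp: K_def\<close>)
    also have "\<dots> = H * M * measure L Om" by (simp add: space_restrict_space)
    finally show ?thesis using divide_nonneg_pos[OF G_nonneg[of v], of p] p by (simp add: E_def)
  qed
  define m where "m = Inf (E h ` K)"
  have bdd: "bdd_below (E h ` K)" using lower by (auto simp: bdd_below_def)
  have m_le: "m \<le> E h v" if "v \<in> K" for v
    unfolding m_def using that bdd by (intro cInf_lower) auto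
  have "\<exists>v\<in>K. E h v \<le> m + (1 / 2) ^ n" for n :: nat
  proof -
    have "m < m + (1 / 2) ^ n" by simp
    then have "\<exists>y\<in>E h ` K. y < m + (1 / 2) ^ n"
      unfolding m_def using K0 bdd by (subst (asm) cInf_less_iff) auto
    then show ?thesis by (auto intro: less_imp_le)
  qed
  then obtain v where v: "\<And>n. v n \<in> K" "\<And>n. E h (v n) \<le> m + (1 / 2) ^ n" by metis
  \<comment> \<open>\<open>w n k\<close> is the maximum of v_n, ..., v_{n+k}.\<close>
  define w where "w n = rec_nat (v n) (\<lambda>k g x. max (g x) (v (n + Suc k) x))" for n
  have w0: "w n 0 = v n" and wS: "w n (Suc k) = (\<lambda>x. max (w n k x) (v (n + Suc k) x))" for n k
    by (simp_all add: w_def)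
  have wK: "w n k \<in> K" for n k
  proof (induction k)
    case (Suc k)
    then show ?case using v(1)[of "n + Suc k"] W_max by (auto simp: wS K_def le_max_iff_disj)
  qed (simp add: w0 v)
  \<comment> \<open>The minimum in the submodularity inequality lies in \<open>K\<close> and so has
    energy at least m; hence each new member raises the energy by at most its own excess
    (1/2)^{n+k+1}, and these excesses form a geometric sum.\<close>
  have wE: "E h (w n k) \<le> m + 2 * (1 / 2) ^ n - (1 / 2) ^ (n + k)" for n k
  proof (induction k)
    case (Suc k)
    have "(\<lambda>x. min (w n k x) (v (n + Suc k) x)) \<in> K"
      using wK[of n k] v(1)[of "n + Suc k"] W_min by (auto simp: K_def min_le_iff_disj)
    from m_le[OF this] E_submodular[OF h, of "w n k" "v (n + Suc k)"]
    show ?case using wK[of n k] v[of "n + Suc k"] Suc by (simp add: wS K_def)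
  qed (use v[of n] in \<open>simp add: w0\<close>)
  have winc: "incseq (\<lambda>k. w n k x)" for n x
    by (rule incseq_SucI) (simp add: wS)
  have wconv: "convergent (\<lambda>k. w n k x)" for n x
    by (rule Bseq_monoseq_convergent)
       (use wK[of n] winc in \<open>auto simp: K_def intro!: BseqI'[of _ M] incseq_imp_monoseq\<close>)
  define S where "S n x = lim (\<lambda>k. w n k x)" for n x
  have wS_lim: "(\<lambda>k. w n k x) \<longlonglongrightarrow> S n x" for n x
    unfolding S_def using wconv by (simp add: convergent_LIMSEQ_iff)
  have Smeas: "S n \<in> borel_measurable lebesgue" for n
    unfolding S_def using wK by (intro borel_measurable_lim_metric W_meas) (auto simp: K_def)
  have wWM: "w n k \<in> W" "AE x in L. \<bar>w n k x\<bar> \<le> M" for n k using wK[of n k] by (auto simp: K_def)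
  have Slim: "(\<lambda>k. m + 2 * (1 / 2) ^ n - (1 / 2) ^ (n + k)) \<longlonglongrightarrow> m + 2 * (1 / 2) ^ n - 0" for n :: nat
    using LIMSEQ_ignore_initial_segment[OF LIMSEQ_power_zero[of "1 / 2 :: real"], of n]
    by (intro tendsto_intros) (simp add: add.commute)
  have SW: "S n \<in> W" and SE: "E h (S n) \<le> m + 2 * (1 / 2) ^ n" for n
    using E_lsc[of "w n" M, OF wWM Smeas _ h bounded_rhs_meas[OF h] _ wE Slim] wS_lim by auto
  have Sb: "0 \<le> S n x" "S n x \<le> M" for n x
    using wK[of n] by (auto simp: K_def intro: LIMSEQ_le_const[OF wS_lim] LIMSEQ_le_const2[OF wS_lim])
  \<comment> \<open>Leaving v_n out of the maximum gives a smaller function, so the tail suprema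
    \<open>S n\<close> decrease in n.\<close>
  have wshift: "w (Suc n) k x \<le> w n (Suc k) x" for n k x
    by (induction k) (auto simp: w0 wS max.coboundedI1 max.coboundedI2)
  have Sdec: "decseq (\<lambda>n. S n x)" for x
    by (rule decseq_SucI, rule LIMSEQ_le[OF wS_lim LIMSEQ_Suc[OF wS_lim]]) (use wshift in auto)
  define u where "u x = lim (\<lambda>n. S n x)" for x
  have "convergent (\<lambda>n. S n x)" for x
    by (rule Bseq_monoseq_convergent)
       (use Sb Sdec in \<open>auto intro!: BseqI'[of _ M] decseq_imp_monoseq\<close>)
  then have ulim: "(\<lambda>n. S n x) \<longlonglongrightarrow> u x" for x
    unfolding u_def by (simp add: convergent_LIMSEQ_iff)
  have umeas: "u \<in> borel_measurable lebesgue"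
    unfolding u_def by (intro borel_measurable_lim_metric Smeas)
  have "(\<lambda>n. m + 2 * (1 / 2) ^ n) \<longlonglongrightarrow> m + 2 * 0"
    by (intro tendsto_intros LIMSEQ_power_zero) auto
  then have uW: "u \<in> W" and uE: "E h u \<le> m"
    using E_lsc[of S M, OF SW _ umeas _ h bounded_rhs_meas[OF h] _ SE] ulim Sb by auto
  have ub: "0 \<le> u x \<and> u x \<le> M" for x
    using Sb by (auto intro: LIMSEQ_le_const[OF ulim] LIMSEQ_le_const2[OF ulim])
  have "E h u \<le> E h y" if "y \<in> W" for y
  proof -
    have "(\<lambda>x. min (max (y x) 0) M) \<in> K" using W_truncate[OF that] M by (auto simp: K_def)
    from m_le[OF this] show ?thesis using uE E_truncate[OF h M that] by linarith
  qed
  then show ?thesis using uW ub by (auto simp: is_minimizer_def)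
qed

section \<open>Euler-Lagrange equation, comparison and positivity of minimisers\<close>

lemma A_scale_right: "A u (\<lambda>x. a * v x) = a * A u v"
  unfolding A_def dif_def by (subst integral_mult_right_zero[symmetric]) (simp add: algebra_simps)

text \<open>The tangent is taken at the perturbed point u + v / (n + 1) instead of u. Minimality
  then yields the inequality with \<open>A (c n) v\<close>, and continuity of \<open>jp\<close>
  suffices to let n tend to infinity; \<open>G\<close> itself is never differentiated. The reverse
  inequality comes from testing with -v.\<close>

lemma minimizer_weak_le:
  assumes h: "bounded_rhs h H" and u: "is_minimizer h u" and v: "v \<in> W"
  shows "(\<integral>x. h x * v x \<partial>L) \<le> A u v"
proof -
  define c where "c n x = u x + (1 / real (Suc n)) * v x" for n x
  have uW: "u \<in> W" using u by (simp add: is_minimizer_def)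
  have cW: "c n \<in> W" for n
    using W_lin[OF uW v, of 1 "1 / real (Suc n)"] unfolding c_def by simp
  have le: "(\<integral>x. h x * v x \<partial>L) \<le> A (c n) v" for n
  proof -
    let ?t = "1 / real (Suc n)"
    have t: "0 < ?t" by simp
    have "(\<lambda>x. u x - c n x) = (\<lambda>x. (- ?t) * v x)" by (auto simp: c_def)
    then have "G (c n) - p * ?t * A (c n) v \<le> G u"
      using G_tangent[OF cW uW, of n] A_scale_right[of "c n" "- ?t" v] by simp
    moreover have "(\<integral>x. h x * c n x \<partial>L) = (\<integral>x. h x * u x + ?t * (h x * v x) \<partial>L)"
      by (intro Bochner_Integration.integral_cong) (auto simp: c_def algebra_simps)
    then have "(\<integral>x. h x * c n x \<partial>L) = (\<integral>x. h x * u x \<partial>L) + ?t * (\<integral>x. h x * v x \<partial>L)"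
      using rhs_mult_integrable[OF h uW] rhs_mult_integrable[OF h v] by simp
    moreover have "G u / p - (\<integral>x. h x * u x \<partial>L) \<le> G (c n) / p - (\<integral>x. h x * c n x \<partial>L)"
      using u cW[of n] by (simp add: is_minimizer_def E_def)
    moreover have "(G (c n) - p * ?t * A (c n) v) / p = G (c n) / p - ?t * A (c n) v"
      using p by (simp add: diff_divide_distrib)
    ultimately have "?t * (\<integral>x. h x * v x \<partial>L) \<le> ?t * A (c n) v"
      using p divide_right_mono[of "G (c n) - p * ?t * A (c n) v" "G u" p] by linarith
    then show ?thesis using t by (simp only: mult_le_cancel_left_pos)
  qed
  have "(\<lambda>n. A (c n) v) \<longlonglongrightarrow> A u v"
    unfolding A_def
  proof (rule integral_dominated_convergence)
    show "integrable gmeas (\<lambda>z. 2 powr p * (\<bar>dif u z\<bar> powr p + \<bar>dif v z\<bar> powr p) + \<bar>dif v z\<bar> powr p)"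
      using uW v by (auto simp: W_iff)
    show "(\<lambda>z. jp p (dif u z) * dif v z) \<in> borel_measurable gmeas"
      "(\<lambda>z. jp p (dif (c n) z) * dif v z) \<in> borel_measurable gmeas" for n
      using W_meas_dif[OF uW] W_meas_dif[OF v] W_meas_dif[OF cW[of n]] by measurable
    have dc: "dif (c n) z = dif u z + 1 / real (Suc n) * dif v z" for n z
      by (simp add: dif_def c_def algebra_simps diff_divide_distrib)
    show "AE z in gmeas. (\<lambda>n. jp p (dif (c n) z) * dif v z) \<longlonglongrightarrow> jp p (dif u z) * dif v z"
    proof (rule AE_I2)
      fix z
      have "(\<lambda>n. dif u z + 1 / real (Suc n) * dif v z) \<longlonglongrightarrow> dif u z + 0 * dif v z"
        by (intro tendsto_intros LIMSEQ_inverse_real_of_nat[unfolded inverse_eq_divide])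
      then have "(\<lambda>n. dif (c n) z) \<longlonglongrightarrow> dif u z" unfolding dc by simp
      then have "(\<lambda>n. jp p (dif (c n) z)) \<longlonglongrightarrow> jp p (dif u z)"
        by (rule isCont_tendsto_compose[OF isCont_jp[OF p]])
      then show "(\<lambda>n. jp p (dif (c n) z) * dif v z) \<longlonglongrightarrow> jp p (dif u z) * dif v z"
        by (intro tendsto_intros)
    qed
    show "AE z in gmeas. norm (jp p (dif (c n) z) * dif v z)
        \<le> 2 powr p * (\<bar>dif u z\<bar> powr p + \<bar>dif v z\<bar> powr p) + \<bar>dif v z\<bar> powr p" for n
    proof (rule AE_I2)
      fix z
      have "\<bar>1 / real (Suc n) * dif v z\<bar> \<le> \<bar>dif v z\<bar>"
        using mult_left_le_one_le[of "\<bar>dif v z\<bar>" "1 / real (Suc n)"] by (simp add: abs_mult)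
      then have "\<bar>dif (c n) z\<bar> \<le> \<bar>dif u z\<bar> + \<bar>dif v z\<bar>" unfolding dc by linarith
      then have "\<bar>dif (c n) z\<bar> powr p \<le> (\<bar>dif u z\<bar> + \<bar>dif v z\<bar>) powr p" using p by (intro powr_mono2) auto
      also have "\<dots> \<le> 2 powr p * (\<bar>dif u z\<bar> powr p + \<bar>dif v z\<bar> powr p)" using p by (intro powr_sum_le) auto
      finally show "norm (jp p (dif (c n) z) * dif v z)
        \<le> 2 powr p * (\<bar>dif u z\<bar> powr p + \<bar>dif v z\<bar> powr p) + \<bar>dif v z\<bar> powr p"
        using abs_jp_mult_le[OF p, of "dif (c n) z" "dif v z"] by simp
    qed
  qed
  then show ?thesis by (rule LIMSEQ_le_const) (use le in blast)
qed

lemma minimizer_weak: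
  assumes h: "bounded_rhs h H" and u: "is_minimizer h u" and v: "v \<in> W"
  shows "A u v = (\<integral>x. h x * v x \<partial>L)"
proof (rule antisym)
  have "(\<integral>x. h x * ((- 1) * v x) \<partial>L) \<le> A u (\<lambda>x. (- 1) * v x)"
    using W_scale[OF v] by (rule minimizer_weak_le[OF h u])
  then show "A u v \<le> (\<integral>x. h x * v x \<partial>L)"
    unfolding A_scale_right by simp
qed (rule minimizer_weak_le[OF assms])

lemma minimizer_le_supersolution:
  assumes h: "bounded_rhs h H" and u: "is_minimizer h u" and w: "w \<in> W"
    and super: "\<And>v. v \<in> W \<Longrightarrow> AE x in lebesgue. 0 \<le> v x \<Longrightarrow> (\<integral>x. h x * v x \<partial>L) \<le> A w v"
  shows "AE x in lebesgue. u x \<le> w x"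
  using u by (intro weak_comparison w) (auto simp: is_minimizer_def minimizer_weak[OF h u] super)

lemma minimizer_mono:
  assumes h: "bounded_rhs h H" "bounded_rhs h' H'" "AE x in L. h x \<le> h' x"
    and u: "is_minimizer h u" "is_minimizer h' u'"
  shows "AE x in lebesgue. u x \<le> u' x"
proof (rule minimizer_le_supersolution[OF h(1) u(1)])
  show "u' \<in> W" using u by (simp add: is_minimizer_def)
  fix v assume v: "v \<in> W" "AE x in lebesgue. 0 \<le> v x"
  have "AE x in L. 0 \<le> v x" using v(2) by (auto simp: AE_L elim: eventually_mono)
  with h(3) have "AE x in L. h x * v x \<le> h' x * v x"
    by eventually_elim (auto intro: mult_right_mono)
  then show "(\<integral>x. h x * v x \<partial>L) \<le> A u' v"
    unfolding minimizer_weak[OF h(2) u(2) v(1)]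
    using rhs_mult_integrable h v by (intro integral_mono_AE) auto
qed

text \<open>Comparison in both directions identifies u almost everywhere with the bounded minimiser
  from \<open>ex_minimizer\<close>.\<close>

lemma minimizer_bounds:
  assumes h: "bounded_rhs h H" and M: "0 < M" "H \<le> c0 * M powr (p - 1)" and u: "is_minimizer h u"
  shows "AE x in lebesgue. 0 \<le> u x \<and> u x \<le> M"
proof -
  obtain w where w: "is_minimizer h w" "\<And>x. 0 \<le> w x \<and> w x \<le> M"
    using ex_minimizer[OF h M] by auto
  have "AE x in lebesgue. u x \<le> w x" "AE x in lebesgue. w x \<le> u x"
    using minimizer_mono[OF h h _ u w(1)] minimizer_mono[OF h h _ w(1) u] by auto
  then show ?thesis by eventually_elim (use w(2) order_trans in blast)
qed

lemma ex_sup_level: "\<exists>M>0. H \<le> c0 * M powr (p - 1)"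
proof (intro exI conjI)
  have pos: "0 < \<bar>H\<bar> / c0 + 1" using c0_pos by (simp add: add_nonneg_pos)
  then show "0 < (\<bar>H\<bar> / c0 + 1) powr (1 / (p - 1))" by simp
  have "((\<bar>H\<bar> / c0 + 1) powr (1 / (p - 1))) powr (p - 1) = \<bar>H\<bar> / c0 + 1"
    using p pos by (simp add: powr_powr)
  then show "H \<le> c0 * ((\<bar>H\<bar> / c0 + 1) powr (1 / (p - 1))) powr (p - 1)"
    using c0_pos by (simp add: distrib_left)
qed

text \<open>A substitute for the strong minimum principle. Lifting u to max(u, e \<phi>) gains at
  least c e times the integral of \<phi> over {u \<le> 0}, while submodularity caps the cost at e^p
  G(\<phi>) / p. Dividing by e and letting e tend to 0 makes that integral vanish, as p > 1.\<close>

lemma minimizer_positive: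
  assumes h: "bounded_rhs h H" and c: "0 < c" "AE x in L. c \<le> h x" and u: "is_minimizer h u"
    and phi: "\<phi> \<in> W" "\<And>x. 0 \<le> \<phi> x"
  shows "AE x in L. 0 < \<phi> x \<longrightarrow> 0 < u x"
proof -
  have uW: "u \<in> W" using u by (simp add: is_minimizer_def)
  have unn: "AE x in L. 0 \<le> u x"
  proof -
    obtain M where "0 < M" "H \<le> c0 * M powr (p - 1)" using ex_sup_level by blast
    from minimizer_bounds[OF h this u] show ?thesis by (auto simp: AE_L elim: eventually_mono)
  qed
  define I where "I = (\<lambda>x. \<phi> x * indicator {x. u x \<le> 0} x)"
  have Imeas: "I \<in> borel_measurable L"
    unfolding I_def using W_meas_L[OF phi(1)] W_meas_L[OF uW] by measurable
  have Iint: "integrable L I"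
    by (rule Bochner_Integration.integrable_bound[OF W_integrable[OF phi(1)] Imeas])
       (auto simp: I_def indicator_def)
  have le: "c * integral\<^sup>L L I \<le> e powr (p - 1) * (G \<phi> / p)" if e: "0 < e" for e
  proof -
    define f where "f = (\<lambda>x. e * \<phi> x)"
    have fW: "f \<in> W" unfolding f_def by (rule W_scale[OF phi(1)])
    have mW: "(\<lambda>x. min (u x) (f x)) \<in> W" "(\<lambda>x. max (u x) (f x)) \<in> W"
      using W_min W_max uW fW by auto
    have Gf: "G f = e powr p * G \<phi>"
      unfolding G_def f_def dif_def using e
      by (subst integral_mult_right_zero[symmetric])
         (auto simp: abs_mult powr_mult simp flip: right_diff_distrib)
    have "E h u \<le> E h (\<lambda>x. max (u x) (f x))" using u mW by (simp add: is_minimizer_def)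
    then have "E h (\<lambda>x. min (u x) (f x)) \<le> E h f" using E_submodular[OF h uW fW] by linarith
    then have 1: "(\<integral>x. h x * f x \<partial>L) - (\<integral>x. h x * min (u x) (f x) \<partial>L) \<le> G f / p"
      using divide_nonneg_pos[OF G_nonneg, of p "\<lambda>x. min (u x) (f x)"] p by (simp add: E_def)
    have "c * (e * integral\<^sup>L L I) = (\<integral>x. c * (e * I x) \<partial>L)" by simp
    also have "\<dots> \<le> (\<integral>x. h x * f x - h x * min (u x) (f x) \<partial>L)"
    proof (rule integral_mono_AE)
      show "AE x in L. c * (e * I x) \<le> h x * f x - h x * min (u x) (f x)"
        using unn c(2)
      proof eventually_elim
        case (elim x)
        have "c * (e * I x) \<le> h x * (e * I x)"
          using elim e phi(2)[of x] by (intro mult_right_mono) (auto simp: I_def)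
        also have "\<dots> \<le> h x * (f x - min (u x) (f x))"
          using elim e c phi(2)[of x] by (intro mult_left_mono) (auto simp: I_def f_def indicator_def min_def)
        finally show ?case by (simp add: right_diff_distrib)
      qed
    qed (use Iint rhs_mult_integrable[OF h] fW mW in auto)
    also have "\<dots> = (\<integral>x. h x * f x \<partial>L) - (\<integral>x. h x * min (u x) (f x) \<partial>L)"
      using rhs_mult_integrable[OF h] fW mW by (intro Bochner_Integration.integral_diff) auto
    finally have "c * (e * integral\<^sup>L L I) \<le> e powr p * G \<phi> / p" using 1 Gf by simp
    also have "e powr p = e * e powr (p - 1)" using powr_mult_base[of e "p - 1"] e by simp
    finally have "e * (c * integral\<^sup>L L I) \<le> e * (e powr (p - 1) * (G \<phi> / p))" by (simp add: mult_ac)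
    then show ?thesis using e by (simp only: mult_le_cancel_left_pos)
  qed
  have "(\<lambda>n. (1 / real (Suc n)) powr (p - 1) * (G \<phi> / p)) \<longlonglongrightarrow> 0 powr (p - 1) * (G \<phi> / p)"
    using p by (intro tendsto_mult tendsto_powr' tendsto_const
        LIMSEQ_inverse_real_of_nat[unfolded inverse_eq_divide]) auto
  then have "c * integral\<^sup>L L I \<le> 0 powr (p - 1) * (G \<phi> / p)"
    by (rule LIMSEQ_le_const) (use le in auto)
  then have "integral\<^sup>L L I \<le> 0" using c by (simp add: mult_le_0_iff)
  moreover have Inn: "0 \<le> I x" for x using phi(2)[of x] by (simp add: I_def)
  ultimately have "integral\<^sup>L L I = 0" by (intro antisym Bochner_Integration.integral_nonneg)
  then have "AE x in L. I x = 0" using integral_nonneg_eq_0_iff_AE[OF Iint] Inn by simp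
  then show ?thesis by eventually_elim (auto simp: I_def indicator_def split: if_splits)
qed

end

section \<open>A positive Lipschitz element of \<open>W\<^sub>0\<^sup>s\<^sup>,\<^sup>p\<close>\<close>

text \<open>Dyadic shells of radius about \<open>2\<^sup>d\<^sup>n\<close>, with \<open>d = -1\<close> near the origin and \<open>d = 1\<close> near infinity.\<close>

lemma nn_integral_shells_finite:
  fixes f :: "'a::euclidean_space \<Rightarrow> ennreal" and c d :: real
  assumes cd: "d * c < 0" and d: "\<bar>d\<bar> = 1"
    and f: "\<And>z. f z \<le> ennreal (norm z powr (c - real DIM('a)))"
    and shell: "\<And>z. f z \<noteq> 0 \<Longrightarrow> \<exists>n::nat. 2 powr (d * real n - 1) \<le> norm z \<and> norm z \<le> 2 powr (d * real n + 1)"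
  shows "(\<integral>\<^sup>+z. f z \<partial>lborel) < \<infinity>"
proof -
  let ?N = "real DIM('a)" and ?V = "unit_ball_vol (real DIM('a))"
  define r where "r n = 2 powr (d * real n)" for n :: nat
  have r: "0 < r n" for n by (simp add: r_def)
  \<comment> \<open>On a shell the ratio \<open>norm z / r n\<close> lies in [1/2, 2], so its power
    with exponent c - N is at most 2^{|c - N|}, whatever the sign of the exponent.\<close>
  define K where "K = 2 powr \<bar>c - ?N\<bar>"
  define g where "g n = ennreal (K * r n powr (c - ?N))" for n
  have fg: "f z \<le> (\<Sum>n. g n * indicator (cball 0 (2 * r n)) z)" for z
  proof (cases "f z = 0")
    case False
    then obtain n where "2 powr (d * real n - 1) \<le> norm z" "norm z \<le> 2 powr (d * real n + 1)"
      using shell by blast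
    then have n: "r n / 2 \<le> norm z" "norm z \<le> 2 * r n" by (simp_all add: r_def powr_diff powr_add mult.commute)
    define t where "t = norm z / r n"
    have t: "1 / 2 \<le> t" "t \<le> 2" "norm z = t * r n" using n r[of n] by (auto simp: t_def field_simps)
    have "t powr (c - ?N) \<le> K"
    proof (cases "0 \<le> c - ?N")
      case True
      then show ?thesis unfolding K_def using t by (simp add: powr_mono2)
    next
      case False
      then have "t powr (c - ?N) \<le> (1 / 2) powr (c - ?N)" using t by (intro powr_mono2') auto
      also have "\<dots> = K" using False by (simp add: K_def powr_divide powr_minus_divide[of 2 "c - ?N", simplified])
      finally show ?thesis .
    qed
    then have "norm z powr (c - ?N) \<le> K * r n powr (c - ?N)"
      using t r[of n] by (simp add: powr_mult mult_right_mono)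
    then have "f z \<le> g n * indicator (cball 0 (2 * r n)) z"
      using f[of z] n unfolding g_def by (auto intro: order_trans ennreal_leI)
    also have "\<dots> \<le> (\<Sum>n. g n * indicator (cball 0 (2 * r n)) z)"
    proof -
      have "t n \<le> suminf t" for t :: "nat \<Rightarrow> ennreal" using sum_le_suminf[of t "{n}"] by (simp add: summableI)
      then show ?thesis .
    qed
    finally show ?thesis .
  qed simp
  \<comment> \<open>A shell has volume of order r^N and f is of order r^{c-N} on it, so it
    contributes r^c = q^n; the condition d c < 0 says q < 1.\<close>
  define q where "q = 2 powr (d * c)"
  have q: "0 < q" "q < 1" using cd by (auto simp: q_def powr_less_one)
  have "(\<integral>\<^sup>+z. f z \<partial>lborel) \<le> (\<integral>\<^sup>+z. (\<Sum>n. g n * indicator (cball (0::'a) (2 * r n)) z) \<partial>lborel)"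
    by (intro nn_integral_mono fg)
  also have "\<dots> = (\<Sum>n. g n * emeasure lborel (cball (0::'a) (2 * r n)))"
    by (subst nn_integral_suminf)
       (auto simp: nn_integral_cmult_indicator intro!: borel_measurable_times_ennreal borel_measurable_indicator)
  also have "\<dots> = (\<Sum>n. ennreal (K * ?V * 2 ^ DIM('a) * q ^ n))"
  proof (rule suminf_cong)
    fix n
    have "r n powr (c - ?N) * r n ^ DIM('a) = r n powr c"
      using r[of n] by (simp add: powr_realpow[symmetric] flip: powr_add)
    also have "r n powr c = q powr real n" by (simp add: r_def q_def powr_powr mult_ac)
    also have "\<dots> = q ^ n" using q by (simp add: powr_realpow)
    finally have rq: "r n powr (c - ?N) * r n ^ DIM('a) = q ^ n" .
    have "g n * emeasure lborel (cball (0::'a) (2 * r n))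
        = ennreal (K * r n powr (c - ?N) * (?V * (2 * r n) ^ DIM('a)))"
      unfolding g_def using r[of n] by (subst emeasure_cball) (auto simp: K_def simp flip: ennreal_mult')
    also have "K * r n powr (c - ?N) * (?V * (2 * r n) ^ DIM('a))
        = K * ?V * 2 ^ DIM('a) * (r n powr (c - ?N) * r n ^ DIM('a))"
      by (simp add: power_mult_distrib mult_ac)
    finally show "g n * emeasure lborel (cball (0::'a) (2 * r n)) = ennreal (K * ?V * 2 ^ DIM('a) * q ^ n)"
      unfolding rq .
  qed
  also have "\<dots> < \<infinity>"
    using q by (subst suminf_ennreal2) (auto simp: K_def intro!: summable_mult summable_geometric)
  finally show ?thesis .
qed

lemma nn_integral_lborel_reflect:
  fixes F :: "'a::euclidean_space \<Rightarrow> ennreal"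
  assumes [measurable]: "F \<in> borel_measurable borel"
  shows "(\<integral>\<^sup>+y. F (x - y) \<partial>lborel) = (\<integral>\<^sup>+y. F y \<partial>lborel)"
  by (subst (2) lborel_affine[of "- 1" x]) (auto simp: nn_integral_density nn_integral_distr)

context fractional_setting
begin

text \<open>Near the diagonal the Lipschitz bound leaves |x - y|^{p(1-s)-N}, integrable at the
  origin since s < 1; away from it the bound D leaves |x - y|^{-sp-N}, integrable at infinity since
  s > 0. Only pairs with a point in the bounded set \<open>Om\<close> contribute, so integrating the
  other point first gives a finite result.\<close>

lemma W_lipschitz:
  assumes lip: "\<And>x y. \<bar>u x - u y\<bar> \<le> norm (x - y)" and zero: "\<And>x. x \<notin> Om \<Longrightarrow> u x = 0"
    and D: "0 \<le> D" "\<And>x y. \<bar>u x - u y\<bar> \<le> D"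
  shows "u \<in> W"
proof -
  let ?N = "real DIM('a)"
  have "continuous_on UNIV u"
    unfolding continuous_on_iff dist_norm real_norm_def using lip le_less_trans by blast
  then have u [measurable]: "u \<in> borel_measurable borel" by (rule borel_measurable_continuous_onI)
  define F1 F2 F :: "'a \<Rightarrow> ennreal" where
    "F1 = (\<lambda>z. ennreal (norm z powr (p * (1 - s) - ?N)) * indicator (ball 0 1) z)" and
    "F2 = (\<lambda>z. ennreal (norm z powr (- (s * p) - ?N)) * indicator (- ball 0 1) z)" and
    "F = (\<lambda>z. F1 z + ennreal (D powr p) * F2 z)"
  have Fm [measurable]: "F1 \<in> borel_measurable borel" "F2 \<in> borel_measurable borel" "F \<in> borel_measurable borel"
  proof -
    have [measurable]: "ball (0::'a) 1 \<in> sets borel" "- ball (0::'a) 1 \<in> sets borel" by auto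
    have "F1 \<in> borel_measurable borel" "F2 \<in> borel_measurable borel"
      unfolding F1_def F2_def by (intro borel_measurable_times_ennreal borel_measurable_indicator; measurable)+
    then show "F1 \<in> borel_measurable borel" "F2 \<in> borel_measurable borel" "F \<in> borel_measurable borel"
      unfolding F_def by auto
  qed
  have "(\<integral>\<^sup>+z. F1 z \<partial>lborel) < \<infinity>"
  proof (rule nn_integral_shells_finite[where d = "- 1" and c = "p * (1 - s)"])
    fix z assume "F1 z \<noteq> 0"
    then have z: "0 < norm z" "norm z < 1" by (auto simp: F1_def indicator_def split: if_splits)
    define n where "n = nat \<lfloor>- log 2 (norm z)\<rfloor>"
    have "0 < - log 2 (norm z)" using z by simp
    then have "real n \<le> - log 2 (norm z)" "- log 2 (norm z) \<le> real n + 1"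
      unfolding n_def by linarith+
    then have "- real n - 1 \<le> log 2 (norm z)" "log 2 (norm z) \<le> - real n + 1" by linarith+
    then show "\<exists>n::nat. 2 powr (- 1 * real n - 1) \<le> norm z \<and> norm z \<le> 2 powr (- 1 * real n + 1)"
      using z by (auto simp: le_log_iff log_le_iff)
  qed (use p s in \<open>auto simp: F1_def indicator_def\<close>)
  moreover have "(\<integral>\<^sup>+z. F2 z \<partial>lborel) < \<infinity>"
  proof (rule nn_integral_shells_finite[where d = 1 and c = "- (s * p)"])
    fix z assume "F2 z \<noteq> 0"
    then have z: "1 \<le> norm z" by (auto simp: F2_def indicator_def split: if_splits)
    define n where "n = nat \<lfloor>log 2 (norm z)\<rfloor>"
    have "0 \<le> log 2 (norm z)" using z by (subst zero_le_log_cancel_iff) auto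
    then have "real n \<le> log 2 (norm z)" "log 2 (norm z) \<le> real n + 1"
      unfolding n_def by linarith+
    then have "real n - 1 \<le> log 2 (norm z)" "log 2 (norm z) \<le> real n + 1" by linarith+
    moreover have "0 < norm z" using z by linarith
    ultimately show "\<exists>n::nat. 2 powr (1 * real n - 1) \<le> norm z \<and> norm z \<le> 2 powr (1 * real n + 1)"
      by (auto simp: le_log_iff log_le_iff)
  qed (use p s in \<open>auto simp: F2_def indicator_def\<close>)
  ultimately have Ffin: "(\<integral>\<^sup>+z. F z \<partial>lborel) < \<infinity>"
    unfolding F_def by (subst nn_integral_add) (auto simp: nn_integral_cmult ennreal_mult_less_top)
  have bound: "ennreal (gker z * \<bar>dif u z\<bar> powr p) \<le>
      indicator Om (fst z) * F (fst z - snd z) + indicator Om (snd z) * F (fst z - snd z)" for z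
  proof (cases "fst z \<in> Om \<or> snd z \<in> Om")
    case False
    then show ?thesis using zero by (simp add: dif_def)
  next
    case True
    let ?r = "norm (fst z - snd z)"
    have gk: "gker z = ?r powr (- (s * p) - ?N)"
      by (simp add: gker_def powr_minus_divide[symmetric] algebra_simps)
    have "ennreal (gker z * \<bar>dif u z\<bar> powr p) \<le> F (fst z - snd z)"
    proof (cases "?r < 1")
      case True
      have "\<bar>dif u z\<bar> powr p \<le> ?r powr p"
        using lip[of "fst z" "snd z"] p by (intro powr_mono2) (auto simp: dif_def)
      then have "gker z * \<bar>dif u z\<bar> powr p \<le> ?r powr (- (s * p) - ?N) * ?r powr p"
        unfolding gk by (intro mult_left_mono) auto
      also have "\<dots> = ?r powr (p * (1 - s) - ?N)"
        by (simp add: algebra_simps flip: powr_add)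
      finally show ?thesis using True by (auto simp: F_def F1_def intro: ennreal_leI add_increasing2)
    next
      case False
      have "\<bar>dif u z\<bar> powr p \<le> D powr p"
        using D(2)[of "fst z" "snd z"] p by (intro powr_mono2) (auto simp: dif_def)
      then have "gker z * \<bar>dif u z\<bar> powr p \<le> D powr p * ?r powr (- (s * p) - ?N)"
        unfolding gk by (simp add: mult.commute mult_right_mono)
      then show ?thesis using False
        by (auto simp: F_def F2_def ennreal_mult'[symmetric] intro: ennreal_leI add_increasing)
    qed
    then show ?thesis using True by (auto simp: indicator_def intro: add_increasing add_increasing2)
  qed
  have Om_fin: "emeasure lborel Om < \<infinity>" using Om emeasure_bounded_finite by blast
  have [measurable]: "(\<lambda>z. F (fst z - snd z)) \<in> borel_measurable (lborel \<Otimes>\<^sub>M lborel)" by measurable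
  have dm: "(\<lambda>z. ennreal (\<bar>dif u z\<bar> powr p)) \<in> borel_measurable lebesgue"
    by (intro measurable_compose[OF borel_measurable_dif_powr measurable_ennreal] measurable_completion) simp
  have "(\<integral>\<^sup>+z. ennreal (\<bar>dif u z\<bar> powr p) \<partial>gmeas) = (\<integral>\<^sup>+z. ennreal (gker z * \<bar>dif u z\<bar> powr p) \<partial>lebesgue)"
    unfolding gmeas_def using borel_measurable_gker dm
    by (subst nn_integral_density) (auto simp: ennreal_mult' gker_nonneg)
  also have "\<dots> = (\<integral>\<^sup>+z. ennreal (gker z * \<bar>dif u z\<bar> powr p) \<partial>(lborel \<Otimes>\<^sub>M lborel))"
    by (simp add: nn_integral_completion lborel_prod)
  also have "\<dots> \<le> (\<integral>\<^sup>+z. indicator Om (fst z) * F (fst z - snd z) + indicator Om (snd z) * F (fst z - snd z) \<partial>(lborel \<Otimes>\<^sub>M lborel))"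
    by (intro nn_integral_mono bound)
  also have "\<dots> = (\<integral>\<^sup>+z. indicator Om (fst z) * F (fst z - snd z) \<partial>(lborel \<Otimes>\<^sub>M lborel))
      + (\<integral>\<^sup>+z. indicator Om (snd z) * F (fst z - snd z) \<partial>(lborel \<Otimes>\<^sub>M lborel))"
    by (intro nn_integral_add) measurable
  also have "(\<integral>\<^sup>+z. indicator Om (fst z) * F (fst z - snd z) \<partial>(lborel \<Otimes>\<^sub>M lborel))
      = (\<integral>\<^sup>+x. indicator Om x * (\<integral>\<^sup>+y. F (x - y) \<partial>lborel) \<partial>lborel)"
    by (subst lborel.nn_integral_fst[symmetric]) (auto simp: nn_integral_cmult)
  also have "\<dots> = emeasure lborel Om * (\<integral>\<^sup>+y. F y \<partial>lborel)"
    by (simp add: nn_integral_lborel_reflect nn_integral_multc)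
  also have "(\<integral>\<^sup>+z. indicator Om (snd z) * F (fst z - snd z) \<partial>(lborel \<Otimes>\<^sub>M lborel))
      = (\<integral>\<^sup>+y. indicator Om y * (\<integral>\<^sup>+x. F (x - y) \<partial>lborel) \<partial>lborel)"
    by (subst lborel_pair.nn_integral_snd[symmetric]) (auto simp: nn_integral_cmult)
  also have "\<dots> = (\<integral>\<^sup>+y. indicator Om y * (\<integral>\<^sup>+x. F x \<partial>lborel) \<partial>lborel)"
  proof -
    have "F (- z) = F z" for z by (simp add: F_def F1_def F2_def indicator_def)
    then have sym: "F (x - y) = F (y - x)" for x y using minus_diff_eq[of y x] by metis
    have "(\<integral>\<^sup>+x. F (x - y) \<partial>lborel) = (\<integral>\<^sup>+x. F x \<partial>lborel)" for y
      by (subst sym) (rule nn_integral_lborel_reflect[OF Fm(3)])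
    then show ?thesis by simp
  qed
  also have "\<dots> = emeasure lborel Om * (\<integral>\<^sup>+y. F y \<partial>lborel)" by (simp add: nn_integral_multc)
  also have "emeasure lborel Om * (\<integral>\<^sup>+y. F y \<partial>lborel) + emeasure lborel Om * (\<integral>\<^sup>+y. F y \<partial>lborel) < \<infinity>"
    using Om_fin Ffin by (simp add: ennreal_mult_less_top)
  finally have fin: "(\<integral>\<^sup>+z. ennreal (\<bar>dif u z\<bar> powr p) \<partial>gmeas) < \<infinity>" .
  have um: "u \<in> borel_measurable lebesgue" by (rule measurable_completion) simp
  have "integrable gmeas (\<lambda>z. \<bar>dif u z\<bar> powr p)"
    by (rule integrableI_nonneg) (use fin borel_measurable_dif_powr[OF um] in \<open>auto simp: measurable_gmeas_eq\<close>)
  then show ?thesis using um zero by (simp add: W_iff)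
qed

text \<open>The distance to the complement serves twice: below it, suitably scaled, minimisers are
  compared to get positivity, and it is the numerator in Picone's test function.\<close>

definition bump :: "'a \<Rightarrow> real" where "bump x = infdist x (- Om)"

lemma bump_nonneg: "0 \<le> bump x"
  by (simp add: bump_def infdist_nonneg)

lemma Om_compl_nonempty: "- Om \<noteq> {}"
proof
  assume "- Om = {}"
  then have "Om = UNIV" by blast
  then show False using Om(2) not_bounded_UNIV by simp
qed

lemma bump_pos: "x \<in> Om \<Longrightarrow> 0 < bump x"
  unfolding bump_def using Om Om_compl_nonempty by (intro infdist_pos_not_in_closed) auto

lemma bump_zero: "x \<notin> Om \<Longrightarrow> bump x = 0"
  by (simp add: bump_def)

lemma bump_bound: "bump x \<le> 2 * rad + 2"
proof (cases "x \<in> Om")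
  case True
  have "far \<noteq> {}" by (simp add: far_def)
  then obtain y where y: "y \<in> far" by blast
  then have "bump x \<le> dist x y" unfolding bump_def using far_disjoint by (intro infdist_le) auto
  also have "\<dots> \<le> norm x + norm y" by (rule dist_triangle2[of x y 0, simplified dist_norm, simplified, folded dist_norm])
  also have "\<dots> \<le> 2 * rad + 2" using True rad(2) far_norm[OF y] by fastforce
  finally show ?thesis .
qed (use rad bump_zero in simp)

lemma bump_W: "bump \<in> W"
proof (rule W_lipschitz[where D = "2 * rad + 2"])
  show "\<bar>bump x - bump y\<bar> \<le> norm (x - y)" for x y
    using infdist_triangle_abs[of x "- Om" y] by (simp add: bump_def dist_norm)
  show "\<bar>bump x - bump y\<bar> \<le> 2 * rad + 2" for x y
    using bump_bound[of x] bump_bound[of y] bump_nonneg[of x] bump_nonneg[of y] by linarith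
qed (use rad bump_zero in auto)

lemma bump_integral_pos:
  assumes "Om \<noteq> {}"
  shows "0 < (\<integral>x. \<bar>bump x\<bar> powr p \<partial>L)"
proof -
  have "\<not> (AE x in L. \<bar>bump x\<bar> powr p = 0)"
  proof
    assume "AE x in L. \<bar>bump x\<bar> powr p = 0"
    then have "AE x in lebesgue. x \<in> Om \<longrightarrow> \<bar>bump x\<bar> powr p = 0" by (simp add: AE_L)
    then have "AE x in lebesgue. x \<notin> Om" by eventually_elim (use bump_pos in fastforce)
    then have "Om \<in> null_sets lebesgue" by (subst AE_iff_null_sets) auto
    then show False using Om assms open_not_negligible by (auto simp: negligible_iff_null_sets)
  qed
  then show ?thesis
    using integral_nonneg_eq_0_iff_AE[OF W_powr_integrable[OF bump_W]]
      Bochner_Integration.integral_nonneg[of L "\<lambda>x. \<bar>bump x\<bar> powr p"] by (auto simp: less_le)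
qed

end

section \<open>Monotone iteration\<close>

locale fractional_problem = fractional_setting p s Om
  for p s :: real and Om :: "'a::euclidean_space set" +
  fixes f :: "real \<Rightarrow> real"
  assumes Om_nonempty: "Om \<noteq> {}"
    and f_C1: "f C1_differentiable_on UNIV" and f_mono: "mono f" and f0: "0 < f 0"
    and f_superlinear: "filterlim (\<lambda>t. f t / t powr (p - 1)) at_top at_top"
begin

lemma f_deriv: "(f has_real_derivative deriv f t) (at t)"
proof -
  obtain D where "(f has_vector_derivative D) (at t)"
    using f_C1 by (auto simp: C1_differentiable_on_def)
  then have "(f has_real_derivative D) (at t)" by (simp add: has_real_derivative_iff_has_vector_derivative)
  then show ?thesis using DERIV_imp_deriv by metis
qed

lemma f_isCont: "isCont f t"
  using f_deriv DERIV_isCont by blast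

lemma f_meas [measurable]: "f \<in> borel_measurable borel"
  using f_isCont by (intro borel_measurable_continuous_onI) (simp add: continuous_on_eq_continuous_at)

lemma deriv_f_meas [measurable]: "deriv f \<in> borel_measurable borel"
proof -
  obtain D where D: "\<And>t. (f has_vector_derivative D t) (at t)" "continuous_on UNIV D"
    using f_C1 by (auto simp: C1_differentiable_on_def)
  then have "deriv f = D"
    by (metis DERIV_imp_deriv ext has_real_derivative_iff_has_vector_derivative)
  then show ?thesis using D(2) borel_measurable_continuous_onI by simp
qed

lemma f_pos: "0 \<le> t \<Longrightarrow> f 0 \<le> f t" "0 \<le> t \<Longrightarrow> 0 < f t"
  using monoD[OF f_mono, of 0 t] f0 by auto

text \<open>Superlinear growth covers large t, where 1 + t \<le> 2 t explains the factor 2^{p-1}; on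
  the remaining bounded range f \<ge> f(0) > 0 is enough. The form 1 + t matches the denominator 1 +
  w of Picone's test function, which stays away from 0.\<close>

lemma f_lower_bound: "\<exists>c>0. \<forall>t\<ge>0. c * (1 + t) powr (p - 1) \<le> f t"
proof -
  have "eventually (\<lambda>t. 1 \<le> f t / t powr (p - 1)) at_top"
    using f_superlinear by (simp add: filterlim_at_top)
  then obtain T0 where T0: "\<And>t. T0 \<le> t \<Longrightarrow> 1 \<le> f t / t powr (p - 1)"
    by (auto simp: eventually_at_top_linorder)
  define T where "T = max T0 1"
  define c where "c = min (1 / 2 powr (p - 1)) (f 0 / (1 + T) powr (p - 1))"
  have T: "1 \<le> T" by (simp add: T_def)
  have "0 < c" unfolding c_def using f0 T by simp
  moreover have "c * (1 + t) powr (p - 1) \<le> f t" if t: "0 \<le> t" for t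
  proof (cases "T \<le> t")
    case True
    then have t1: "1 \<le> t" "T0 \<le> t" using T by (auto simp: T_def)
    have "c * (1 + t) powr (p - 1) \<le> 1 / 2 powr (p - 1) * (2 * t) powr (p - 1)"
      unfolding c_def using t1 p by (intro mult_mono powr_mono2) auto
    also have "\<dots> = t powr (p - 1)" using t1 by (simp add: powr_mult)
    also have "\<dots> \<le> f t" using T0[OF t1(2)] t1 by (simp add: field_simps)
    finally show ?thesis .
  next
    case False
    have "c * (1 + t) powr (p - 1) \<le> f 0 / (1 + T) powr (p - 1) * (1 + T) powr (p - 1)"
      unfolding c_def using t False T p f0 by (intro mult_mono powr_mono2) auto
    also have "\<dots> = f 0" using T by simp
    finally show ?thesis using f_pos(1)[OF t] by simp
  qed
  ultimately show ?thesis by blast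
qed

section \<open>Arbitrary solutions and Picone's bound on the parameter\<close>

lemma solution_W: "solution_P s p Om f lam w \<Longrightarrow> w \<in> W"
  and solution_pos: "solution_P s p Om f lam w \<Longrightarrow> AE x in L. 0 < w x"
  by (auto simp: solution_P_def weak_solution_def AE_L)

lemma solution_nonneg:
  assumes "solution_P s p Om f lam w"
  shows "AE x in lebesgue. 0 \<le> w x"
  using solution_pos[OF assms, unfolded AE_L] W_zero_outside[OF solution_W[OF assms]]
  by eventually_elim (metis order.refl less_imp_le)

lemma solution_weak:
  assumes w: "solution_P s p Om f lam w" and v: "v \<in> W" "AE x in lebesgue. 0 \<le> v x"
  shows "integrable L (\<lambda>x. lam * f (w x) * v x)" "A w v = (\<integral>x. lam * f (w x) * v x \<partial>L)"
  using w v frac_p_laplacian_eq[OF solution_W[OF w] v(1)]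
  by (auto simp: solution_P_def weak_solution_def in_dual_Wsp0_def integrable_L integral_L)

text \<open>
  The test function is \<open>bump\<^sup>p / (1 + w)\<^sup>p\<^sup>-\<^sup>1\<close>; the truncations in \<open>q\<close> only serve to make it a globally
  Lipschitz function of \<open>bump\<close> and \<open>w\<close>, hence admissible.
\<close>

lemma solution_lambda_bound:
  assumes c: "0 < c" "\<And>t. 0 \<le> t \<Longrightarrow> c * (1 + t) powr (p - 1) \<le> f t"
    and w: "solution_P s p Om f lam w" and lam: "0 < lam"
  shows "lam * c * (\<integral>x. \<bar>bump x\<bar> powr p \<partial>L) \<le> G bump"
proof -
  define R where "R = 2 * rad + 2"
  define q where "q = (\<lambda>b a. (min (max b 0) R) powr p / (1 + max a 0) powr (p - 1))"
  define v where "v = (\<lambda>x. q (bump x) (w x))"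
  have R: "0 \<le> R" using rad by (simp add: R_def)
  have wW: "w \<in> W" using solution_W[OF w] .
  have vW: "v \<in> W" unfolding v_def
  proof (rule W_combine[where f = q and C = "p * R powr (p - 1) + (p - 1) * R powr p", OF bump_W wW])
    show "case_prod q \<in> borel_measurable (borel \<Otimes>\<^sub>M borel)" unfolding q_def by measurable
    show "q 0 0 = 0" using R p by (simp add: q_def)
    show "0 \<le> p * R powr (p - 1) + (p - 1) * R powr p" using p by simp
    fix b a b' a' :: real
    have "\<bar>q b a - q b' a'\<bar> \<le> (p * R powr (p - 1) + (p - 1) * R powr p) *
        (\<bar>min (max b 0) R - min (max b' 0) R\<bar> + \<bar>(1 + max a 0) - (1 + max a' 0)\<bar>)"
      unfolding q_def using R by (intro picone_quotient_lipschitz p) auto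
    also have "\<dots> \<le> (p * R powr (p - 1) + (p - 1) * R powr p) * (\<bar>b - b'\<bar> + \<bar>a - a'\<bar>)"
      using p by (intro mult_left_mono add_mono) auto
    finally show "\<bar>q b a - q b' a'\<bar> \<le> (p * R powr (p - 1) + (p - 1) * R powr p) * (\<bar>b - b'\<bar> + \<bar>a - a'\<bar>)" .
  qed
  have v_eq: "v x = bump x powr p / (1 + w x) powr (p - 1)" if "0 \<le> w x" for x
    using that bump_bound[of x] bump_nonneg[of x] by (simp add: v_def q_def R_def)
  have vnn: "0 \<le> v x" for x by (simp add: v_def q_def)
  have Aeq: "A w v = (\<integral>x. lam * f (w x) * v x \<partial>L)" and int: "integrable L (\<lambda>x. lam * f (w x) * v x)"
    using solution_weak[OF w vW] vnn by auto
  \<comment> \<open>Picone's inequality is applied to 1 + w, whose differences are those of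
    w.\<close>
  have "A w v \<le> G bump"
    unfolding A_def G_def
  proof (rule integral_mono_AE)
    show "AE z in gmeas. jp p (dif w z) * dif v z \<le> \<bar>dif bump z\<bar> powr p"
      using AE_gmeas_fst[OF solution_nonneg[OF w]] AE_gmeas_snd[OF solution_nonneg[OF w]]
    proof eventually_elim
      case (elim z)
      then show ?case
        using discrete_picone[OF p, of "1 + w (fst z)" "1 + w (snd z)" "bump (fst z)" "bump (snd z)"] bump_nonneg
        by (simp add: dif_def v_eq)
    qed
  qed (use A_integrable[OF wW vW] W_integrable_dif[OF bump_W] in auto)
  \<comment> \<open>The lower bound on f cancels the denominator of v.\<close>
  moreover have "(\<integral>x. lam * c * \<bar>bump x\<bar> powr p \<partial>L) \<le> (\<integral>x. lam * f (w x) * v x \<partial>L)"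
  proof (rule integral_mono_AE)
    show "AE x in L. lam * c * \<bar>bump x\<bar> powr p \<le> lam * f (w x) * v x"
      using solution_pos[OF w]
    proof eventually_elim
      case (elim x)
      have "c * bump x powr p = c * (1 + w x) powr (p - 1) * v x" using elim by (simp add: v_eq)
      also have "\<dots> \<le> f (w x) * v x" using c(2)[of "w x"] elim vnn by (intro mult_right_mono) auto
      finally show ?case using lam bump_nonneg[of x] by (simp add: mult.assoc)
    qed
  qed (use int W_powr_integrable[OF bump_W] in auto)
  ultimately show ?thesis using Aeq by simp
qed

text \<open>The choice demands a representative bounded at every point: then the next right-hand
  side is bounded as well, and the recursion never runs out of minimisers.\<close>

primrec it :: "real \<Rightarrow> nat \<Rightarrow> 'a \<Rightarrow> real" where
  "it lam 0 = (\<lambda>x. 0)"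
| "it lam (Suc n) = (SOME u. is_minimizer (\<lambda>x. lam * f (it lam n x)) u \<and> (\<exists>M. \<forall>x. 0 \<le> u x \<and> u x \<le> M))"

definition rhs :: "real \<Rightarrow> ('a \<Rightarrow> real) \<Rightarrow> 'a \<Rightarrow> real" where
  "rhs lam u x = lam * f (u x)"

lemma bounded_rhs_rhs:
  assumes "0 < lam" "u \<in> borel_measurable lebesgue" "AE x in L. 0 \<le> u x \<and> u x \<le> M"
  shows "bounded_rhs (rhs lam u) (lam * f M)"
proof -
  have "AE x in L. 0 \<le> lam * f (u x) \<and> lam * f (u x) \<le> lam * f M"
    using assms(3) by eventually_elim (use assms(1) f_pos(2) monoD[OF f_mono] in \<open>auto simp: less_imp_le\<close>)
  moreover have "(\<lambda>x. lam * f (u x)) \<in> borel_measurable lebesgue" using assms(2) by measurable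
  ultimately show ?thesis by (simp add: bounded_rhs_def rhs_def[abs_def])
qed

lemma it_Suc:
  assumes "0 < lam" "it lam n \<in> W" "\<And>x. 0 \<le> it lam n x \<and> it lam n x \<le> M"
  shows "is_minimizer (rhs lam (it lam n)) (it lam (Suc n)) \<and> (\<exists>M. \<forall>x. 0 \<le> it lam (Suc n) x \<and> it lam (Suc n) x \<le> M)"
proof -
  have "bounded_rhs (rhs lam (it lam n)) (lam * f M)"
    using assms by (intro bounded_rhs_rhs W_meas) auto
  moreover obtain M' where "0 < M'" "lam * f M \<le> c0 * M' powr (p - 1)" using ex_sup_level by blast
  ultimately have "\<exists>u. is_minimizer (rhs lam (it lam n)) u \<and> (\<exists>M. \<forall>x. 0 \<le> u x \<and> u x \<le> M)"
    using ex_minimizer by blast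
  from someI_ex[OF this] show ?thesis by (simp add: rhs_def[abs_def])
qed

lemma it_W_bounded:
  assumes "0 < lam"
  shows "it lam n \<in> W \<and> (\<exists>M. \<forall>x. 0 \<le> it lam n x \<and> it lam n x \<le> M)"
proof (induction n)
  case 0
  then show ?case using W_zero by auto
next
  case (Suc n)
  then obtain M where "it lam n \<in> W" "\<And>x. 0 \<le> it lam n x \<and> it lam n x \<le> M" by blast
  from it_Suc[OF assms this] show ?case by (simp add: is_minimizer_def del: it.simps)
qed

lemma it_W: "0 < lam \<Longrightarrow> it lam n \<in> W"
  and it_nonneg: "0 < lam \<Longrightarrow> 0 \<le> it lam n x"
  and it_minimizer: "0 < lam \<Longrightarrow> is_minimizer (rhs lam (it lam n)) (it lam (Suc n))"
  using it_W_bounded[of lam n] it_Suc[of lam n] by blast+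

lemma it_rhs:
  assumes "0 < lam"
  shows "\<exists>H. bounded_rhs (rhs lam (it lam n)) H"
proof -
  obtain M where "\<And>x. 0 \<le> it lam n x \<and> it lam n x \<le> M" using it_W_bounded[OF assms] by blast
  then have "bounded_rhs (rhs lam (it lam n)) (lam * f M)"
    using assms it_W by (intro bounded_rhs_rhs W_meas) auto
  then show ?thesis ..
qed

lemma it_mono:
  assumes lam: "0 < lam"
  shows "AE x in lebesgue. it lam n x \<le> it lam (Suc n) x"
proof (induction n)
  case 0
  then show ?case using it_nonneg[OF lam, of "Suc 0"] by (simp del: it.simps(2))
next
  case (Suc n)
  obtain H H' where H: "bounded_rhs (rhs lam (it lam n)) H" "bounded_rhs (rhs lam (it lam (Suc n))) H'"
    using it_rhs[OF lam] by meson
  have "AE x in L. it lam n x \<le> it lam (Suc n) x"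
    unfolding AE_L using Suc by eventually_elim simp
  then have "AE x in L. rhs lam (it lam n) x \<le> rhs lam (it lam (Suc n)) x"
    by eventually_elim (use lam monoD[OF f_mono] in \<open>auto simp: rhs_def simp del: it.simps\<close>)
  from minimizer_mono[OF H this it_minimizer[OF lam] it_minimizer[OF lam]] show ?case .
qed

text \<open>Monotonicity of f makes w a supersolution of every step of the iteration. Since w may be
  unbounded and may belong to a larger parameter, the same induction gives minimality among all
  solutions and monotonicity in the parameter.\<close>

lemma it_le_solution:
  assumes lam: "0 < lam" "lam \<le> mu" and w: "solution_P s p Om f mu w"
  shows "AE x in lebesgue. it lam n x \<le> w x"
proof (induction n)
  case 0
  then show ?case using solution_nonneg[OF w] by simp
next
  case (Suc n)
  obtain H where H: "bounded_rhs (rhs lam (it lam n)) H" using it_rhs[OF lam(1)] by blast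
  show ?case
  proof (rule minimizer_le_supersolution[OF H it_minimizer[OF lam(1)] solution_W[OF w]])
    fix v assume v: "v \<in> W" "AE x in lebesgue. 0 \<le> v x"
    have "AE x in lebesgue. x \<in> Om \<longrightarrow> rhs lam (it lam n) x * v x \<le> mu * f (w x) * v x"
      using Suc v(2) solution_nonneg[OF w]
    proof eventually_elim
      case (elim x)
      have "f (it lam n x) \<le> f (w x)" using elim monoD[OF f_mono] by blast
      then have "lam * f (it lam n x) \<le> mu * f (w x)"
        using lam f_pos(2)[of "w x"] f_pos(2)[OF it_nonneg[OF lam(1)]] elim by (intro mult_mono) (auto simp: less_imp_le)
      then show ?case using elim by (auto simp: rhs_def intro: mult_right_mono)
    qed
    then show "(\<integral>x. rhs lam (it lam n) x * v x \<partial>L) \<le> A w v"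
      unfolding solution_weak(2)[OF w v]
      using rhs_mult_integrable[OF H v(1)] solution_weak(1)[OF w v] by (intro integral_mono_AE) (auto simp: AE_L)
  qed
qed

text \<open>The level 1 reproduces itself: below it the right-hand side is at most lam f(1) \<le>
  c0, which is the condition of \<open>minimizer_bounds\<close> with M = 1.\<close>

lemma it_le_one:
  assumes lam: "0 < lam" "lam * f 1 \<le> c0"
  shows "AE x in lebesgue. it lam n x \<le> 1"
proof (induction n)
  case (Suc n)
  have "AE x in L. 0 \<le> it lam n x \<and> it lam n x \<le> 1"
    unfolding AE_L using Suc by eventually_elim (use it_nonneg[OF lam(1)] in auto)
  then have "bounded_rhs (rhs lam (it lam n)) (lam * f 1)"
    using lam by (intro bounded_rhs_rhs W_meas it_W)
  from minimizer_bounds[OF this _ _ it_minimizer[OF lam(1)], of 1]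
  have "AE x in lebesgue. 0 \<le> it lam (Suc n) x \<and> it lam (Suc n) x \<le> 1" using lam by simp
  then show ?case by eventually_elim simp
qed simp

section \<open>The limit of a bounded iteration\<close>

definition ulim :: "real \<Rightarrow> 'a \<Rightarrow> real" where
  "ulim lam x = lim (\<lambda>n. it lam n x)"

context
  fixes lam M :: real
  assumes lam: "0 < lam" and it_bound: "\<And>n. AE x in lebesgue. it lam n x \<le> M"
begin

lemma AE_it_incseq: "AE x in lebesgue. incseq (\<lambda>n. it lam n x) \<and> (\<lambda>n. it lam n x) \<longlonglongrightarrow> ulim lam x
    \<and> (\<forall>n. it lam n x \<le> ulim lam x) \<and> ulim lam x \<le> M"
proof -
  have "AE x in lebesgue. \<forall>n. it lam n x \<le> it lam (Suc n) x" "AE x in lebesgue. \<forall>n. it lam n x \<le> M"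
    unfolding AE_all_countable using it_mono[OF lam] it_bound by auto
  then show ?thesis
  proof eventually_elim
    case (elim x)
    then have inc: "incseq (\<lambda>n. it lam n x)" by (intro incseq_SucI) blast
    have "convergent (\<lambda>n. it lam n x)"
      by (rule Bseq_monoseq_convergent)
         (use it_nonneg[OF lam] elim inc in \<open>auto intro!: BseqI'[of _ M] incseq_imp_monoseq simp del: it.simps\<close>)
    then have lim: "(\<lambda>n. it lam n x) \<longlonglongrightarrow> ulim lam x" by (simp add: ulim_def convergent_LIMSEQ_iff)
    then show ?case using inc elim incseq_le[OF inc lim] by (auto intro: LIMSEQ_le_const2)
  qed
qed

lemma ulim_meas: "ulim lam \<in> borel_measurable lebesgue"
  unfolding ulim_def by (intro borel_measurable_lim_metric W_meas it_W lam)

lemma ulim_bounds: "AE x in lebesgue. 0 \<le> ulim lam x \<and> ulim lam x \<le> M"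
  using AE_it_incseq by eventually_elim (use it_nonneg[OF lam] order_trans in blast)

lemma ulim_rhs: "bounded_rhs (rhs lam (ulim lam)) (lam * f M)"
  using ulim_bounds lam ulim_meas by (intro bounded_rhs_rhs) (auto simp: AE_L elim: eventually_mono)

lemma it_rhs_uniform: "bounded_rhs (rhs lam (it lam n)) (lam * f M)"
  using it_bound[of n] it_nonneg[OF lam] lam it_W[OF lam]
  by (intro bounded_rhs_rhs W_meas) (auto simp: AE_L elim: eventually_mono)

text \<open>Passes to the limit in the minimality of each iterate, on the left by
  \<open>E_lsc\<close> and on the right by dominated convergence. The limit minimises the convex
  functional whose right-hand side is frozen at the limit itself, which is how it solves the
  nonlinear problem.\<close>

lemma ulim_minimizer: "is_minimizer (rhs lam (ulim lam)) (ulim lam)"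
proof -
  have lim: "AE x in lebesgue. (\<lambda>n. it lam (Suc n) x) \<longlonglongrightarrow> ulim lam x"
    using AE_it_incseq by eventually_elim (auto intro: LIMSEQ_Suc simp del: it.simps)
  have rlim: "AE x in L. (\<lambda>n. rhs lam (it lam n) x) \<longlonglongrightarrow> rhs lam (ulim lam) x"
    unfolding AE_L rhs_def using AE_it_incseq
    by eventually_elim (auto intro!: tendsto_intros isCont_tendsto_compose[OF f_isCont])
  have b: "AE x in L. \<bar>it lam (Suc n) x\<bar> \<le> M" for n
    unfolding AE_L using it_bound[of "Suc n"] by eventually_elim (use it_nonneg[OF lam, of "Suc n"] in auto)
  have *: "ulim lam \<in> W \<and> E (rhs lam (ulim lam)) (ulim lam) \<le> E (rhs lam (ulim lam)) v" if v: "v \<in> W" for v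
  proof -
    have "(\<lambda>n. \<integral>x. rhs lam (it lam n) x * v x \<partial>L) \<longlonglongrightarrow> (\<integral>x. rhs lam (ulim lam) x * v x \<partial>L)"
    proof (rule integral_dominated_convergence)
      show "integrable L (\<lambda>x. lam * f M * \<bar>v x\<bar>)" using W_integrable[OF v] by simp
      show "(\<lambda>x. rhs lam (ulim lam) x * v x) \<in> borel_measurable L"
        using rhs_mult_integrable[OF ulim_rhs v] by simp
      show "(\<lambda>x. rhs lam (it lam n) x * v x) \<in> borel_measurable L" for n
        using rhs_mult_integrable[OF it_rhs_uniform v] by simp
      show "AE x in L. (\<lambda>n. rhs lam (it lam n) x * v x) \<longlonglongrightarrow> rhs lam (ulim lam) x * v x"
        using rlim by eventually_elim (auto intro: tendsto_intros)
      show "AE x in L. norm (rhs lam (it lam n) x * v x) \<le> lam * f M * \<bar>v x\<bar>" for n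
        using bounded_rhs_abs[OF it_rhs_uniform[of n]]
        by eventually_elim (auto simp: abs_mult intro: mult_right_mono)
    qed
    then have elim: "(\<lambda>n. E (rhs lam (it lam n)) v) \<longlonglongrightarrow> E (rhs lam (ulim lam)) v"
      unfolding E_def by (intro tendsto_intros)
    have le: "E (rhs lam (it lam n)) (it lam (Suc n)) \<le> E (rhs lam (it lam n)) v" for n
      using it_minimizer[OF lam, of n] v by (auto simp: is_minimizer_def simp del: it.simps)
    show ?thesis
      using E_lsc[of "\<lambda>n. it lam (Suc n)" M, OF it_W[OF lam] b ulim_meas lim it_rhs_uniform
          bounded_rhs_meas[OF ulim_rhs] rlim le elim] by blast
  qed
  then show ?thesis using W_zero by (auto simp: is_minimizer_def)
qed

lemma ulim_W: "ulim lam \<in> W"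
  using ulim_minimizer by (simp add: is_minimizer_def)

lemma ulim_pos: "AE x in L. 0 < ulim lam x"
proof -
  have "AE x in L. lam * f 0 \<le> rhs lam (ulim lam) x"
    unfolding AE_L rhs_def using ulim_bounds
    by eventually_elim (use lam f_pos(1) in auto)
  then have "AE x in L. 0 < bump x \<longrightarrow> 0 < ulim lam x"
    using lam f0 by (intro minimizer_positive[OF ulim_rhs _ _ ulim_minimizer bump_W bump_nonneg, of "lam * f 0"]) auto
  then show ?thesis unfolding AE_L by eventually_elim (use bump_pos in auto)
qed

lemma ulim_solution: "solution_P s p Om f lam (ulim lam)"
proof -
  have "in_dual_Wsp0 s p Om (\<lambda>x. lam * f (ulim lam x))"
    using in_dual_bounded[OF bounded_rhs_meas[OF ulim_rhs] bounded_rhs_abs[OF ulim_rhs]]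
    by (simp add: rhs_def[abs_def])
  moreover have "frac_p_laplacian s p (ulim lam) v = (LINT x:Om|lebesgue. lam * f (ulim lam x) * v x)" if "v \<in> W" for v
    using minimizer_weak[OF ulim_rhs ulim_minimizer that] frac_p_laplacian_eq[OF ulim_W that]
    by (simp add: rhs_def integral_L)
  ultimately show ?thesis
    using ulim_W ulim_pos by (simp add: solution_P_def weak_solution_def AE_L)
qed

lemma ulim_bounded: "essentially_bounded_on Om (ulim lam)"
  unfolding essentially_bounded_on_def
  by (rule exI[of _ M]) (use ulim_bounds in \<open>eventually_elim, auto\<close>)

lemma ulim_le_solution:
  assumes "lam \<le> mu" "solution_P s p Om f mu w"
  shows "AE x in lebesgue. ulim lam x \<le> w x"
proof -
  have "AE x in lebesgue. \<forall>n. it lam n x \<le> w x"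
    unfolding AE_all_countable using it_le_solution[OF lam assms] by blast
  with AE_it_incseq show ?thesis by eventually_elim (auto intro: LIMSEQ_le_const2)
qed

lemma ulim_minimal: "minimal_solution_P s p Om f lam (ulim lam)"
  unfolding minimal_solution_P_def
proof (intro conjI allI impI ulim_solution)
  fix v assume "solution_P s p Om f lam v"
  from ulim_le_solution[OF order.refl this] show "AE x in lebesgue. x \<in> Om \<longrightarrow> ulim lam x \<le> v x"
    by eventually_elim simp
qed

end

end

section \<open>Stability\<close>

context fractional_problem
begin

text \<open>A primitive of f with f continued below 0 by the constant f(0): competitors u - t \<phi>
  may be negative, and this extension keeps the primitive convex and increasing. Its additive
  constant is left open, hence the terms \<open>Fprim 0\<close> below.\<close>

definition Fprim :: "real \<Rightarrow> real" where
  "Fprim = (SOME F. \<forall>t. (F has_real_derivative f (max t 0)) (at t))"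

lemma Fprim_deriv: "(Fprim has_real_derivative f (max t 0)) (at t)"
proof -
  have "isCont (\<lambda>t. f (max t 0)) t" for t
    by (intro isCont_o2[OF _ f_isCont] continuous_intros)
  then have "\<exists>F. \<forall>t. - \<infinity> < ereal t \<longrightarrow> ereal t < \<infinity> \<longrightarrow> (F has_vector_derivative f (max t 0)) (at t)"
    by (intro einterval_antiderivative) auto
  then have "\<exists>F. \<forall>t. (F has_real_derivative f (max t 0)) (at t)"
    by (simp add: has_real_derivative_iff_has_vector_derivative)
  from someI_ex[OF this] show ?thesis by (simp add: Fprim_def)
qed

lemma Fprim_cont: "continuous_on UNIV Fprim"
  using Fprim_deriv DERIV_isCont by (blast intro: continuous_at_imp_continuous_on)

lemma Fprim_meas [measurable]: "Fprim \<in> borel_measurable borel"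
  using Fprim_cont by (rule borel_measurable_continuous_onI)

lemma Fprim_tangent: "f (max r 0) * (t - r) \<le> Fprim t - Fprim r"
proof -
  consider "r < t" | "t < r" | "r = t" by linarith
  then show ?thesis
  proof cases
    case 1
    then obtain z where z: "r < z" "z < t" "Fprim t - Fprim r = (t - r) * f (max z 0)"
      using MVT2[of r t Fprim "\<lambda>z. f (max z 0)"] Fprim_deriv by blast
    then have "f (max r 0) \<le> f (max z 0)" by (intro monoD[OF f_mono]) auto
    then show ?thesis using z by (simp add: mult.commute)
  next
    case 2
    then obtain z where z: "t < z" "z < r" "Fprim r - Fprim t = (r - t) * f (max z 0)"
      using MVT2[of t r Fprim "\<lambda>z. f (max z 0)"] Fprim_deriv by blast
    then have "f (max z 0) \<le> f (max r 0)" by (intro monoD[OF f_mono]) auto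
    then have "(r - t) * f (max z 0) \<le> (r - t) * f (max r 0)" using 2 by simp
    then show ?thesis using z by (simp add: algebra_simps)
  qed simp
qed

lemma Fprim_mono:
  assumes "r \<le> t"
  shows "Fprim r \<le> Fprim t"
proof -
  have "0 \<le> f (max r 0) * (t - r)" using assms f_pos(2)[of "max r 0"] by (simp add: less_imp_le)
  then show ?thesis using Fprim_tangent[of r t] by linarith
qed

text \<open>The slope is constant below 0 and at most f(M) up to M, so growth is linear. Competitors
  need only be bounded above for their energy to be finite.\<close>

lemma Fprim_bound:
  assumes "0 \<le> M" "t \<le> M"
  shows "\<bar>Fprim t\<bar> \<le> \<bar>Fprim 0\<bar> + f M * \<bar>t\<bar>"
proof -
  have m: "f (max t 0) \<le> f M" using assms by (intro monoD[OF f_mono]) auto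
  have "\<bar>Fprim t - Fprim 0\<bar> \<le> f M * \<bar>t\<bar>"
  proof (cases "0 \<le> t")
    case True
    have "Fprim t - Fprim 0 \<le> f (max t 0) * t" using Fprim_tangent[of t 0] by (simp add: algebra_simps)
    also have "\<dots> \<le> f M * t" using m True by (rule mult_right_mono)
    finally show ?thesis using Fprim_mono[OF True] True by simp
  next
    case False
    have "Fprim 0 - Fprim t \<le> f 0 * (- t)" using Fprim_tangent[of 0 t] by simp
    also have "\<dots> \<le> f M * (- t)" using False monoD[OF f_mono assms(1)] by (intro mult_right_mono) auto
    finally show ?thesis using Fprim_mono[of t 0] False by simp
  qed
  then show ?thesis by linarith
qed

lemma Fprim_integrable:
  assumes v: "v \<in> W" and M: "0 \<le> M" "AE x in L. v x \<le> M"
  shows "integrable L (\<lambda>x. Fprim (v x))"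
proof (rule Bochner_Integration.integrable_bound)
  show "integrable L (\<lambda>x. \<bar>Fprim 0\<bar> + f M * \<bar>v x\<bar>)" using W_integrable[OF v] by simp
  show "(\<lambda>x. Fprim (v x)) \<in> borel_measurable L" using W_meas_L[OF v] by measurable
  show "AE x in L. norm (Fprim (v x)) \<le> norm (\<bar>Fprim 0\<bar> + f M * \<bar>v x\<bar>)"
    using M(2)
  proof eventually_elim
    case (elim x)
    then show ?case using Fprim_bound[OF M(1) elim] f_pos(2)[OF M(1)] by simp
  qed
qed

section \<open>The full energy along the iteration\<close>

definition energy :: "real \<Rightarrow> ('a \<Rightarrow> real) \<Rightarrow> real" where
  "energy lam v = G v / p - lam * (\<integral>x. Fprim (v x) \<partial>L)"

context
  fixes lam M :: real
  assumes lam: "0 < lam" and it_bound: "\<And>n. AE x in lebesgue. it lam n x \<le> M" and M: "0 \<le> M"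
begin

text \<open>Let a be the next iterate and d = (a - v)^+. Submodularity moves the change of
  \<open>G\<close> from v to a, where the tangent and the equation for a bound it by p times the
  integral of lam f(u_n) d. As u_n \<le> v, this is at most lam f(v^+) d, and convexity of the
  primitive bounds that by lam (F(max(v, a)) - F(v)).\<close>

lemma energy_step:
  assumes v: "v \<in> W" "AE x in lebesgue. it lam n x \<le> v x" "AE x in lebesgue. v x \<le> M"
  shows "energy lam (\<lambda>x. max (v x) (it lam (Suc n) x)) \<le> energy lam v"
proof -
  define a where "a = it lam (Suc n)"
  define h where "h = rhs lam (it lam n)"
  define w where "w = (\<lambda>x. max (v x) (a x))"
  define m where "m = (\<lambda>x. min (v x) (a x))"
  define d where "d = (\<lambda>x. w x - v x)"
  have aW: "a \<in> W" unfolding a_def by (rule it_W[OF lam])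
  have W: "w \<in> W" "m \<in> W" unfolding w_def m_def using W_max W_min v aW by auto
  then have dW: "d \<in> W" unfolding d_def using W_diff v by auto
  have h: "bounded_rhs h (lam * f M)"
    unfolding h_def using it_rhs_uniform[OF lam it_bound] .
  have mina: "is_minimizer h a" unfolding h_def a_def by (rule it_minimizer[OF lam])
  have "(\<lambda>x. m x - a x) = (\<lambda>x. (- 1) * d x)" by (auto simp: m_def d_def w_def)
  then have "G a - p * A a d \<le> G m"
    using G_tangent[OF aW W(2)] A_scale_right[of a "- 1" d] by simp
  moreover have "G w + G m \<le> G v + G a" unfolding w_def m_def by (rule G_submodular[OF v(1) aW])
  ultimately have "(G w - G v) / p \<le> A a d" using p by (simp add: field_simps)
  also have "A a d = (\<integral>x. h x * d x \<partial>L)" by (rule minimizer_weak[OF h mina dW])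
  also have "\<dots> \<le> (\<integral>x. lam * (Fprim (w x) - Fprim (v x)) \<partial>L)"
  proof (rule integral_mono_AE)
    show "integrable L (\<lambda>x. h x * d x)" by (rule rhs_mult_integrable[OF h dW])
    have "AE x in L. v x \<le> M" "AE x in L. w x \<le> M"
      using v(3) it_bound[of "Suc n"] unfolding AE_L w_def a_def
      by (eventually_elim, simp del: it.simps)+
    then show "integrable L (\<lambda>x. lam * (Fprim (w x) - Fprim (v x)))"
      using Fprim_integrable[OF v(1) M] Fprim_integrable[OF W(1) M] by auto
    show "AE x in L. h x * d x \<le> lam * (Fprim (w x) - Fprim (v x))"
      unfolding AE_L using v(2)
    proof (eventually_elim, intro impI)
      fix x assume le: "it lam n x \<le> v x"
      have d0: "0 \<le> d x" by (simp add: d_def w_def)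
      have "f (it lam n x) * d x \<le> f (max (v x) 0) * d x"
        using le d0 by (intro mult_right_mono monoD[OF f_mono]) auto
      also have "\<dots> \<le> Fprim (w x) - Fprim (v x)" using Fprim_tangent[of "v x" "w x"] by (simp add: d_def)
      finally show "h x * d x \<le> lam * (Fprim (w x) - Fprim (v x))"
        using lam by (simp add: h_def rhs_def mult.assoc)
    qed
  qed
  also have "\<dots> = lam * (\<integral>x. Fprim (w x) \<partial>L) - lam * (\<integral>x. Fprim (v x) \<partial>L)"
  proof -
    have "AE x in L. v x \<le> M" "AE x in L. w x \<le> M"
      using v(3) it_bound[of "Suc n"] unfolding AE_L w_def a_def
      by (eventually_elim, simp del: it.simps)+
    then show ?thesis
      using Fprim_integrable[OF v(1) M] Fprim_integrable[OF W(1) M] by (simp add: right_diff_distrib)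
  qed
  finally show ?thesis
    unfolding energy_def a_def[symmetric] w_def[symmetric] by (simp add: diff_divide_distrib)
qed

text \<open>
  Pushing a competitor upwards through the iteration only lowers its energy, so the limit minimises
  the (nonconvex) energy among all functions below it.
\<close>

lemma ulim_energy_minimal:
  assumes v: "v \<in> W" "AE x in lebesgue. v x \<le> ulim lam x"
  shows "energy lam (ulim lam) \<le> energy lam v"
proof -
  note AE_it = AE_it_incseq[OF lam it_bound]
  \<comment> \<open>\<open>vs n\<close> is the maximum of v, 0, u_1, ..., u_n. It lies above u_n, as
    \<open>energy_step\<close> requires, and below the limit, so it is squeezed to the
    limit.\<close>
  define vs where "vs = rec_nat (\<lambda>x. max (v x) 0) (\<lambda>n g x. max (g x) (it lam (Suc n) x))"
  have vs0: "vs 0 = (\<lambda>x. max (v x) 0)" and vsS: "vs (Suc n) = (\<lambda>x. max (vs n x) (it lam (Suc n) x))" for n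
    by (simp_all add: vs_def del: it.simps)
  have vsW: "vs n \<in> W" for n
    by (induction n) (auto simp: vs0 vsS v W_pos W_max it_W[OF lam] simp del: it.simps)
  have vs_nn: "0 \<le> vs n x" for n x
    by (induction n) (auto simp: vs0 vsS le_max_iff_disj simp del: it.simps)
  have vs_it: "it lam n x \<le> vs n x" for n x
    by (cases n) (auto simp: vs0 vsS simp del: it.simps(2))
  have vs_le: "AE x in lebesgue. \<forall>n. vs n x \<le> ulim lam x"
    using v(2) AE_it ulim_bounds[OF lam it_bound]
  proof eventually_elim
    case (elim x)
    show ?case
    proof
      fix n show "vs n x \<le> ulim lam x" by (induction n) (use elim in \<open>auto simp: vs0 vsS simp del: it.simps\<close>)
    qed
  qed
  have vs_M: "AE x in lebesgue. vs n x \<le> M" for n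
    using vs_le ulim_bounds[OF lam it_bound] by eventually_elim (meson order_trans)
  have vs_ML: "AE x in L. vs n x \<le> M" for n
    unfolding AE_L using vs_M[of n] by eventually_elim simp
  have v_M: "AE x in L. v x \<le> M"
    unfolding AE_L using v(2) ulim_bounds[OF lam it_bound] by eventually_elim simp
  have "energy lam (vs n) \<le> energy lam v" for n
  proof (induction n)
    case 0
    \<comment> \<open>Taking the positive part lowers the seminorm and raises the primitive, so the
      energy drops.\<close>
    have "G (vs 0) \<le> G v" unfolding vs0 using v by (intro G_mono W_pos) auto
    moreover have "(\<integral>x. Fprim (v x) \<partial>L) \<le> (\<integral>x. Fprim (vs 0 x) \<partial>L)"
      by (rule integral_mono[OF Fprim_integrable[OF v(1) M v_M] Fprim_integrable[OF vsW M vs_ML]])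
         (simp add: vs0 Fprim_mono)
    ultimately show ?case
      unfolding energy_def using p lam by (intro diff_mono divide_right_mono mult_left_mono) auto
  next
    case (Suc n)
    have "AE x in lebesgue. it lam n x \<le> vs n x" using vs_it by simp
    from energy_step[OF vsW this vs_M] Suc show ?case by (simp add: vsS del: it.simps)
  qed
  then have le: "G (vs n) \<le> p * (energy lam v + lam * (\<integral>x. Fprim (vs n x) \<partial>L))" for n
    using p by (simp add: energy_def field_simps)
  have lim: "AE x in lebesgue. (\<lambda>n. vs n x) \<longlonglongrightarrow> ulim lam x"
    using AE_it vs_le
  proof eventually_elim
    case (elim x)
    show ?case
      by (rule tendsto_sandwich[of "\<lambda>n. it lam n x" _ _ "\<lambda>n. ulim lam x"])
         (use elim vs_it in \<open>auto intro: always_eventually simp del: it.simps\<close>)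
  qed
  have "(\<lambda>n. \<integral>x. Fprim (vs n x) \<partial>L) \<longlonglongrightarrow> (\<integral>x. Fprim (ulim lam x) \<partial>L)"
  proof (rule integral_dominated_convergence)
    show "integrable L (\<lambda>x. \<bar>Fprim 0\<bar> + f M * M)" by simp
    show "(\<lambda>x. Fprim (ulim lam x)) \<in> borel_measurable L" "(\<lambda>x. Fprim (vs n x)) \<in> borel_measurable L" for n
      using W_meas_L[OF vsW[of n]] measurable_L[OF ulim_meas[OF lam it_bound]] by measurable
    show "AE x in L. (\<lambda>n. Fprim (vs n x)) \<longlonglongrightarrow> Fprim (ulim lam x)"
      unfolding AE_L using lim
      by eventually_elim (auto intro: isCont_tendsto_compose[OF DERIV_isCont[OF Fprim_deriv]])
    show "AE x in L. norm (Fprim (vs n x)) \<le> \<bar>Fprim 0\<bar> + f M * M" for n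
      using vs_ML[of n]
    proof eventually_elim
      case (elim x)
      have "f M * \<bar>vs n x\<bar> \<le> f M * M" using elim vs_nn[of n x] f_pos(2)[OF M] by (intro mult_left_mono) auto
      then show ?case using Fprim_bound[OF M elim] by simp
    qed
  qed
  then have "(\<lambda>n. p * (energy lam v + lam * (\<integral>x. Fprim (vs n x) \<partial>L)))
      \<longlonglongrightarrow> p * (energy lam v + lam * (\<integral>x. Fprim (ulim lam x) \<partial>L))"
    by (intro tendsto_intros)
  from G_lsc(2)[OF vsW ulim_meas[OF lam it_bound] lim le this]
  show ?thesis using p by (simp add: energy_def field_simps)
qed

text \<open>The competitor u - t \<phi> lies below u because \<phi> \<ge> 0. The weak equation
  tested with \<phi> cancels the first-order terms, so the energy inequality becomes one between the
  two remainders.\<close>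

lemma ulim_second_order:
  assumes phi: "\<phi> \<in> W" "\<And>x. 0 \<le> \<phi> x" and t: "0 < t"
  shows "integrable gmeas (\<lambda>z. taylor_rem p (dif (ulim lam) z) (dif \<phi> z) t)"
    "integrable L (\<lambda>x. (Fprim (ulim lam x - t * \<phi> x) - Fprim (ulim lam x) + t * f (max (ulim lam x) 0) * \<phi> x) / t\<^sup>2)"
    "lam * p * (\<integral>x. (Fprim (ulim lam x - t * \<phi> x) - Fprim (ulim lam x) + t * f (max (ulim lam x) 0) * \<phi> x) / t\<^sup>2 \<partial>L)
      \<le> (\<integral>z. taylor_rem p (dif (ulim lam) z) (dif \<phi> z) t \<partial>gmeas)"
proof -
  define u where "u = ulim lam"
  define v where "v = (\<lambda>x. u x - t * \<phi> x)"
  have uW: "u \<in> W" unfolding u_def by (rule ulim_W[OF lam it_bound])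
  have vW: "v \<in> W" unfolding v_def using W_lin[OF uW phi(1), of 1 "- t"] by simp
  have dv: "dif v z = dif u z - t * dif \<phi> z" for z by (simp add: v_def dif_def algebra_simps)
  have u_nn: "AE x in L. 0 \<le> u x" and u_M: "AE x in L. u x \<le> M"
    unfolding AE_L u_def using ulim_bounds[OF lam it_bound] by (eventually_elim, simp)+
  have v_M: "AE x in L. v x \<le> M"
    using u_M
  proof eventually_elim
    case (elim x)
    have "0 \<le> t * \<phi> x" using t phi(2)[of x] by simp
    then show ?case using elim unfolding v_def by linarith
  qed
  have i: "integrable gmeas (\<lambda>z. \<bar>dif v z\<bar> powr p)" "integrable gmeas (\<lambda>z. \<bar>dif u z\<bar> powr p)"
    "integrable gmeas (\<lambda>z. jp p (dif u z) * dif \<phi> z)"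
    using uW vW A_integrable[OF uW phi(1)] by (auto simp: W_iff)
  have R_eq: "taylor_rem p (dif u z) (dif \<phi> z) t
      = (\<bar>dif v z\<bar> powr p - \<bar>dif u z\<bar> powr p + p * t * (jp p (dif u z) * dif \<phi> z)) / t\<^sup>2" for z
    by (simp add: taylor_rem_def dv mult.assoc)
  show "integrable gmeas (\<lambda>z. taylor_rem p (dif (ulim lam) z) (dif \<phi> z) t)"
    unfolding u_def[symmetric] R_eq using i by auto
  have "(\<integral>z. \<bar>dif v z\<bar> powr p - \<bar>dif u z\<bar> powr p + p * t * (jp p (dif u z) * dif \<phi> z) \<partial>gmeas)
      = G v - G u + p * t * A u \<phi>"
    unfolding G_def A_def using i by simp
  then have RI: "(\<integral>z. taylor_rem p (dif u z) (dif \<phi> z) t \<partial>gmeas) = (G v - G u + p * t * A u \<phi>) / t\<^sup>2"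
    unfolding R_eq by (simp only: integral_divide_zero)
  have k: "integrable L (\<lambda>x. Fprim (v x))" "integrable L (\<lambda>x. Fprim (u x))"
    using Fprim_integrable[OF vW M v_M] Fprim_integrable[OF uW M u_M] .
  have h: "bounded_rhs (rhs lam u) (lam * f M)" "is_minimizer (rhs lam u) u"
    unfolding u_def using ulim_rhs[OF lam it_bound] ulim_minimizer[OF lam it_bound] by auto
  have k3': "integrable L (\<lambda>x. rhs lam u x * \<phi> x / lam)"
    using rhs_mult_integrable[OF h(1) phi(1)] by simp
  have eq3: "AE x in L. rhs lam u x * \<phi> x / lam = f (max (u x) 0) * \<phi> x"
    using u_nn by eventually_elim (use lam in \<open>auto simp: rhs_def max_absorb1\<close>)
  have m3: "(\<lambda>x. f (max (u x) 0) * \<phi> x) \<in> borel_measurable L"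
    using W_meas_L[OF uW] W_meas_L[OF phi(1)] by measurable
  have k3: "integrable L (\<lambda>x. f (max (u x) 0) * \<phi> x)"
    using k3' m3 eq3 by (rule integrable_cong_AE_imp)
  have "lam * (\<integral>x. f (max (u x) 0) * \<phi> x \<partial>L) = lam * (\<integral>x. rhs lam u x * \<phi> x / lam \<partial>L)"
    using integral_cong_AE[OF borel_measurable_integrable[OF k3'] m3 eq3] by simp
  also have "\<dots> = A u \<phi>" using minimizer_weak[OF h phi(1)] lam by simp
  finally have Aeq: "A u \<phi> = lam * (\<integral>x. f (max (u x) 0) * \<phi> x \<partial>L)" ..
  let ?Q = "\<lambda>x. (Fprim (v x) - Fprim (u x) + t * (f (max (u x) 0) * \<phi> x)) / t\<^sup>2"
  have Q_eq: "(Fprim (u x - t * \<phi> x) - Fprim (u x) + t * f (max (u x) 0) * \<phi> x) / t\<^sup>2 = ?Q x" for x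
    by (simp add: v_def mult.assoc)
  show "integrable L (\<lambda>x. (Fprim (ulim lam x - t * \<phi> x) - Fprim (ulim lam x) + t * f (max (ulim lam x) 0) * \<phi> x) / t\<^sup>2)"
    unfolding u_def[symmetric] Q_eq using k k3 by auto
  have QI: "integral\<^sup>L L ?Q = ((\<integral>x. Fprim (v x) \<partial>L) - (\<integral>x. Fprim (u x) \<partial>L) + t * (\<integral>x. f (max (u x) 0) * \<phi> x \<partial>L)) / t\<^sup>2"
    using k k3 by simp
  have "AE x in lebesgue. v x \<le> ulim lam x" using t phi(2) by (simp add: v_def u_def)
  from ulim_energy_minimal[OF vW this]
  have "lam * ((\<integral>x. Fprim (v x) \<partial>L) - (\<integral>x. Fprim (u x) \<partial>L)) \<le> (G v - G u) / p"
    by (simp add: energy_def u_def right_diff_distrib diff_divide_distrib)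
  then have "p * (lam * ((\<integral>x. Fprim (v x) \<partial>L) - (\<integral>x. Fprim (u x) \<partial>L))) \<le> G v - G u"
    using p by (simp add: pos_le_divide_eq mult.commute)
  then have "p * (lam * ((\<integral>x. Fprim (v x) \<partial>L) - (\<integral>x. Fprim (u x) \<partial>L))) + p * t * A u \<phi> \<le> G v - G u + p * t * A u \<phi>"
    by simp
  then have "lam * p * integral\<^sup>L L ?Q \<le> (G v - G u + p * t * A u \<phi>) / t\<^sup>2"
    unfolding QI Aeq times_divide_eq_right
    by (intro divide_right_mono) (simp_all add: algebra_simps)
  then show "lam * p * (\<integral>x. (Fprim (ulim lam x - t * \<phi> x) - Fprim (ulim lam x) + t * f (max (ulim lam x) 0) * \<phi> x) / t\<^sup>2 \<partial>L)
      \<le> (\<integral>z. taylor_rem p (dif (ulim lam) z) (dif \<phi> z) t \<partial>gmeas)"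
    unfolding u_def[symmetric] Q_eq RI .
qed

text \<open>The limit of \<open>ulim_second_order\<close> along t tending to 0. Dominated
  convergence on the left-hand energy shows in passing that the weighted double integral is finite;
  nonnegativity of the other remainder, from convexity of the primitive, permits Fatou.\<close>

lemma stability_inequality:
  assumes phi: "\<phi> \<in> W" "\<And>x. 0 \<le> \<phi> x"
    and C: "p < 2 \<Longrightarrow> 0 < C \<and> (AE z in gmeas. \<bar>dif \<phi> z\<bar> \<le> C * \<bar>dif (ulim lam) z\<bar>)"
  shows "ennreal lam * (\<integral>\<^sup>+x. ennreal (deriv f (ulim lam x) * (\<phi> x)\<^sup>2) \<partial>L)
    \<le> ennreal (p - 1) * (\<integral>\<^sup>+z. ennreal (stability_weight p (ulim lam) (fst z) (snd z) * (dif \<phi> z)\<^sup>2) \<partial>gmeas)"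
proof -
  define u where "u = ulim lam"
  \<comment> \<open>For p < 2 the majorant of \<open>taylor_rem_le_less2\<close> holds up to t = 1 /
    (2 C) only.\<close>
  define t0 where "t0 = (if p < 2 then min 1 (1 / (2 * C)) else 1)"
  have t0: "0 < t0" "t0 \<le> 1" "p < 2 \<Longrightarrow> t0 \<le> 1 / (2 * C)" using C by (auto simp: t0_def)
  define t where "t n = t0 / real (Suc n)" for n
  have t: "0 < t n" "t n \<le> t0" for n using t0 by (auto simp: t_def divide_le_eq)
  have tlim: "t \<longlonglongrightarrow> 0"
    using tendsto_mult[OF tendsto_const[of t0] LIMSEQ_inverse_real_of_nat]
    by (simp add: t_def[abs_def] divide_inverse)
  define w where "w z = (if p = 2 then 1 else \<bar>dif u z\<bar> powr (p - 2)) * (dif \<phi> z)\<^sup>2" for z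
  have wstab: "w z = stability_weight p u (fst z) (snd z) * (dif \<phi> z)\<^sup>2" for z
    by (simp add: w_def stability_weight_def dif_def)
  define R where "R n z = taylor_rem p (dif u z) (dif \<phi> z) (t n)" for n z
  define Q where "Q n x = (Fprim (u x - t n * \<phi> x) - Fprim (u x) + t n * f (max (u x) 0) * \<phi> x) / (t n)\<^sup>2" for n x
  have uW: "u \<in> W" unfolding u_def by (rule ulim_W[OF lam it_bound])
  have RQ: "integrable gmeas (R n)" "integrable L (Q n)" "lam * p * integral\<^sup>L L (Q n) \<le> integral\<^sup>L gmeas (R n)" for n
    unfolding R_def[abs_def] Q_def[abs_def] u_def using ulim_second_order[OF phi t(1)[of n]] by simp_all
  have w_meas: "w \<in> borel_measurable gmeas"
    unfolding w_def using W_meas_dif[OF uW] W_meas_dif[OF phi(1)] by measurable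
  define K where "K = (if p < 2 then p * (p - 1) / 2 * (1 / 2) powr (p - 2) * C\<^sup>2 else p * (p - 1) / 2 * 2 powr p)"
  have dom_int: "integrable gmeas (\<lambda>z. K * (\<bar>dif u z\<bar> powr p + \<bar>dif \<phi> z\<bar> powr p))"
    using uW phi by (auto simp: W_iff)
  have Rlim: "AE z in gmeas. (\<lambda>n. R n z) \<longlonglongrightarrow> p * (p - 1) / 2 * w z"
  proof -
    have "AE z in gmeas. 2 \<le> p \<or> dif u z \<noteq> 0 \<or> dif \<phi> z = 0"
    proof (cases "p < 2")
      case True
      then have "AE z in gmeas. \<bar>dif \<phi> z\<bar> \<le> C * \<bar>dif u z\<bar>" using C by (simp add: u_def)
      then show ?thesis by eventually_elim auto
    qed auto
    then show ?thesis
      by eventually_elim (use taylor_rem_tendsto[OF p _ t(1) tlim] in \<open>simp add: R_def w_def\<close>)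
  qed
  have Rbound: "AE z in gmeas. norm (R n z) \<le> K * (\<bar>dif u z\<bar> powr p + \<bar>dif \<phi> z\<bar> powr p)" for n
  proof (cases "p < 2")
    case True
    then have "AE z in gmeas. \<bar>dif \<phi> z\<bar> \<le> C * \<bar>dif u z\<bar>" using C by (simp add: u_def)
    then show ?thesis
    proof eventually_elim
      case (elim z)
      have K0: "0 \<le> K" using p by (simp add: K_def)
      have "R n z \<le> K * \<bar>dif u z\<bar> powr p"
        using taylor_rem_le_less2[OF p True t(1) order_trans[OF t(2) t0(3)[OF True]] _ elim] C True
        by (simp add: R_def K_def)
      also have "\<dots> \<le> K * (\<bar>dif u z\<bar> powr p + \<bar>dif \<phi> z\<bar> powr p)" using K0 by (intro mult_left_mono) auto
      finally show ?case using taylor_rem_nonneg[OF p] by (simp add: R_def)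
    qed
  next
    case False
    then show ?thesis
      using taylor_rem_nonneg[OF p] taylor_rem_le_ge2[of p "t n"] t[of n] t0 by (intro AE_I2) (simp add: R_def K_def)
  qed
  have RIlim: "(\<lambda>n. integral\<^sup>L gmeas (R n)) \<longlonglongrightarrow> (\<integral>z. p * (p - 1) / 2 * w z \<partial>gmeas)"
    and w_int': "integrable gmeas (\<lambda>z. p * (p - 1) / 2 * w z)"
    using integral_dominated_convergence[OF _ _ dom_int Rlim Rbound]
      integrable_dominated_convergence[OF _ _ dom_int Rlim Rbound] w_meas RQ(1) by auto
  have "integrable gmeas (\<lambda>z. 2 / (p * (p - 1)) * (p * (p - 1) / 2 * w z))"
    using w_int' by (rule integrable_mult_right)
  then have w_int: "integrable gmeas w" using p by simp
  have w_nn: "0 \<le> w z" for z by (simp add: w_def)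
  define Iw where "Iw = integral\<^sup>L gmeas w"
  have Iw: "0 \<le> Iw" "(\<integral>\<^sup>+z. ennreal (w z) \<partial>gmeas) = ennreal Iw"
    unfolding Iw_def using nn_integral_eq_integral[OF w_int] Bochner_Integration.integral_nonneg[OF w_nn, of gmeas] w_nn
    by auto
  have Qnn: "0 \<le> Q n x" for n x
    using Fprim_tangent[of "u x" "u x - t n * \<phi> x"] by (simp add: Q_def algebra_simps)
  \<comment> \<open>As u > 0 in \<open>Om\<close>, the extended nonlinearity agrees with f near
    u(x), so its derivative there is f'(u(x)).\<close>
  have Qlim: "AE x in L. (\<lambda>n. Q n x) \<longlonglongrightarrow> deriv f (u x) * (\<phi> x)\<^sup>2 / 2"
    using ulim_pos[OF lam it_bound]
  proof eventually_elim
    case (elim x)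
    have "((\<lambda>t. f (max t 0)) has_real_derivative deriv f (u x)) (at (u x))"
      by (rule has_field_derivative_transform_within_open[OF f_deriv, of "{0<..}"])
         (use elim in \<open>auto simp: u_def\<close>)
    from second_order_tendsto[OF Fprim_deriv this t(1) tlim, of "\<phi> x"]
    show ?case by (simp add: Q_def)
  qed
  have "(\<integral>\<^sup>+x. ennreal (deriv f (u x) * (\<phi> x)\<^sup>2 / 2) \<partial>L) = (\<integral>\<^sup>+x. liminf (\<lambda>n. ennreal (Q n x)) \<partial>L)"
  proof (rule nn_integral_cong_AE)
    show "AE x in L. ennreal (deriv f (u x) * (\<phi> x)\<^sup>2 / 2) = liminf (\<lambda>n. ennreal (Q n x))"
      using Qlim by eventually_elim (rule lim_imp_Liminf[symmetric, OF sequentially_bot tendsto_ennrealI])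
  qed
  also have "\<dots> \<le> liminf (\<lambda>n. \<integral>\<^sup>+x. ennreal (Q n x) \<partial>L)"
    using RQ(2) by (intro nn_integral_liminf) auto
  also have "\<dots> \<le> liminf (\<lambda>n. ennreal (integral\<^sup>L gmeas (R n) / (lam * p)))"
  proof (intro Liminf_mono always_eventually allI)
    fix n
    have "(\<integral>\<^sup>+x. ennreal (Q n x) \<partial>L) = ennreal (integral\<^sup>L L (Q n))"
      using RQ(2) Qnn by (intro nn_integral_eq_integral) auto
    also have "\<dots> \<le> ennreal (integral\<^sup>L gmeas (R n) / (lam * p))"
      using RQ(3)[of n] lam p by (intro ennreal_leI) (simp add: field_simps)
    finally show "(\<integral>\<^sup>+x. ennreal (Q n x) \<partial>L) \<le> ennreal (integral\<^sup>L gmeas (R n) / (lam * p))" .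
  qed
  also have "\<dots> = ennreal ((p - 1) / 2 * Iw / lam)"
  proof (rule lim_imp_Liminf[OF sequentially_bot tendsto_ennrealI])
    have "(\<lambda>n. integral\<^sup>L gmeas (R n) / (lam * p)) \<longlonglongrightarrow> (p * (p - 1) / 2 * Iw) / (lam * p)"
      using RIlim unfolding Iw_def by (intro tendsto_intros) (use lam p in auto)
    moreover have "(p * (p - 1) / 2 * Iw) / (lam * p) = (p - 1) / 2 * Iw / lam" using lam p by simp
    ultimately show "(\<lambda>n. integral\<^sup>L gmeas (R n) / (lam * p)) \<longlonglongrightarrow> (p - 1) / 2 * Iw / lam" by simp
  qed
  finally have half: "(\<integral>\<^sup>+x. ennreal (deriv f (u x) * (\<phi> x)\<^sup>2 / 2) \<partial>L) \<le> ennreal ((p - 1) / 2 * Iw / lam)" .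
  have "ennreal a = 2 * ennreal (a / 2)" for a :: real
    by (cases "0 \<le> a") (auto simp: ennreal_neg ennreal_mult'[symmetric] simp flip: ennreal_numeral)
  then have "(\<integral>\<^sup>+x. ennreal (deriv f (u x) * (\<phi> x)\<^sup>2) \<partial>L) = (\<integral>\<^sup>+x. 2 * ennreal (deriv f (u x) * (\<phi> x)\<^sup>2 / 2) \<partial>L)"
    by (intro nn_integral_cong)
  also have "\<dots> = 2 * (\<integral>\<^sup>+x. ennreal (deriv f (u x) * (\<phi> x)\<^sup>2 / 2) \<partial>L)"
  proof (rule nn_integral_cmult)
    show "(\<lambda>x. ennreal (deriv f (u x) * (\<phi> x)\<^sup>2 / 2)) \<in> borel_measurable L"
      using W_meas_L[OF uW] W_meas_L[OF phi(1)] deriv_f_meas by measurable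
  qed
  also have "\<dots> \<le> 2 * ennreal ((p - 1) / 2 * Iw / lam)" using half by (rule mult_left_mono) simp
  also have "\<dots> = ennreal ((p - 1) * Iw / lam)"
    using p Iw lam by (simp add: ennreal_mult'[symmetric] flip: ennreal_numeral)
  finally have fin: "(\<integral>\<^sup>+x. ennreal (deriv f (u x) * (\<phi> x)\<^sup>2) \<partial>L) \<le> ennreal ((p - 1) * Iw / lam)" .
  have "ennreal lam * (\<integral>\<^sup>+x. ennreal (deriv f (u x) * (\<phi> x)\<^sup>2) \<partial>L) \<le> ennreal lam * ennreal ((p - 1) * Iw / lam)"
    using fin by (rule mult_left_mono) simp
  also have "\<dots> = ennreal (p - 1) * ennreal Iw"
    using lam p Iw by (simp add: ennreal_mult'[symmetric])
  finally show "ennreal lam * (\<integral>\<^sup>+x. ennreal (deriv f (ulim lam x) * (\<phi> x)\<^sup>2) \<partial>L)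
    \<le> ennreal (p - 1) * (\<integral>\<^sup>+z. ennreal (stability_weight p (ulim lam) (fst z) (snd z) * (dif \<phi> z)\<^sup>2) \<partial>gmeas)"
    unfolding Iw(2)[symmetric] wstab u_def .
qed

end

end

context fractional_problem
begin

text \<open>Passing from \<phi> to |\<phi>| leaves the second integral unchanged, does not increase
  the first, and keeps the domination by differences of u that defines the test space for p < 2. So
  nonnegative test functions suffice.\<close>

lemma ulim_stable:
  assumes lam: "0 < lam" and it_bound: "\<And>n. AE x in lebesgue. it lam n x \<le> M" and M: "0 \<le> M"
  shows "stable_solution_P s p Om f lam (ulim lam)"
  unfolding stable_solution_P_def
proof (intro conjI ballI)
  show "solution_P s p Om f lam (ulim lam)" by (rule ulim_solution[OF lam it_bound])
  define u where "u = ulim lam"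
  fix \<phi> assume test: "\<phi> \<in> stability_test_space s p Om (ulim lam)"
  define \<psi> where "\<psi> = (\<lambda>x. \<bar>\<phi> x\<bar>)"
  have phi: "\<phi> \<in> W" using test by (auto simp: stability_test_space_def split: if_splits)
  then have psi: "\<psi> \<in> W" "\<And>x. 0 \<le> \<psi> x" unfolding \<psi>_def by (auto intro: W_abs)
  have dif_le: "\<bar>dif \<psi> z\<bar> \<le> \<bar>dif \<phi> z\<bar>" for z by (simp add: \<psi>_def dif_def)
  have "\<exists>C. p < 2 \<longrightarrow> 0 < C \<and> (AE z in gmeas. \<bar>dif \<psi> z\<bar> \<le> C * \<bar>dif (ulim lam) z\<bar>)"
  proof (cases "p < 2")
    case True
    then obtain C where C: "0 < C" "AE (x, y) in lebesgue. \<bar>\<phi> x - \<phi> y\<bar> \<le> C * \<bar>ulim lam x - ulim lam y\<bar>"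
      using test by (auto simp: stability_test_space_def)
    have "AE z in gmeas. \<bar>dif \<psi> z\<bar> \<le> C * \<bar>dif (ulim lam) z\<bar>"
      using AE_gmeas[OF C(2)]
    proof eventually_elim
      case (elim z)
      then have "\<bar>dif \<phi> z\<bar> \<le> C * \<bar>dif (ulim lam) z\<bar>" by (simp only: dif_def case_prod_unfold)
      with dif_le[of z] show ?case by (rule order_trans)
    qed
    then show ?thesis using C by blast
  qed blast
  then obtain C where C: "p < 2 \<Longrightarrow> 0 < C \<and> (AE z in gmeas. \<bar>dif \<psi> z\<bar> \<le> C * \<bar>dif (ulim lam) z\<bar>)"
    by blast
  define X where "X = (\<integral>\<^sup>+x\<in>Om. ennreal (deriv f (u x) * (\<phi> x)\<^sup>2) \<partial>lebesgue)"
  define Y where "Y = (\<integral>\<^sup>+(x, y). ennreal (stability_weight p u x y * (\<phi> x - \<phi> y)\<^sup>2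
      / norm (x - y) powr (real DIM('a) + p * s)) \<partial>lebesgue)"
  have uW: "u \<in> W" unfolding u_def by (rule ulim_W[OF lam it_bound])
  have X_eq: "(\<integral>\<^sup>+x. ennreal (deriv f (u x) * (\<psi> x)\<^sup>2) \<partial>L) = X"
    unfolding X_def \<psi>_def by (subst nn_integral_restrict_space) auto
  have "(\<integral>\<^sup>+z. ennreal (stability_weight p u (fst z) (snd z) * (dif \<psi> z)\<^sup>2) \<partial>gmeas)
      \<le> (\<integral>\<^sup>+z. ennreal (stability_weight p u (fst z) (snd z) * (dif \<phi> z)\<^sup>2) \<partial>gmeas)"
    using dif_le
    by (intro nn_integral_mono ennreal_leI mult_left_mono) (auto simp: stability_weight_def abs_le_square_iff)
  also have "\<dots> = Y"
  proof -
    have "(\<lambda>z. if p = 2 then 1 else \<bar>dif u z\<bar> powr (p - 2)) \<in> borel_measurable lebesgue"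
      using borel_measurable_dif[OF W_meas[OF uW]] by measurable
    then have m: "(\<lambda>z. (if p = 2 then 1 else \<bar>dif u z\<bar> powr (p - 2)) * (dif \<phi> z)\<^sup>2) \<in> borel_measurable lebesgue"
      using borel_measurable_dif[OF W_meas[OF phi]] by measurable
    have sw: "stability_weight p u (fst z) (snd z) = (if p = 2 then 1 else \<bar>dif u z\<bar> powr (p - 2))" for z
      by (simp add: stability_weight_def dif_def)
    have "(\<integral>\<^sup>+z. ennreal (stability_weight p u (fst z) (snd z) * (dif \<phi> z)\<^sup>2) \<partial>gmeas)
        = (\<integral>\<^sup>+z. ennreal (gker z) * ennreal ((if p = 2 then 1 else \<bar>dif u z\<bar> powr (p - 2)) * (dif \<phi> z)\<^sup>2) \<partial>lebesgue)"
      unfolding gmeas_def sw using borel_measurable_gker m by (subst nn_integral_density) auto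
    also have "\<dots> = Y"
      unfolding Y_def
      by (intro nn_integral_cong)
         (auto simp: stability_weight_def dif_def gker_def mult.commute simp flip: ennreal_mult')
    finally show ?thesis .
  qed
  finally have "ennreal lam * X \<le> ennreal (p - 1) * Y"
    using stability_inequality[OF lam it_bound M psi C] unfolding u_def[symmetric] X_eq
    by (meson mult_left_mono order_trans zero_le)
  then have "ereal lam * enn2ereal X \<le> ereal (p - 1) * enn2ereal Y"
    using lam p by (simp add: less_eq_ennreal.rep_eq times_ennreal.rep_eq enn2ereal_ennreal)
  then show "0 \<le> ereal (p - 1) * enn2ereal (\<integral>\<^sup>+(x, y). ennreal (stability_weight p (ulim lam) x y * (\<phi> x - \<phi> y)\<^sup>2
      / norm (x - y) powr (real DIM('a) + p * s)) \<partial>lebesgue)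
      - ereal lam * enn2ereal (\<integral>\<^sup>+x\<in>Om. ennreal (deriv f (ulim lam x) * (\<phi> x)\<^sup>2) \<partial>lebesgue)"
    unfolding X_def Y_def u_def by (rule ereal_diff_positive)
qed

section \<open>The set of solvable parameters and its supremum\<close>

lemma it_bounded_by_solution:
  assumes "0 < lam" "lam \<le> mu" "solution_P s p Om f mu w" "essentially_bounded_on Om w"
  shows "\<exists>M\<ge>0. \<forall>n. AE x in lebesgue. it lam n x \<le> M"
proof -
  obtain M where M: "AE x in lebesgue. x \<in> Om \<longrightarrow> \<bar>w x\<bar> \<le> M"
    using assms(4) by (auto simp: essentially_bounded_on_def)
  have "AE x in lebesgue. it lam n x \<le> max M 0" for n
    using it_le_solution[OF assms(1-3), of n] M W_zero_outside[OF it_W[OF assms(1)], of n]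
  proof eventually_elim
    case (elim x)
    then show ?case by (cases "x \<in> Om") auto
  qed
  then show ?thesis by (intro exI[of _ "max M 0"]) auto
qed

definition solvable :: "real set" where
  "solvable = {lam. 0 < lam \<and> (\<exists>v. solution_P s p Om f lam v \<and> essentially_bounded_on Om v)}"

lemma solvable_small: "c0 / f 1 \<in> solvable"
proof -
  have lam: "0 < c0 / f 1" using c0_pos f_pos(2)[of 1] by simp
  have "AE x in lebesgue. it (c0 / f 1) n x \<le> 1" for n
    using f_pos(2)[of 1] by (intro it_le_one[OF lam]) simp
  from ulim_solution[OF lam this] ulim_bounded[OF lam this] lam show ?thesis
    unfolding solvable_def by blast
qed

lemma solvable_bdd_above: "bdd_above solvable"
proof -
  obtain c where c: "0 < c" "\<And>t. 0 \<le> t \<Longrightarrow> c * (1 + t) powr (p - 1) \<le> f t"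
    using f_lower_bound by blast
  let ?I = "\<integral>x. \<bar>bump x\<bar> powr p \<partial>L"
  have "lam \<le> G bump / (c * ?I)" if "lam \<in> solvable" for lam
    using that solution_lambda_bound[OF c, of lam] c(1) bump_integral_pos[OF Om_nonempty]
    by (auto simp: solvable_def pos_le_divide_eq mult.assoc)
  then show ?thesis by (auto simp: bdd_above_def)
qed

end

theorem theorem1p5:
  fixes p s :: real and \<Omega> :: "'a::euclidean_space set" and f :: "real \<Rightarrow> real"
  assumes "p > 1" and "0 < s" and "s < 1"
    and "bounded_C11_domain \<Omega>"
    and "f C1_differentiable_on UNIV" and "mono f" and "f 0 > 0"
    and "filterlim (\<lambda>t. f t / t powr (p - 1)) at_top at_top"
  shows "\<exists>lstar>0. \<exists>u :: real \<Rightarrow> 'a \<Rightarrow> real.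
    (\<forall>lam. 0 < lam \<and> lam < lstar \<longrightarrow>
        minimal_solution_P s p \<Omega> f lam (u lam) \<and>
        essentially_bounded_on \<Omega> (u lam) \<and>
        stable_solution_P s p \<Omega> f lam (u lam)) \<and>
    (\<forall>lam mu. 0 < lam \<and> lam \<le> mu \<and> mu < lstar \<longrightarrow>
        (AE x in lebesgue. x \<in> \<Omega> \<longrightarrow> u lam x \<le> u mu x)) \<and>
    (\<forall>lam>lstar. \<not> (\<exists>v. solution_P s p \<Omega> f lam v \<and> essentially_bounded_on \<Omega> v))"
proof -
  interpret fractional_problem p s \<Omega> f
    using assms by unfold_locales (auto simp: bounded_C11_domain_def)
  let ?ls = "Sup solvable"
  \<comment> \<open>Below the supremum there is a solvable mu > lam, and its bounded solution caps
    the iteration for lam; hence every smaller parameter is solvable too.\<close>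
  have bound: "\<exists>M\<ge>0. \<forall>n. AE x in lebesgue. it lam n x \<le> M" if "0 < lam" "lam < ?ls" for lam
  proof -
    have "solvable \<noteq> {}" using solvable_small by blast
    with that(2) obtain mu where "mu \<in> solvable" "lam < mu" by (rule less_cSupE)
    then show ?thesis using it_bounded_by_solution[OF that(1), of mu] by (auto simp: solvable_def)
  qed
  have ge: "lam \<le> ?ls" if "lam \<in> solvable" for lam
    using that solvable_bdd_above by (rule cSup_upper)
  have pos: "0 < ?ls" using ge[OF solvable_small] solvable_small by (auto simp: solvable_def)
  have sol: "minimal_solution_P s p \<Omega> f lam (ulim lam) \<and> essentially_bounded_on \<Omega> (ulim lam)
      \<and> stable_solution_P s p \<Omega> f lam (ulim lam)" if lam: "0 < lam" "lam < ?ls" for lam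
  proof -
    obtain M where M: "0 \<le> M" "\<And>n. AE x in lebesgue. it lam n x \<le> M" using bound[OF lam] by blast
    show ?thesis
      using ulim_minimal[OF lam(1) M(2)] ulim_bounded[OF lam(1) M(2)] ulim_stable[OF lam(1) M(2,1)] by blast
  qed
  have mono: "AE x in lebesgue. x \<in> \<Omega> \<longrightarrow> ulim lam x \<le> ulim mu x"
    if lam: "0 < lam" "lam \<le> mu" "mu < ?ls" for lam mu
  proof -
    have "lam < ?ls" "0 < mu" using lam by auto
    then obtain M where M: "\<And>n. AE x in lebesgue. it lam n x \<le> M" using bound[OF lam(1)] by blast
    have "solution_P s p \<Omega> f mu (ulim mu)"
      using sol[OF \<open>0 < mu\<close> lam(3)] by (simp add: minimal_solution_P_def)
    from ulim_le_solution[OF lam(1) M lam(2) this] show ?thesis by eventually_elim simp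
  qed
  have "\<not> (\<exists>v. solution_P s p \<Omega> f lam v \<and> essentially_bounded_on \<Omega> v)" if "?ls < lam" for lam
    using ge[of lam] that pos by (auto simp: solvable_def)
  then show ?thesis
    using pos sol mono by (intro exI[of _ ?ls] conjI exI[of _ ulim]) blast+
qed

end
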